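(* Let $m,n\ge1$ be integers. For every i.d.c.s. $(S_t)_{t\ge0}\subset\mathcal O'_C(\mathbb R^n;M_{m\times m})$ with generating distribution $G$, the growth bound of $(S_t)_{t\ge 0}$ is equal to the spectral bound of $G$: $\omega((S_t)_{t\ge0})=s(G)$ (both possibly equal to $+\infty$).
   Context: $M_{m\times m}$ is the set of $m\times m$ complex matrices; $\sigma(B)$ is the spectrum of $B\in M_{m\times m}$. $\mathcal S(\mathbb R^n)$ is the Schwartz space, $\mathcal S(\mathbb R^n;\mathbb C^m)$ its $\mathbb C^m$-valued version, and $\mathcal S'(\mathbb R^n)$ the space of tempered distributions. The Fourier transformation is $(\mathscr F\varphi)(\xi)=\int_{\mathbb R^n}e^{-ix\cdot\xi}\varphi(x)\,dx$ for $\varphi\in\mathcal S(\mathbb R^n)$, and $\langle\mathscr F T,\varphi\rangle=\langle T,\mathscr F\varphi\rangle$ for $T\in\mathcal S'(\mathbb R^n)$; it acts entrywise on matrices of distributions. $\mathcal O_M(\mathbb R^n)$ is the algebra of $\phi\in C^\infty(\mathbb R^n)$ such that for every multiindex $\alpha$ there is $m_\alpha\in\mathbb N_0$ with $\sup_{\xi}(1+|\xi|)^{-m_\alpha}|\partial^\alpha\phi(\xi)|<\infty$. $\mathcal O'_C(\mathbb R^n)$ is the space of rapidly decreasing distributions: $T\in\mathcal D'(\mathbb R^n)$ such that for every $k\in\mathbb N_0$ there is $m_k\in\mathbb N_0$ with $T=\sum_{|\alpha|\le m_k}\partial^\alpha f_{k,\alpha}$, where the $f_{k,\alpha}$ are continuous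 and $f_{k,\alpha}(x)=O(|x|^{-k})$ as $|x|\to\infty$. Equivalently, $\mathcal O'_C(\mathbb R^n)=\{T\in\mathcal S'(\mathbb R^n):T*\varphi\in\mathcal S(\mathbb R^n)\ \forall\varphi\in\mathcal S(\mathbb R^n)\}$. It is a convolution algebra, and $\mathscr F$ is an algebra isomorphism of $\mathcal O'_C(\mathbb R^n)$ onto $\mathcal O_M(\mathbb R^n)$. The topology of $\mathcal O'_C(\mathbb R^n)$ is the one induced, via $T\mapsto (T* )|_{\mathcal S(\mathbb R^n)}$, by the space $L(\mathcal S(\mathbb R^n);\mathcal S(\mathbb R^n))$ of continuous linear operators with the compact-open topology. $\mathcal O'_C(\mathbb R^n;M_{m\times m})$ is the space of $m\times m$ matrices with entries in $\mathcal O'_C(\mathbb R^n)$, with the topology of $\mathcal O'_C(\mathbb R^n)^{m^2}$ and the convolution $S*T=(\sum_{j}S_{i,j}*T_{j,k})_{i,k}$. An i.d.c.s. (infinitely differentiable convolution semigroup) in it is an infinitely differentiable mapping $[0,\infty)\ni t\mapsto S_t\in\mathcal O'_C(\mathbb R^n;M_{m\times m})$ (right derivatives at $0$) such that $S_{s+t}=S_s*S_t$ for all $s,t\ge0$ and $S_0=\mathbb 1_{m\times m}\otimes\delta$ (the identity matrix times the Dirac distribution). Its generating distribution is $G=\frac{d}{dt}\big|_{t=0}S_t$. The spectral bound of $G\in\mathcal O'_C(\mathbb R^n;M_{m\times m})$ is $$s(G)=\sup\{\operatorname{Re}\lambda:\text{there is }\xi\in\mathbb R^n\text{ such that }\lambda\in\sigma((\mathscr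 F G)(\xi))\},$$ finite or $+\infty$. The growth bound of an i.d.c.s. is $$\omega((S_t)_{t\ge0})=\inf\{\omega\in\mathbb R:\ ((e^{-\omega t}S_t\,* )|_{\mathcal S(\mathbb R^n;\mathbb C^m)})_{t\ge0}\subset L(\mathcal S(\mathbb R^n;\mathbb C^m);\mathcal S(\mathbb R^n;\mathbb C^m))\text{ is equicontinuous}\},$$ with $\inf\emptyset=+\infty$. *)

theory Defs
  imports "HOL-Analysis.Analysis" "HOL-Library.Landau_Symbols"
begin

section \<open>Schwartz functions\<close>

definition partial :: "'n \<Rightarrow> (real^'n::finite \<Rightarrow> 'b::real_normed_vector) \<Rightarrow> real^'n \<Rightarrow> 'b" where
  "partial i f x = vector_derivative (\<lambda>t. f (x + t *\<^sub>R axis i 1)) (at 0)"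

text \<open>A multiindex is given by a list \<open>[i\<^sub>1, \<dots>, i\<^sub>k]\<close> of coordinates, standing for
  \<open>\<partial>\<^bsub>i\<^sub>1\<^esub> \<dots> \<partial>\<^bsub>i\<^sub>k\<^esub>\<close>; its order \<open>|\<alpha>|\<close> is the length of the list. On smooth functions the order of
  the list is irrelevant, by symmetry of higher derivatives.\<close>

definition mderiv :: "'n list \<Rightarrow> (real^'n::finite \<Rightarrow> 'b::real_normed_vector) \<Rightarrow> real^'n \<Rightarrow> 'b" where
  "mderiv \<alpha> f = foldr partial \<alpha> f"

definition smooth :: "(real^'n::finite \<Rightarrow> 'b::real_normed_vector) \<Rightarrow> bool" where
  "smooth f \<longleftrightarrow> (\<forall>\<alpha>. mderiv \<alpha> f differentiable_on UNIV)"

definition schwartz :: "(real^'n::finite \<Rightarrow> 'b::real_normed_vector) set" where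
  "schwartz = {f. smooth f \<and>
     (\<forall>k \<alpha>. bdd_above (range (\<lambda>x. (1 + norm x) ^ k * norm (mderiv \<alpha> f x))))}"

definition schwartz_seminorm ::
    "nat \<Rightarrow> 'n list \<Rightarrow> (real^'n::finite \<Rightarrow> 'b::real_normed_vector) \<Rightarrow> real" where
  "schwartz_seminorm k \<alpha> f = (SUP x. (1 + norm x) ^ k * norm (mderiv \<alpha> f x))"

definition schwartz_topology :: "(real^'n::finite \<Rightarrow> 'b::real_normed_vector) topology" where
  "schwartz_topology = topology_generated_by
     {{g \<in> schwartz. schwartz_seminorm k \<alpha> (\<lambda>x. g x - f x) < \<epsilon>} | f k \<alpha> \<epsilon>. f \<in> schwartz \<and> \<epsilon> > 0}"

definition fourier :: "(real^'n::finite \<Rightarrow> complex) \<Rightarrow> real^'n \<Rightarrow> complex" where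
  "fourier \<phi> \<xi> = (\<integral>x. exp (- \<i> * complex_of_real (x \<bullet> \<xi>)) * \<phi> x \<partial>lborel)"

section \<open>Tempered distributions\<close>

text \<open>A tempered distribution is a functional on all functions that vanishes, by convention,
  off the Schwartz space. Thus equality of distributions is equality of functionals.\<close>

type_synonym 'n functional = "(real^'n \<Rightarrow> complex) \<Rightarrow> complex"

definition on_schwartz :: "'n::finite functional \<Rightarrow> 'n functional" where
  "on_schwartz T = (\<lambda>\<phi>. if \<phi> \<in> schwartz then T \<phi> else 0)"

definition tempered :: "'n::finite functional set" where
  "tempered = {T. (\<forall>\<phi>. \<phi> \<notin> schwartz \<longrightarrow> T \<phi> = 0)
     \<and> (\<forall>\<phi>\<in>schwartz. \<forall>\<psi>\<in>schwartz. T (\<lambda>x. \<phi> x + \<psi> x) = T \<phi> + T \<psi>)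
     \<and> (\<forall>c. \<forall>\<phi>\<in>schwartz. T (\<lambda>x. c * \<phi> x) = c * T \<phi>)
     \<and> continuous_map schwartz_topology euclidean T}"

definition regular_dist :: "(real^'n::finite \<Rightarrow> complex) \<Rightarrow> 'n functional" where
  "regular_dist f = on_schwartz (\<lambda>\<phi>. \<integral>x. f x * \<phi> x \<partial>lborel)"

definition delta_dist :: "'n::finite functional" where
  "delta_dist = on_schwartz (\<lambda>\<phi>. \<phi> 0)"

definition dist_mderiv :: "'n list \<Rightarrow> 'n::finite functional \<Rightarrow> 'n functional" where
  "dist_mderiv \<alpha> T = on_schwartz (\<lambda>\<phi>. (-1) ^ length \<alpha> * T (mderiv \<alpha> \<phi>))"

definition dist_fourier :: "'n::finite functional \<Rightarrow> 'n functional" where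
  "dist_fourier T = on_schwartz (\<lambda>\<phi>. T (fourier \<phi>))"

text \<open>\<open>(T * \<phi>)(x) = \<langle>T\<^sub>y, \<phi>(x - y)\<rangle>\<close> and \<open>\<langle>U * V, \<phi>\<rangle> = \<langle>U\<^sub>x, \<langle>V\<^sub>y, \<phi>(x + y)\<rangle>\<rangle>\<close>; the latter is meant for
  rapidly decreasing \<open>V\<close>, for which the inner function of \<open>x\<close> is again in the Schwartz space.\<close>

definition conv_fun :: "'n::finite functional \<Rightarrow> (real^'n \<Rightarrow> complex) \<Rightarrow> real^'n \<Rightarrow> complex" where
  "conv_fun T \<phi> = (\<lambda>x. T (\<lambda>y. \<phi> (x - y)))"

definition conv_dist :: "'n::finite functional \<Rightarrow> 'n functional \<Rightarrow> 'n functional" where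
  "conv_dist U V = on_schwartz (\<lambda>\<phi>. U (\<lambda>x. V (\<lambda>y. \<phi> (x + y))))"

section \<open>The spaces \<open>\<O>\<^sub>M\<close> and \<open>\<O>'\<^sub>C\<close>\<close>

definition OM :: "(real^'n::finite \<Rightarrow> complex) set" where
  "OM = {f. smooth f \<and>
     (\<forall>\<alpha>. \<exists>m::nat. bdd_above (range (\<lambda>\<xi>. norm (mderiv \<alpha> f \<xi>) / (1 + norm \<xi>) ^ m)))}"

text \<open>A distribution of the form \<open>\<Sum>\<^bsub>|\<alpha>| \<le> m\<^esub> \<partial>\<^sup>\<alpha> f\<^sub>\<alpha>\<close> as below extends uniquely from the test functions
  to a tempered distribution (each \<open>f\<^sub>\<alpha>\<close> is bounded), so the rapidly decreasing distributions are
  taken inside the tempered ones, and the representation is an identity of tempered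
  distributions.\<close>

definition OC :: "'n::finite functional set" where
  "OC = {T \<in> tempered. \<forall>k::nat. \<exists>m::nat. \<exists>f :: 'n list \<Rightarrow> real^'n \<Rightarrow> complex.
     (\<forall>\<alpha>. length \<alpha> \<le> m \<longrightarrow> continuous_on UNIV (f \<alpha>) \<and>
        (\<lambda>x. norm (f \<alpha> x)) \<in> O[at_infinity](\<lambda>x. 1 / norm x ^ k)) \<and>
     T = (\<lambda>\<phi>. \<Sum>\<alpha> | length \<alpha> \<le> m. dist_mderiv \<alpha> (regular_dist (f \<alpha>)) \<phi>)}"

text \<open>Continuous linear operators on a (scalar or vector valued) Schwartz space; the first argument
  is the multiplication of values by complex scalars.\<close>

definition schwartz_ops :: "(complex \<Rightarrow> 'b \<Rightarrow> 'b) \<Rightarrow>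
    ((real^'n::finite \<Rightarrow> 'b::real_normed_vector) \<Rightarrow> real^'n \<Rightarrow> 'b) set" where
  "schwartz_ops smul = {u \<in> extensional schwartz.
     continuous_map schwartz_topology schwartz_topology u
     \<and> (\<forall>\<phi>\<in>schwartz. \<forall>\<psi>\<in>schwartz. u (\<lambda>x. \<phi> x + \<psi> x) = (\<lambda>x. u \<phi> x + u \<psi> x))
     \<and> (\<forall>c. \<forall>\<phi>\<in>schwartz. u (\<lambda>x. smul c (\<phi> x)) = (\<lambda>x. smul c (u \<phi> x)))}"

definition compact_open_topology :: "'a topology \<Rightarrow> 'b topology \<Rightarrow> ('a \<Rightarrow> 'b) topology" where
  "compact_open_topology X Y = topology_generated_by
     {{u. continuous_map X Y u \<and> u ` K \<subseteq> V} | K V. compactin X K \<and> openin Y V}"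

definition OC_topology :: "'n::finite functional topology" where
  "OC_topology = pullback_topology OC (\<lambda>T. restrict (conv_fun T) schwartz)
     (subtopology (compact_open_topology schwartz_topology schwartz_topology) (schwartz_ops (*)))"

section \<open>Matrices of rapidly decreasing distributions\<close>

type_synonym ('n, 'm) mfunctional = "'n functional^'m^'m"

definition OC_mat :: "('n::finite, 'm::finite) mfunctional set" where
  "OC_mat = {A. \<forall>i j. A $ i $ j \<in> OC}"

definition OC_mat_topology :: "('n::finite, 'm::finite) mfunctional topology" where
  "OC_mat_topology = pullback_topology OC_mat (\<lambda>A (i, j). A $ i $ j)
     (product_topology (\<lambda>_ :: 'm \<times> 'm. OC_topology) UNIV)"

definition mat_conv ::
    "('n::finite, 'm::finite) mfunctional \<Rightarrow> ('n, 'm) mfunctional \<Rightarrow> ('n, 'm) mfunctional" where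
  "mat_conv A B = (\<chi> i k. (\<lambda>\<phi>. \<Sum>j\<in>UNIV. conv_dist (A $ i $ j) (B $ j $ k) \<phi>))"

definition mat_conv_fun ::
    "('n::finite, 'm::finite) mfunctional \<Rightarrow> (real^'n \<Rightarrow> complex^'m) \<Rightarrow> real^'n \<Rightarrow> complex^'m" where
  "mat_conv_fun A \<phi> = (\<lambda>x. \<chi> i. \<Sum>j\<in>UNIV. conv_fun (A $ i $ j) (\<lambda>y. \<phi> y $ j) x)"

definition mat_scale :: "real \<Rightarrow> ('n::finite, 'm::finite) mfunctional \<Rightarrow> ('n, 'm) mfunctional" where
  "mat_scale r A = (\<chi> i j. (\<lambda>\<phi>. complex_of_real r * (A $ i $ j) \<phi>))"

definition mat_diff ::
    "('n::finite, 'm::finite) mfunctional \<Rightarrow> ('n, 'm) mfunctional \<Rightarrow> ('n, 'm) mfunctional" where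
  "mat_diff A B = (\<chi> i j. (\<lambda>\<phi>. (A $ i $ j) \<phi> - (B $ i $ j) \<phi>))"

definition mat_delta :: "('n::finite, 'm::finite) mfunctional" where
  "mat_delta = (\<chi> i j. if i = j then delta_dist else (\<lambda>\<phi>. 0))"

section \<open>Infinitely differentiable convolution semigroups\<close>

text \<open>Derivative at \<open>t \<ge> 0\<close> of a map on \<open>[0, \<infinity>)\<close>; it is the right derivative for \<open>t = 0\<close>.\<close>

definition has_OC_deriv ::
    "(real \<Rightarrow> ('n::finite, 'm::finite) mfunctional) \<Rightarrow> ('n, 'm) mfunctional \<Rightarrow> real \<Rightarrow> bool" where
  "has_OC_deriv F D t \<longleftrightarrow> limitin OC_mat_topology
     (\<lambda>s. mat_scale (1 / (s - t)) (mat_diff (F s) (F t))) D (at t within {0..})"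

definition OC_smooth :: "(real \<Rightarrow> ('n::finite, 'm::finite) mfunctional) \<Rightarrow> bool" where
  "OC_smooth F \<longleftrightarrow> (\<exists>D :: nat \<Rightarrow> real \<Rightarrow> ('n, 'm) mfunctional.
     D 0 = F \<and> (\<forall>k. \<forall>t\<ge>0. has_OC_deriv (D k) (D (Suc k) t) t))"

definition idcs :: "(real \<Rightarrow> ('n::finite, 'm::finite) mfunctional) \<Rightarrow> bool" where
  "idcs S \<longleftrightarrow> (\<forall>t\<ge>0. S t \<in> OC_mat) \<and> OC_smooth S
     \<and> (\<forall>s\<ge>0. \<forall>t\<ge>0. S (s + t) = mat_conv (S s) (S t)) \<and> S 0 = mat_delta"

definition generating_distribution ::
    "(real \<Rightarrow> ('n::finite, 'm::finite) mfunctional) \<Rightarrow> ('n, 'm) mfunctional \<Rightarrow> bool" where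
  "generating_distribution S G \<longleftrightarrow> has_OC_deriv S G 0"

section \<open>Spectral bound and growth bound\<close>

definition spectrum :: "complex^'m^'m \<Rightarrow> complex set" where
  "spectrum A = {z. \<not> invertible (mat z - A)}"

text \<open>The function in \<open>\<O>\<^sub>M\<close> with which the Fourier transform of a rapidly decreasing distribution is
  identified.\<close>

definition fourier_symbol :: "'n::finite functional \<Rightarrow> real^'n \<Rightarrow> complex" where
  "fourier_symbol T = (THE g. g \<in> OM \<and> dist_fourier T = regular_dist g)"

definition mat_symbol :: "('n::finite, 'm::finite) mfunctional \<Rightarrow> real^'n \<Rightarrow> complex^'m^'m" where
  "mat_symbol G \<xi> = (\<chi> i j. fourier_symbol (G $ i $ j) \<xi>)"

definition spectral_bound :: "('n::finite, 'm::finite) mfunctional \<Rightarrow> ereal" where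
  "spectral_bound G = (SUP z \<in> {z. \<exists>\<xi>. z \<in> spectrum (mat_symbol G \<xi>)}. ereal (Re z))"

definition equicontinuous ::
    "((real^'n::finite \<Rightarrow> 'b::real_normed_vector) \<Rightarrow> real^'n \<Rightarrow> 'b) set \<Rightarrow> bool" where
  "equicontinuous \<U> \<longleftrightarrow> (\<forall>V. openin schwartz_topology V \<and> (\<lambda>x. 0) \<in> V \<longrightarrow>
     (\<exists>W. openin schwartz_topology W \<and> (\<lambda>x. 0) \<in> W \<and> (\<forall>u\<in>\<U>. u ` W \<subseteq> V)))"

definition scaled_ops :: "(real \<Rightarrow> ('n::finite, 'm::finite) mfunctional) \<Rightarrow> real \<Rightarrow>
    ((real^'n \<Rightarrow> complex^'m) \<Rightarrow> real^'n \<Rightarrow> complex^'m) set" where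
  "scaled_ops S \<omega> =
     (\<lambda>t. restrict (mat_conv_fun (mat_scale (exp (- \<omega> * t)) (S t))) schwartz) ` {0..}"

definition growth_bound :: "(real \<Rightarrow> ('n::finite, 'm::finite) mfunctional) \<Rightarrow> ereal" where
  "growth_bound S =
     (INF \<omega> \<in> {\<omega>. scaled_ops S \<omega> \<subseteq> schwartz_ops (*s) \<and> equicontinuous (scaled_ops S \<omega>)}. ereal \<omega>)"

end

theory Submission
  imports Defs "HOL-Probability.Characteristic_Functions" "HOL-Probability.Sinc_Integral"
    "HOL-Computational_Algebra.Fundamental_Theorem_Algebra"
begin

text \<open>
  The Fourier transformation turns the convolution semigroup into a pointwise one. Every
  \<open>T \<in> \<O>'\<^sub>C\<close> has a symbol, the function in \<open>\<O>\<^sub>M\<close> that represents \<open>\<F> T\<close> (\<open>has_symbol_OC\<close>). Let \<open>A\<^sub>t(\<xi>)\<close> be the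
  matrix of the symbols of the entries of \<open>S\<^sub>t\<close>, and \<open>g(\<xi>)\<close> that of \<open>G\<close>. The convolution theorem gives
  \<open>A\<^bsub>s + t\<^esub> = A\<^sub>s A\<^sub>t\<close>, and the differentiability of \<open>S\<close> gives \<open>A\<^sub>t' = g A\<^sub>t = A\<^sub>t g\<close>, also after derivatives in \<open>\<xi>\<close>
  (\<open>idcs_symbol_equation\<close>); so \<open>A\<^sub>t(\<xi>)\<close> is the exponential of \<open>t g(\<xi>)\<close>.

  The spectral bound is at most the growth bound: let \<open>g(\<xi>) v = z v\<close> with \<open>v \<noteq> 0\<close>. Apply the operators
  \<open>e\<^bsup>-\<omega> t\<^esup> S\<^sub>t *\<close> to \<open>\<gamma> v\<close> for the Gaussian \<open>\<gamma>\<close> and evaluate the Fourier transform at \<open>\<xi>\<close>. The result is a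
  nonzero multiple of \<open>e\<^bsup>(z - \<omega>) t\<^esup> v\<close>, and equicontinuity keeps it bounded, so \<open>Re z \<le> \<omega>\<close>
  (\<open>spectrum_le_of_equicontinuous\<close>).

  The growth bound is at most the spectral bound: let \<open>\<omega>' < \<omega>\<close> exceed the spectral bound. For matrices
  of a fixed size, \<open>|A\<^sub>t(\<xi>)| \<le> C e\<^bsup>\<omega>' t\<^esup> (1 + t)\<^sup>N (1 + |g(\<xi>)|)\<^sup>N\<close> with \<open>C\<close> and \<open>N\<close> independent of the matrix
  (\<open>matrix_semigroup_growth\<close>); this uniformity in \<open>\<xi>\<close> is the core of the theorem, since \<open>g\<close> is unbounded
  and need not be diagonalizable. The derivatives of \<open>A\<^sub>t\<close> in \<open>\<xi>\<close> obey a bound of the same kind by Leibniz'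
  rule and Duhamel's formula (\<open>symbol_derivatives_growth\<close>). Hence the functions \<open>e\<^bsup>-\<omega> t\<^esup> A\<^sub>t\<close> form a bounded
  family in \<open>\<O>\<^sub>M\<close>, the multiplications by them are equicontinuous on the Schwartz space, and the Fourier
  transformation, an isomorphism of that space by \<open>fourier_inversion\<close>, carries them to the convolution
  operators (\<open>tame_mat_conv_fun\<close>, \<open>growth_bound_le\<close>).
\<close>

section \<open>Iterated partial derivatives\<close>

lemma mderiv_Nil [simp]: "mderiv [] f = f"
  by (simp add: mderiv_def)

lemma mderiv_Cons [simp]: "mderiv (i # \<alpha>) f = partial i (mderiv \<alpha> f)"
  by (simp add: mderiv_def)

lemma mderiv_append: "mderiv (\<alpha> @ \<beta>) f = mderiv \<alpha> (mderiv \<beta> f)"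
  by (simp add: mderiv_def)

lemma has_vector_derivative_along_axis:
  assumes "(f has_derivative f') (at (x + s *\<^sub>R v))"
  shows "((\<lambda>t. f (x + t *\<^sub>R v)) has_vector_derivative f' v) (at s)"
proof -
  have "((\<lambda>t. x + t *\<^sub>R v) has_derivative (\<lambda>t. t *\<^sub>R v)) (at s)"
    by (auto intro!: derivative_eq_intros)
  then have "((\<lambda>t. f (x + t *\<^sub>R v)) has_derivative (\<lambda>t. f' (t *\<^sub>R v))) (at s)"
    using has_derivative_compose[of "\<lambda>t. x + t *\<^sub>R v" _ s UNIV f f'] assms by simp
  moreover have "f' (t *\<^sub>R v) = t *\<^sub>R f' v" for t
    using assms by (simp add: has_derivative_def linear_simps)
  ultimately show ?thesis by (simp add: has_vector_derivative_def)
qed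

lemma partial_eq:
  assumes "(f has_derivative f') (at x)"
  shows "partial i f x = f' (axis i 1)"
  unfolding partial_def
  by (rule vector_derivative_at) (use assms in \<open>simp add: has_vector_derivative_along_axis\<close>)

lemma differentiable_on_UNIV_at:
  assumes "f differentiable_on UNIV"
  obtains f' where "(f has_derivative f') (at x)"
  using assms by (auto simp: differentiable_on_def differentiable_def)

lemma has_vector_derivative_partial:
  assumes "f differentiable_on UNIV"
  shows "((\<lambda>t. f (x + t *\<^sub>R axis i 1)) has_vector_derivative partial i f (x + s *\<^sub>R axis i 1)) (at s)"
proof -
  obtain f' where f': "(f has_derivative f') (at (x + s *\<^sub>R axis i 1))"
    by (rule differentiable_on_UNIV_at[OF assms])
  from has_vector_derivative_along_axis[OF f'] partial_eq[OF f'] show ?thesis by simp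
qed

lemma partial_const: "partial i (\<lambda>x. c) = (\<lambda>x. 0)"
  by (rule ext, rule partial_eq[THEN trans, OF has_derivative_const]) simp

lemma partial_add:
  assumes "f differentiable_on UNIV" "g differentiable_on UNIV"
  shows "partial i (\<lambda>x. f x + g x) = (\<lambda>x. partial i f x + partial i g x)"
proof
  fix x
  obtain f' g' where *: "(f has_derivative f') (at x)" "(g has_derivative g') (at x)"
    using differentiable_on_UNIV_at assms by metis
  from partial_eq[OF has_derivative_add[OF *]] * show
    "partial i (\<lambda>x. f x + g x) x = partial i f x + partial i g x"
    by (simp add: partial_eq)
qed

lemma partial_linear:
  assumes "bounded_linear h" "f differentiable_on UNIV"
  shows "partial i (\<lambda>x. h (f x)) = (\<lambda>x. h (partial i f x))"
proof
  fix x
  obtain f' where *: "(f has_derivative f') (at x)"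
    by (rule differentiable_on_UNIV_at[OF assms(2)])
  from partial_eq[OF bounded_linear.has_derivative[OF assms(1) *]] * show
    "partial i (\<lambda>x. h (f x)) x = h (partial i f x)"
    by (simp add: partial_eq)
qed

lemma partial_bilinear:
  assumes "bounded_bilinear p" "f differentiable_on UNIV" "g differentiable_on UNIV"
  shows "partial i (\<lambda>x. p (f x) (g x)) = (\<lambda>x. p (partial i f x) (g x) + p (f x) (partial i g x))"
proof
  fix x
  obtain f' g' where *: "(f has_derivative f') (at x)" "(g has_derivative g') (at x)"
    using differentiable_on_UNIV_at assms by metis
  from partial_eq[OF bounded_bilinear.FDERIV[OF assms(1) *]] * show
    "partial i (\<lambda>x. p (f x) (g x)) x = p (partial i f x) (g x) + p (f x) (partial i g x)"
    by (simp add: partial_eq add.commute)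
qed

lemma partial_affine:
  assumes "f differentiable_on UNIV"
  shows "partial i (\<lambda>x. f (a + b *\<^sub>R x)) = (\<lambda>x. b *\<^sub>R partial i f (a + b *\<^sub>R x))"
proof
  fix x
  obtain f' where *: "(f has_derivative f') (at (a + b *\<^sub>R x))"
    by (rule differentiable_on_UNIV_at[OF assms])
  have "((\<lambda>x. a + b *\<^sub>R x) has_derivative (\<lambda>x. b *\<^sub>R x)) (at x)"
    by (auto intro!: derivative_eq_intros)
  then have "((\<lambda>x. f (a + b *\<^sub>R x)) has_derivative (\<lambda>t. f' (b *\<^sub>R t))) (at x)"
    using has_derivative_compose[of "\<lambda>t. a + b *\<^sub>R t" _ x UNIV f f'] * by simp
  from partial_eq[OF this] * show
    "partial i (\<lambda>x. f (a + b *\<^sub>R x)) x = b *\<^sub>R partial i f (a + b *\<^sub>R x)"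
    by (simp add: partial_eq[OF *] has_derivative_def linear_simps)
qed

lemma differentiable_on_bilinear:
  assumes "bounded_bilinear p" "f differentiable_on UNIV" "g differentiable_on UNIV"
  shows "(\<lambda>x. p (f x) (g x)) differentiable_on UNIV"
unfolding differentiable_on_def
proof
  fix x
  obtain f' g' where "(f has_derivative f') (at x)" "(g has_derivative g') (at x)"
    using differentiable_on_UNIV_at assms by metis
  from bounded_bilinear.FDERIV[OF assms(1) this]
  show "(\<lambda>x. p (f x) (g x)) differentiable (at x within UNIV)"
    by (rule differentiableI)
qed

lemma differentiable_on_linear:
  assumes "bounded_linear h" "f differentiable_on UNIV"
  shows "(\<lambda>x. h (f x)) differentiable_on UNIV"
unfolding differentiable_on_def
proof
  fix x
  obtain f' where "(f has_derivative f') (at x)"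
    using differentiable_on_UNIV_at assms by metis
  from bounded_linear.has_derivative[OF assms(1) this]
  show "(\<lambda>x. h (f x)) differentiable (at x within UNIV)"
    by (rule differentiableI)
qed

lemma differentiable_on_affine:
  fixes f :: "'a::real_normed_vector \<Rightarrow> 'b::real_normed_vector"
  assumes "f differentiable_on UNIV"
  shows "(\<lambda>x. f (a + b *\<^sub>R x)) differentiable_on UNIV"
proof -
  have "(\<lambda>x::'a. a + b *\<^sub>R x) differentiable_on UNIV"
    by (intro derivative_intros)
  then show ?thesis
    using differentiable_on_compose[of "\<lambda>x. a + b *\<^sub>R x" UNIV f] assms
      differentiable_on_subset by blast
qed

text \<open>Derivatives are counted because the Fourier transform of a function of finite decay has only
  finitely many of them; \<open>smooth\<close> is the conjunction over all \<open>l\<close>.\<close>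

definition diff_order :: "nat \<Rightarrow> (real^'n::finite \<Rightarrow> 'b::real_normed_vector) \<Rightarrow> bool" where
  "diff_order l f \<longleftrightarrow> (\<forall>\<alpha>. length \<alpha> < l \<longrightarrow> mderiv \<alpha> f differentiable_on UNIV)"

lemma diff_orderD: "diff_order l f \<Longrightarrow> length \<alpha> < l \<Longrightarrow> mderiv \<alpha> f differentiable_on UNIV"
  by (simp add: diff_order_def)

lemma smooth_iff_diff_order: "smooth f \<longleftrightarrow> (\<forall>l. diff_order l f)"
  unfolding smooth_def diff_order_def by blast

lemma smooth_diff_order: "smooth f \<Longrightarrow> diff_order l f"
  by (simp add: smooth_iff_diff_order)

lemma smoothD: "smooth f \<Longrightarrow> mderiv \<alpha> f differentiable_on UNIV"
  by (simp add: smooth_def)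

lemma smooth_differentiable: "smooth f \<Longrightarrow> f differentiable_on UNIV"
  using smoothD[of f "[]"] by simp

lemma smooth_mderiv: "smooth f \<Longrightarrow> smooth (mderiv \<alpha> f)"
  unfolding smooth_def by (metis mderiv_append)

lemma smooth_partial: "smooth f \<Longrightarrow> smooth (partial i f)"
  using smooth_mderiv[of f "[i]"] by simp

lemma smooth_continuous: "smooth f \<Longrightarrow> continuous_on UNIV (mderiv \<alpha> f)"
  using smoothD differentiable_imp_continuous_on by blast

text \<open>Smoothness is the largest property that implies differentiability and passes to partial
  derivatives.\<close>

lemma smooth_coinduct:
  assumes "P f"
    and "\<And>f. P f \<Longrightarrow> f differentiable_on UNIV"
    and "\<And>f i. P f \<Longrightarrow> P (partial i f)"
  shows "smooth f"
proof -
  have "P (mderiv \<alpha> f)" for \<alpha>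
    by (induction \<alpha>) (use assms in auto)
  then show ?thesis using assms(2) by (auto simp: smooth_def)
qed

lemma mderiv_add:
  assumes "diff_order l f" "diff_order l g" "length \<alpha> \<le> l"
  shows "mderiv \<alpha> (\<lambda>x. f x + g x) = (\<lambda>x. mderiv \<alpha> f x + mderiv \<alpha> g x)"
  using assms(3) by (induction \<alpha>) (auto simp: partial_add assms(1,2)[THEN diff_orderD])

lemma mderiv_linear:
  assumes "bounded_linear h" "diff_order l f" "length \<alpha> \<le> l"
  shows "mderiv \<alpha> (\<lambda>x. h (f x)) = (\<lambda>x. h (mderiv \<alpha> f x))"
  using assms(3) by (induction \<alpha>) (auto simp: partial_linear assms(1) assms(2)[THEN diff_orderD])

lemma mderiv_affine:
  assumes "smooth f"
  shows "mderiv \<alpha> (\<lambda>x. f (a + b *\<^sub>R x)) = (\<lambda>x. b ^ length \<alpha> *\<^sub>R mderiv \<alpha> f (a + b *\<^sub>R x))"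
proof (induction \<alpha>)
  case (Cons i \<alpha>)
  have "mderiv (i # \<alpha>) (\<lambda>x. f (a + b *\<^sub>R x))
      = partial i (\<lambda>x. b ^ length \<alpha> *\<^sub>R mderiv \<alpha> f (a + b *\<^sub>R x))"
    by (simp add: Cons)
  also have "\<dots> = (\<lambda>x. b ^ length \<alpha> *\<^sub>R partial i (\<lambda>x. mderiv \<alpha> f (a + b *\<^sub>R x)) x)"
    by (intro partial_linear bounded_linear_scaleR_right differentiable_on_affine smoothD assms)
  finally show ?case by (simp add: partial_affine smoothD assms mult.commute)
qed simp

text \<open>All ways of distributing the derivatives in \<open>\<alpha>\<close> over two factors, as a list with repetitions:
  these replace the binomial coefficients in Leibniz' rule.\<close>

fun splits :: "'n list \<Rightarrow> ('n list \<times> 'n list) list" where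
  "splits [] = [([], [])]"
| "splits (i # \<alpha>) = map (\<lambda>(\<beta>, \<gamma>). (i # \<beta>, \<gamma>)) (splits \<alpha>) @ map (\<lambda>(\<beta>, \<gamma>). (\<beta>, i # \<gamma>)) (splits \<alpha>)"

lemma splits_length: "a \<in> set (splits \<alpha>) \<Longrightarrow> length (fst a) + length (snd a) = length \<alpha>"
  by (induction \<alpha> arbitrary: a) auto

lemma partial_sum_list:
  assumes "\<And>a. a \<in> set as \<Longrightarrow> F a differentiable_on UNIV"
  shows "partial i (\<lambda>x. \<Sum>a\<leftarrow>as. F a x) = (\<lambda>x. \<Sum>a\<leftarrow>as. partial i (F a) x)
    \<and> (\<lambda>x. \<Sum>a\<leftarrow>as. F a x) differentiable_on UNIV"
  using assms
proof (induction as)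
  case Nil
  then show ?case by (simp add: partial_const)
next
  case (Cons a as)
  have d: "F a differentiable_on UNIV" "(\<lambda>x. \<Sum>a\<leftarrow>as. F a x) differentiable_on UNIV"
    using Cons by auto
  have IH: "partial i (\<lambda>x. \<Sum>a\<leftarrow>as. F a x) = (\<lambda>x. \<Sum>a\<leftarrow>as. partial i (F a) x)"
    using Cons by auto
  show ?case
    unfolding list.map sum_list.Cons partial_add[OF d] IH
    by (intro conjI refl differentiable_on_add d)
qed

text \<open>Leibniz' rule. Any bounded bilinear product is allowed, so that it serves for scalar functions and for
  matrices.\<close>

lemma mderiv_bilinear:
  assumes "bounded_bilinear p" "diff_order l f" "diff_order l g" "length \<alpha> \<le> l"
  shows "mderiv \<alpha> (\<lambda>x. p (f x) (g x)) =
    (\<lambda>x. \<Sum>(\<beta>, \<gamma>)\<leftarrow>splits \<alpha>. p (mderiv \<beta> f x) (mderiv \<gamma> g x))"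
  using assms(4)
proof (induction \<alpha>)
  case (Cons i \<alpha>)
  let ?F = "\<lambda>(\<beta>, \<gamma>) x. p (mderiv \<beta> f x) (mderiv \<gamma> g x)"
  have d: "mderiv (fst a) f differentiable_on UNIV" "mderiv (snd a) g differentiable_on UNIV"
    if "a \<in> set (splits \<alpha>)" for a
    using splits_length[OF that] Cons.prems assms by (auto intro: diff_orderD)
  have IH: "mderiv \<alpha> (\<lambda>x. p (f x) (g x)) =
      (\<lambda>x. \<Sum>(\<beta>, \<gamma>)\<leftarrow>splits \<alpha>. p (mderiv \<beta> f x) (mderiv \<gamma> g x))"
    using Cons by auto
  have "mderiv (i # \<alpha>) (\<lambda>x. p (f x) (g x)) = partial i (\<lambda>x. \<Sum>a\<leftarrow>splits \<alpha>. ?F a x)"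
    unfolding mderiv_Cons IH by (simp only: case_prod_unfold)
  also have "\<dots> = (\<lambda>x. \<Sum>a\<leftarrow>splits \<alpha>. partial i (?F a) x)"
    by (rule partial_sum_list[of "splits \<alpha>" ?F, THEN conjunct1])
       (simp add: split_beta differentiable_on_bilinear assms(1) d)
  also have "\<dots> = (\<lambda>x. \<Sum>(\<beta>, \<gamma>)\<leftarrow>splits \<alpha>. p (mderiv (i # \<beta>) f x) (mderiv \<gamma> g x)
      + p (mderiv \<beta> f x) (mderiv (i # \<gamma>) g x))"
    by (intro ext arg_cong[where f = sum_list] map_cong refl)
       (simp add: split_beta partial_bilinear[OF assms(1)] d)
  finally show ?case by (simp add: case_prod_unfold o_def sum_list_addf)
qed simp

lemma diff_order_bilinear:
  fixes f :: "real^'n::finite \<Rightarrow> 'a::real_normed_vector"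
  assumes "bounded_bilinear p" "diff_order l f" "diff_order l g"
  shows "diff_order l (\<lambda>x. p (f x) (g x))"
  unfolding diff_order_def
proof (intro allI impI)
  fix \<alpha> :: "'n list" assume "length \<alpha> < l"
  then have d: "mderiv (fst a) f differentiable_on UNIV" "mderiv (snd a) g differentiable_on UNIV"
    if "a \<in> set (splits \<alpha>)" for a
    using splits_length[OF that] assms by (auto intro: diff_orderD)
  let ?F = "\<lambda>(\<beta>, \<gamma>) x. p (mderiv \<beta> f x) (mderiv \<gamma> g x)"
  have "(\<lambda>x. \<Sum>a\<leftarrow>splits \<alpha>. ?F a x) differentiable_on UNIV"
    by (rule partial_sum_list[of "splits \<alpha>" ?F, THEN conjunct2])
       (simp add: split_beta differentiable_on_bilinear assms(1) d)
  then show "mderiv \<alpha> (\<lambda>x. p (f x) (g x)) differentiable_on UNIV"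
    using \<open>length \<alpha> < l\<close> by (simp add: mderiv_bilinear[OF assms] case_prod_unfold)
qed

lemma diff_order_add:
  assumes "diff_order l f" "diff_order l g"
  shows "diff_order l (\<lambda>x. f x + g x)"
  unfolding diff_order_def
  by (simp add: mderiv_add[OF assms] differentiable_on_add assms[THEN diff_orderD])

lemma diff_order_linear:
  assumes "bounded_linear h" "diff_order l f"
  shows "diff_order l (\<lambda>x. h (f x))"
  unfolding diff_order_def
  by (simp add: mderiv_linear[OF assms] differentiable_on_linear assms(1) assms(2)[THEN diff_orderD])

lemma mderiv_const: "mderiv \<alpha> (\<lambda>x. c) = (\<lambda>x. if \<alpha> = [] then c else 0)"
  by (induction \<alpha>) (auto simp: partial_const)

lemma smooth_const: "smooth (\<lambda>x. c)"
  unfolding smooth_def mderiv_const by (simp only: differentiable_on_const simp_thms)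

lemma smooth_bilinear: "bounded_bilinear p \<Longrightarrow> smooth f \<Longrightarrow> smooth g \<Longrightarrow> smooth (\<lambda>x. p (f x) (g x))"
  by (simp add: smooth_iff_diff_order diff_order_bilinear)

lemmas smooth_mult = smooth_bilinear[OF bounded_bilinear_mult]

lemma smooth_add: "smooth f \<Longrightarrow> smooth g \<Longrightarrow> smooth (\<lambda>x. f x + g x)"
  by (simp add: smooth_iff_diff_order diff_order_add)

lemma smooth_linear: "bounded_linear h \<Longrightarrow> smooth f \<Longrightarrow> smooth (\<lambda>x. h (f x))"
  by (simp add: smooth_iff_diff_order diff_order_linear)

lemma smooth_affine:
  assumes "smooth f" shows "smooth (\<lambda>x. f (a + b *\<^sub>R x))"
  unfolding smooth_def mderiv_affine[OF assms]
  by (intro allI differentiable_on_linear[OF bounded_linear_scaleR_right]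
      differentiable_on_affine smoothD assms)

lemma smooth_sum:
  "(\<And>i. i \<in> I \<Longrightarrow> smooth (f i)) \<Longrightarrow> smooth (\<lambda>x. \<Sum>i\<in>I. f i x)"
  by (induction I rule: infinite_finite_induct) (auto intro: smooth_add smooth_const)

lemma bounded_linear_axis: "bounded_linear (axis i :: 'b::euclidean_space \<Rightarrow> 'b^'m::finite)"
proof -
  have "linear (axis i :: 'b \<Rightarrow> 'b^'m)"
    by (rule linearI) (auto simp: axis_def vec_eq_iff)
  then show ?thesis by (simp add: linear_conv_bounded_linear)
qed

lemma vec_eq_sum_axis: "(v :: 'b::euclidean_space^'m::finite) = (\<Sum>i\<in>UNIV. axis i (v $ i))"
  by (simp add: vec_eq_iff axis_def)

lemma smooth_vec:
  fixes f :: "real^'n::finite \<Rightarrow> ('b::euclidean_space)^'m::finite"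
  assumes "\<And>i. smooth (\<lambda>x. f x $ i)"
  shows "smooth f"
proof -
  have "smooth (\<lambda>x. \<Sum>i\<in>UNIV. axis i (f x $ i))"
    by (intro smooth_sum smooth_linear[OF bounded_linear_axis] assms)
  then show ?thesis by (simp flip: vec_eq_sum_axis)
qed

lemma mderiv_vec_nth:
  fixes f :: "real^'n::finite \<Rightarrow> ('b::euclidean_space)^'m::finite"
  assumes "smooth f"
  shows "mderiv \<alpha> (\<lambda>x. f x $ i) = (\<lambda>x. mderiv \<alpha> f x $ i)"
  using mderiv_linear[OF bounded_linear_vec_nth smooth_diff_order[OF assms] order_refl] .

section \<open>Schwartz functions and tame families of operators\<close>

lemma finite_multiindices [simp]: "finite {\<alpha> :: 'n::finite list. length \<alpha> \<le> M}"
  using finite_lists_length_le[of "UNIV :: 'n set" M] by simp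

lemma schwartz_smooth: "\<phi> \<in> schwartz \<Longrightarrow> smooth \<phi>"
  by (simp add: schwartz_def)

lemma schwartzI:
  assumes "smooth f" "\<And>k \<alpha>. \<exists>C. \<forall>x. (1 + norm x) ^ k * norm (mderiv \<alpha> f x) \<le> C"
  shows "f \<in> schwartz"
  using assms unfolding schwartz_def bdd_above_def by fastforce

lemma seminorm_upper:
  "\<phi> \<in> schwartz \<Longrightarrow> (1 + norm x) ^ k * norm (mderiv \<alpha> \<phi> x) \<le> schwartz_seminorm k \<alpha> \<phi>"
  unfolding schwartz_seminorm_def schwartz_def by (intro cSUP_upper) auto

lemma seminorm_least:
  "(\<And>x. (1 + norm x) ^ k * norm (mderiv \<alpha> \<phi> x) \<le> C) \<Longrightarrow> schwartz_seminorm k \<alpha> \<phi> \<le> C"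
  unfolding schwartz_seminorm_def by (intro cSUP_least) auto

lemma seminorm_nonneg: "\<phi> \<in> schwartz \<Longrightarrow> 0 \<le> schwartz_seminorm k \<alpha> \<phi>"
  by (rule order_trans[OF _ seminorm_upper[of \<phi> 0]]) auto

text \<open>An increasing sequence of norms that defines the topology; one index in place of the pair
  \<open>(k, \<alpha>)\<close> keeps the bookkeeping of estimates short.\<close>

definition schwartz_norm :: "nat \<Rightarrow> (real^'n::finite \<Rightarrow> 'b::real_normed_vector) \<Rightarrow> real" where
  "schwartz_norm M \<phi> = (\<Sum>\<alpha> | length \<alpha> \<le> M. schwartz_seminorm M \<alpha> \<phi>)"

lemma schwartz_norm_nonneg: "\<phi> \<in> schwartz \<Longrightarrow> 0 \<le> schwartz_norm M \<phi>"
  unfolding schwartz_norm_def by (intro sum_nonneg seminorm_nonneg)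

lemma seminorm_mono:
  assumes "\<phi> \<in> schwartz" "k \<le> l"
  shows "schwartz_seminorm k \<alpha> \<phi> \<le> schwartz_seminorm l \<alpha> \<phi>"
proof (rule seminorm_least)
  fix x
  have "(1 + norm x) ^ k * norm (mderiv \<alpha> \<phi> x) \<le> (1 + norm x) ^ l * norm (mderiv \<alpha> \<phi> x)"
    using assms by (intro mult_right_mono power_increasing) auto
  also have "\<dots> \<le> schwartz_seminorm l \<alpha> \<phi>" by (rule seminorm_upper) fact
  finally show "(1 + norm x) ^ k * norm (mderiv \<alpha> \<phi> x) \<le> schwartz_seminorm l \<alpha> \<phi>" .
qed

lemma seminorm_le_norm:
  assumes "\<phi> \<in> schwartz" "k \<le> M" "length \<alpha> \<le> M"
  shows "schwartz_seminorm k \<alpha> \<phi> \<le> schwartz_norm M \<phi>"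
proof -
  have "schwartz_seminorm k \<alpha> \<phi> \<le> schwartz_seminorm M \<alpha> \<phi>"
    by (rule seminorm_mono) fact+
  also have "\<dots> \<le> schwartz_norm M \<phi>"
    unfolding schwartz_norm_def using assms
    by (intro member_le_sum) (auto intro: seminorm_nonneg)
  finally show ?thesis .
qed

lemma schwartz_norm_upper:
  assumes "\<phi> \<in> schwartz" "k \<le> M" "length \<alpha> \<le> M"
  shows "(1 + norm x) ^ k * norm (mderiv \<alpha> \<phi> x) \<le> schwartz_norm M \<phi>"
  using seminorm_upper[OF assms(1)] seminorm_le_norm[OF assms] by (rule order_trans)

lemma schwartz_norm_mono:
  assumes "\<phi> \<in> schwartz" "M \<le> N"
  shows "schwartz_norm M \<phi> \<le> schwartz_norm N \<phi>"
proof -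
  have "schwartz_norm M \<phi> \<le> (\<Sum>\<alpha> | length \<alpha> \<le> M. schwartz_seminorm N \<alpha> \<phi>)"
    unfolding schwartz_norm_def by (intro sum_mono seminorm_mono assms)
  also have "\<dots> \<le> schwartz_norm N \<phi>"
    unfolding schwartz_norm_def using assms
    by (intro sum_mono2) (auto intro: seminorm_nonneg)
  finally show ?thesis .
qed

text \<open>The families of operators considered below are pointwise combinations, compositions and
  Fourier conjugates of each other. A family is tame if it obeys seminorm estimates that are
  uniform in the index; for linear operators this is equicontinuity.\<close>

definition tame :: "'i set \<Rightarrow> ('i \<Rightarrow> (real^'n::finite \<Rightarrow> 'b::real_normed_vector) \<Rightarrow>
    real^'n \<Rightarrow> 'c::real_normed_vector) \<Rightarrow> bool" where
  "tame I U \<longleftrightarrow> (\<forall>i\<in>I. \<forall>\<phi>\<in>schwartz. smooth (U i \<phi>)) \<and>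
     (\<forall>k \<alpha>. \<exists>C M. \<forall>i\<in>I. \<forall>\<phi>\<in>schwartz. \<forall>x.
        (1 + norm x) ^ k * norm (mderiv \<alpha> (U i \<phi>) x) \<le> C * schwartz_norm M \<phi>)"

lemma tameI:
  assumes "\<And>i \<phi>. i \<in> I \<Longrightarrow> \<phi> \<in> schwartz \<Longrightarrow> smooth (U i \<phi>)"
    and "\<And>k \<alpha>. \<exists>C M. \<forall>i\<in>I. \<forall>\<phi>\<in>schwartz. \<forall>x.
        (1 + norm x) ^ k * norm (mderiv \<alpha> (U i \<phi>) x) \<le> C * schwartz_norm M \<phi>"
  shows "tame I U"
  using assms unfolding tame_def by blast

lemma tame_bound:
  fixes U :: "'i \<Rightarrow> (real^'n::finite \<Rightarrow> 'b::real_normed_vector) \<Rightarrow> real^'n \<Rightarrow> 'c::real_normed_vector"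
  assumes "tame I U"
  obtains C M where "C \<ge> 0" "\<And>i \<phi> x. i \<in> I \<Longrightarrow> \<phi> \<in> schwartz \<Longrightarrow>
        (1 + norm x) ^ k * norm (mderiv \<alpha> (U i \<phi>) x) \<le> C * schwartz_norm M \<phi>"
proof -
  obtain C M where *: "\<And>i \<phi> x. i \<in> I \<Longrightarrow> \<phi> \<in> schwartz \<Longrightarrow>
        (1 + norm x) ^ k * norm (mderiv \<alpha> (U i \<phi>) x) \<le> C * schwartz_norm M \<phi>"
    using assms unfolding tame_def by metis
  have le: "C * schwartz_norm M \<phi> \<le> \<bar>C\<bar> * schwartz_norm M \<phi>" if "\<phi> \<in> schwartz" for \<phi> :: "real^'n \<Rightarrow> 'b"
    using that by (intro mult_right_mono schwartz_norm_nonneg) auto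
  show thesis
  proof (rule that[of "\<bar>C\<bar>" M])
    fix i and \<phi> :: "real^'n \<Rightarrow> 'b" and x assume "i \<in> I" "\<phi> \<in> schwartz"
    from *[OF this] le[OF this(2)]
    show "(1 + norm x) ^ k * norm (mderiv \<alpha> (U i \<phi>) x) \<le> \<bar>C\<bar> * schwartz_norm M \<phi>"
      by (rule order_trans)
  qed simp
qed

lemma tame_smooth: "tame I U \<Longrightarrow> i \<in> I \<Longrightarrow> \<phi> \<in> schwartz \<Longrightarrow> smooth (U i \<phi>)"
  by (simp add: tame_def)

lemma tame_schwartz:
  assumes "tame I U" "i \<in> I" "\<phi> \<in> schwartz"
  shows "U i \<phi> \<in> schwartz"
proof (rule schwartzI)
  show "smooth (U i \<phi>)" using assms by (rule tame_smooth)
  fix k \<alpha>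
  obtain C M where "\<And>x. (1 + norm x) ^ k * norm (mderiv \<alpha> (U i \<phi>) x) \<le> C * schwartz_norm M \<phi>"
    using tame_bound[OF assms(1), of k \<alpha>] assms(2,3) by metis
  then show "\<exists>C. \<forall>x. (1 + norm x) ^ k * norm (mderiv \<alpha> (U i \<phi>) x) \<le> C" by blast
qed

lemma tame_norm_bound:
  fixes U :: "'i \<Rightarrow> (real^'n::finite \<Rightarrow> 'b::real_normed_vector) \<Rightarrow> real^'n \<Rightarrow> 'c::real_normed_vector"
  assumes "tame I U"
  obtains C M where "C \<ge> 0"
    "\<And>i \<phi>. i \<in> I \<Longrightarrow> \<phi> \<in> schwartz \<Longrightarrow> schwartz_norm N (U i \<phi>) \<le> C * schwartz_norm M \<phi>"
proof -
  have "\<exists>C M. C \<ge> 0 \<and> (\<forall>i \<phi> x. i \<in> I \<longrightarrow> \<phi> \<in> schwartz \<longrightarrow>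
        (1 + norm x) ^ N * norm (mderiv \<alpha> (U i \<phi>) x) \<le> C * schwartz_norm M \<phi>)" for \<alpha>
    by (rule tame_bound[OF assms, of N \<alpha>]) blast
  then obtain C M where C: "\<And>\<alpha>. C \<alpha> \<ge> 0" and *: "\<And>\<alpha> i \<phi> x. i \<in> I \<Longrightarrow> \<phi> \<in> schwartz \<Longrightarrow>
        (1 + norm x) ^ N * norm (mderiv \<alpha> (U i \<phi>) x) \<le> C \<alpha> * schwartz_norm (M \<alpha>) \<phi>"
    by metis
  let ?A = "{\<alpha>. length \<alpha> \<le> N}"
  show thesis
  proof (rule that[of "\<Sum>\<alpha>\<in>?A. C \<alpha>" "\<Sum>\<alpha>\<in>?A. M \<alpha>"])
    show "(\<Sum>\<alpha>\<in>?A. C \<alpha>) \<ge> 0" by (intro sum_nonneg C)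
    fix i and \<phi> :: "real^'n \<Rightarrow> 'b" assume i: "i \<in> I" "\<phi> \<in> schwartz"
    have "schwartz_seminorm N \<alpha> (U i \<phi>) \<le> C \<alpha> * schwartz_norm (\<Sum>\<alpha>\<in>?A. M \<alpha>) \<phi>" if "\<alpha> \<in> ?A" for \<alpha>
    proof -
      have "schwartz_seminorm N \<alpha> (U i \<phi>) \<le> C \<alpha> * schwartz_norm (M \<alpha>) \<phi>"
        by (intro seminorm_least * i)
      also have "\<dots> \<le> C \<alpha> * schwartz_norm (\<Sum>\<alpha>\<in>?A. M \<alpha>) \<phi>"
        using that by (intro mult_left_mono schwartz_norm_mono i C member_le_sum) auto
      finally show ?thesis .
    qed
    then show "schwartz_norm N (U i \<phi>) \<le> (\<Sum>\<alpha>\<in>?A. C \<alpha>) * schwartz_norm (\<Sum>\<alpha>\<in>?A. M \<alpha>) \<phi>"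
      unfolding schwartz_norm_def[of N] sum_distrib_right by (intro sum_mono)
  qed
qed

lemma tame_compose:
  fixes U :: "'i \<Rightarrow> (real^'n::finite \<Rightarrow> 'b::real_normed_vector) \<Rightarrow> real^'n \<Rightarrow> 'c::real_normed_vector"
    and V :: "'i \<Rightarrow> (real^'n \<Rightarrow> 'a::real_normed_vector) \<Rightarrow> real^'n \<Rightarrow> 'b"
  assumes "tame I U" "tame I V"
  shows "tame I (\<lambda>i \<phi>. U i (V i \<phi>))"
proof (rule tameI)
  fix i \<phi> assume "i \<in> I" "(\<phi> :: real^'n \<Rightarrow> 'a) \<in> schwartz"
  then show "smooth (U i (V i \<phi>))" using assms by (intro tame_smooth[of I U] tame_schwartz[of I V])
next
  fix k and \<alpha> :: "'n list"
  obtain C M where C: "C \<ge> 0" "\<And>i \<phi> x. i \<in> I \<Longrightarrow> \<phi> \<in> schwartz \<Longrightarrow>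
        (1 + norm x) ^ k * norm (mderiv \<alpha> (U i \<phi>) x) \<le> C * schwartz_norm M \<phi>"
    by (rule tame_bound[OF assms(1), of k \<alpha>]) blast
  obtain B L where B: "B \<ge> 0" "\<And>i \<phi>. i \<in> I \<Longrightarrow> \<phi> \<in> schwartz \<Longrightarrow>
      schwartz_norm M (V i \<phi>) \<le> B * schwartz_norm L \<phi>"
    by (rule tame_norm_bound[OF assms(2), of M]) blast
  have "(1 + norm x) ^ k * norm (mderiv \<alpha> (U i (V i \<phi>)) x) \<le> (C * B) * schwartz_norm L \<phi>"
    if "i \<in> I" "\<phi> \<in> schwartz" for i \<phi> x
  proof -
    have "(1 + norm x) ^ k * norm (mderiv \<alpha> (U i (V i \<phi>)) x) \<le> C * schwartz_norm M (V i \<phi>)"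
      using that by (intro C tame_schwartz[OF assms(2)])
    also have "\<dots> \<le> C * (B * schwartz_norm L \<phi>)"
      using that by (intro mult_left_mono B C)
    finally show ?thesis by simp
  qed
  then show "\<exists>C M. \<forall>i\<in>I. \<forall>\<phi>\<in>schwartz. \<forall>x.
        (1 + norm x) ^ k * norm (mderiv \<alpha> (U i (V i \<phi>)) x) \<le> C * schwartz_norm M \<phi>" by blast
qed

text \<open>Bounded families in \<open>\<O>\<^sub>M\<close>, also for vector valued functions: the exponent \<open>N\<close> may depend on the
  order of the derivative but not on the member of the family.\<close>

definition slow :: "'i set \<Rightarrow> ('i \<Rightarrow> real^'n::finite \<Rightarrow> 'b::real_normed_vector) \<Rightarrow> bool" where
  "slow I f \<longleftrightarrow> (\<forall>i\<in>I. smooth (f i)) \<and>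
     (\<forall>\<alpha>. \<exists>C N. \<forall>i\<in>I. \<forall>x. norm (mderiv \<alpha> (f i) x) \<le> C * (1 + norm x) ^ N)"

lemma norm_sum_list_le:
  "norm (\<Sum>x\<leftarrow>xs. f x) \<le> (\<Sum>x\<leftarrow>xs. norm (f x))"
  by (induction xs) (auto intro: norm_triangle_le)

text \<open>By Leibniz' rule: the powers of \<open>1 + |x|\<close> by which the derivatives of the multipliers may grow are
  absorbed by a stronger weight in the norm of \<open>\<phi>\<close>.\<close>

lemma tame_multiplication:
  fixes f :: "'i \<Rightarrow> real^'n::finite \<Rightarrow> 'b::real_normed_vector"
    and p :: "'b \<Rightarrow> 'd::real_normed_vector \<Rightarrow> 'c::real_normed_vector"
  assumes p: "bounded_bilinear p" and f: "slow I f"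
  shows "tame I (\<lambda>i \<phi> x. p (f i x) (\<phi> x))"
proof (rule tameI)
  fix i \<phi> assume "i \<in> I" and phi: "(\<phi> :: real^'n \<Rightarrow> 'd) \<in> schwartz"
  with f have "smooth (f i)" by (simp add: slow_def)
  then show "smooth (\<lambda>x. p (f i x) (\<phi> x))" using schwartz_smooth[OF phi] by (rule smooth_bilinear[OF p])
next
  fix k and \<alpha> :: "'n list"
  obtain K where K: "K \<ge> 0" "\<And>a b. norm (p a b) \<le> norm a * norm b * K"
    using bounded_bilinear.nonneg_bounded[OF p] by metis
  have "\<forall>\<beta>. \<exists>C N. \<forall>i\<in>I. \<forall>x. norm (mderiv \<beta> (f i) x) \<le> C * (1 + norm x) ^ N"
    using f by (auto simp: slow_def)
  then obtain C N where C: "\<And>\<beta> i x. i \<in> I \<Longrightarrow> norm (mderiv \<beta> (f i) x) \<le> C \<beta> * (1 + norm x) ^ N \<beta>"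
    by metis
  define L where "L = length \<alpha> + k + (\<Sum>a\<leftarrow>splits \<alpha>. N (fst a))"
  define B where "B = (\<Sum>a\<leftarrow>splits \<alpha>. \<bar>C (fst a)\<bar> * K)"
  have "(1 + norm x) ^ k * norm (mderiv \<alpha> (\<lambda>x. p (f i x) (\<phi> x)) x) \<le> B * schwartz_norm L \<phi>"
    if i: "i \<in> I" and phi: "\<phi> \<in> schwartz" for i x and \<phi> :: "real^'n \<Rightarrow> 'd"
  proof -
    have *: "(1 + norm x) ^ k * norm (p (mderiv (fst a) (f i) x) (mderiv (snd a) \<phi> x))
      \<le> \<bar>C (fst a)\<bar> * K * schwartz_norm L \<phi>" if a: "a \<in> set (splits \<alpha>)" for a
    proof -
      have "N (fst a) \<le> (\<Sum>a\<leftarrow>splits \<alpha>. N (fst a))"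
        by (rule member_le_sum_list) (use a in auto)
      then have L: "k + N (fst a) \<le> L" "length (snd a) \<le> L"
        using splits_length[OF a] by (auto simp: L_def)
      have "(1 + norm x) ^ k * norm (p (mderiv (fst a) (f i) x) (mderiv (snd a) \<phi> x))
         \<le> (1 + norm x) ^ k * (norm (mderiv (fst a) (f i) x) * norm (mderiv (snd a) \<phi> x) * K)"
        by (intro mult_left_mono K) auto
      also have "\<dots> \<le> (1 + norm x) ^ k * ((\<bar>C (fst a)\<bar> * (1 + norm x) ^ N (fst a)) * norm (mderiv (snd a) \<phi> x) * K)"
        using C[OF i, of "fst a" x] K(1)
        by (intro mult_left_mono mult_right_mono order_trans[OF C[OF i]]) auto
      also have "\<dots> = \<bar>C (fst a)\<bar> * K * ((1 + norm x) ^ (k + N (fst a)) * norm (mderiv (snd a) \<phi> x))"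
        by (simp add: power_add)
      also have "\<dots> \<le> \<bar>C (fst a)\<bar> * K * schwartz_norm L \<phi>"
        using K(1) L by (intro mult_left_mono schwartz_norm_upper phi) auto
      finally show ?thesis .
    qed
    have sm: "smooth (f i)" using f i by (simp add: slow_def)
    have "mderiv \<alpha> (\<lambda>x. p (f i x) (\<phi> x)) x =
        (\<Sum>a\<leftarrow>splits \<alpha>. p (mderiv (fst a) (f i) x) (mderiv (snd a) \<phi> x))"
      unfolding mderiv_bilinear[OF p smooth_diff_order[OF sm] smooth_diff_order[OF schwartz_smooth[OF phi]] order_refl]
      by (simp only: case_prod_unfold)
    then have "norm (mderiv \<alpha> (\<lambda>x. p (f i x) (\<phi> x)) x)
        \<le> (\<Sum>a\<leftarrow>splits \<alpha>. norm (p (mderiv (fst a) (f i) x) (mderiv (snd a) \<phi> x)))"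
      by (simp only: norm_sum_list_le)
    then have "(1 + norm x) ^ k * norm (mderiv \<alpha> (\<lambda>x. p (f i x) (\<phi> x)) x)
        \<le> (1 + norm x) ^ k * (\<Sum>a\<leftarrow>splits \<alpha>. norm (p (mderiv (fst a) (f i) x) (mderiv (snd a) \<phi> x)))"
      by (rule mult_left_mono) simp
    also have "\<dots> \<le> (\<Sum>a\<leftarrow>splits \<alpha>. \<bar>C (fst a)\<bar> * K * schwartz_norm L \<phi>)"
      unfolding sum_list_const_mult[symmetric] by (intro sum_list_mono *)
    also have "\<dots> = B * schwartz_norm L \<phi>" by (simp add: B_def sum_list_mult_const)
    finally show ?thesis .
  qed
  then show "\<exists>C M. \<forall>i\<in>I. \<forall>\<phi>\<in>schwartz. \<forall>x.
      (1 + norm x) ^ k * norm (mderiv \<alpha> (\<lambda>x. p (f i x) (\<phi> x)) x) \<le> C * schwartz_norm M (\<phi> :: real^'n \<Rightarrow> 'd)"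
    by blast
qed

lemma tame_linear:
  fixes h :: "'a::real_normed_vector \<Rightarrow> 'b::real_normed_vector"
  assumes "bounded_linear h"
  shows "tame I (\<lambda>i (\<phi> :: real^'d::finite \<Rightarrow> 'a) x. h (\<phi> x))"
proof (rule tameI)
  fix i \<phi> assume "(\<phi> :: real^'d \<Rightarrow> 'a) \<in> schwartz"
  then show "smooth (\<lambda>x. h (\<phi> x))" by (rule smooth_linear[OF assms schwartz_smooth])
next
  fix k and \<alpha> :: "'d list"
  obtain K where K: "\<And>a. norm (h a) \<le> norm a * K" "K \<ge> 0"
    using bounded_linear.nonneg_bounded[OF assms] by metis
  have "(1 + norm x) ^ k * norm (mderiv \<alpha> (\<lambda>x. h (\<phi> x)) x) \<le> K * schwartz_norm (k + length \<alpha>) \<phi>"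
    if phi: "\<phi> \<in> schwartz" for x and \<phi> :: "real^'d \<Rightarrow> 'a"
  proof -
    have "mderiv \<alpha> (\<lambda>x. h (\<phi> x)) x = h (mderiv \<alpha> \<phi> x)"
      by (simp add: mderiv_linear[OF assms smooth_diff_order[OF schwartz_smooth[OF phi]] order_refl])
    then have "(1 + norm x) ^ k * norm (mderiv \<alpha> (\<lambda>x. h (\<phi> x)) x) \<le> (1 + norm x) ^ k * (norm (mderiv \<alpha> \<phi> x) * K)"
      by (auto intro!: mult_left_mono K)
    also have "\<dots> = K * ((1 + norm x) ^ k * norm (mderiv \<alpha> \<phi> x))" by simp
    also have "\<dots> \<le> K * schwartz_norm (k + length \<alpha>) \<phi>"
      by (intro mult_left_mono K schwartz_norm_upper phi) auto
    finally show ?thesis .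
  qed
  then show "\<exists>C M. \<forall>i\<in>I. \<forall>\<phi>\<in>schwartz. \<forall>x.
      (1 + norm x) ^ k * norm (mderiv \<alpha> (\<lambda>x. h (\<phi> x)) x) \<le> C * schwartz_norm M \<phi>"
    by blast
qed

lemma tame_add:
  fixes U V :: "'i \<Rightarrow> (real^'n::finite \<Rightarrow> 'b::real_normed_vector) \<Rightarrow> real^'n \<Rightarrow> 'c::real_normed_vector"
  assumes "tame I U" "tame I V"
  shows "tame I (\<lambda>i \<phi> x. U i \<phi> x + V i \<phi> x)"
proof (rule tameI)
  fix i \<phi> assume "i \<in> I" "(\<phi> :: real^'n \<Rightarrow> 'b) \<in> schwartz"
  then show "smooth (\<lambda>x. U i \<phi> x + V i \<phi> x)" using assms by (intro smooth_add tame_smooth)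
next
  fix k and \<alpha> :: "'n list"
  obtain B L where B: "B \<ge> 0" "\<And>i \<phi> x. i \<in> I \<Longrightarrow> \<phi> \<in> schwartz \<Longrightarrow>
        (1 + norm x) ^ k * norm (mderiv \<alpha> (U i \<phi>) x) \<le> B * schwartz_norm L \<phi>"
    by (rule tame_bound[OF assms(1), of k \<alpha>]) blast
  obtain C M where C: "C \<ge> 0" "\<And>i \<phi> x. i \<in> I \<Longrightarrow> \<phi> \<in> schwartz \<Longrightarrow>
        (1 + norm x) ^ k * norm (mderiv \<alpha> (V i \<phi>) x) \<le> C * schwartz_norm M \<phi>"
    by (rule tame_bound[OF assms(2), of k \<alpha>]) blast
  have "(1 + norm x) ^ k * norm (mderiv \<alpha> (\<lambda>x. U i \<phi> x + V i \<phi> x) x) \<le> (B + C) * schwartz_norm (L + M) \<phi>"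
    if i: "i \<in> I" and phi: "\<phi> \<in> schwartz" for i \<phi> x
  proof -
    have "mderiv \<alpha> (\<lambda>x. U i \<phi> x + V i \<phi> x) x = mderiv \<alpha> (U i \<phi>) x + mderiv \<alpha> (V i \<phi>) x"
      by (subst mderiv_add[OF _ _ order_refl])
        (auto intro!: smooth_diff_order tame_smooth[OF assms(1)] tame_smooth[OF assms(2)] i phi)
    then have "(1 + norm x) ^ k * norm (mderiv \<alpha> (\<lambda>x. U i \<phi> x + V i \<phi> x) x)
        \<le> (1 + norm x) ^ k * (norm (mderiv \<alpha> (U i \<phi>) x) + norm (mderiv \<alpha> (V i \<phi>) x))"
      by (auto intro!: mult_left_mono norm_triangle_ineq)
    also have "\<dots> \<le> B * schwartz_norm L \<phi> + C * schwartz_norm M \<phi>"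
      using B(2)[OF i phi, of x] C(2)[OF i phi, of x] by (simp add: distrib_left)
    also have "\<dots> \<le> B * schwartz_norm (L + M) \<phi> + C * schwartz_norm (L + M) \<phi>"
      by (intro add_mono mult_left_mono schwartz_norm_mono phi B(1) C(1)) auto
    finally show ?thesis by (simp add: distrib_right)
  qed
  then show "\<exists>C M. \<forall>i\<in>I. \<forall>\<phi>\<in>schwartz. \<forall>x.
      (1 + norm x) ^ k * norm (mderiv \<alpha> (\<lambda>x. U i \<phi> x + V i \<phi> x) x) \<le> C * schwartz_norm M \<phi>"
    by blast
qed

lemma tame_zero: "tame I (\<lambda>i \<phi> x. 0)"
  by (rule tameI) (auto simp: smooth_const mderiv_const intro!: exI[of _ 0])

lemma tame_sum:
  "(\<And>j. j \<in> J \<Longrightarrow> tame I (U j)) \<Longrightarrow> tame I (\<lambda>i \<phi> x. \<Sum>j\<in>J. U j i \<phi> x)"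
  by (induction J rule: infinite_finite_induct) (auto intro: tame_zero tame_add)

lemma tame_partial: "tame I (\<lambda>i (\<phi> :: real^'b::finite \<Rightarrow> 'c::real_normed_vector). partial j \<phi>)"
proof (rule tameI)
  fix \<phi> assume "(\<phi> :: real^'b \<Rightarrow> 'c) \<in> schwartz"
  then show "smooth (partial j \<phi>)" by (intro smooth_partial schwartz_smooth)
next
  fix k and \<alpha> :: "'b list"
  have "(1 + norm x) ^ k * norm (mderiv \<alpha> (partial j \<phi>) x) \<le> 1 * schwartz_norm (k + length \<alpha> + 1) \<phi>"
    if "\<phi> \<in> schwartz" for x and \<phi> :: "real^'b \<Rightarrow> 'c"
    using schwartz_norm_upper[OF that, of k "k + length \<alpha> + 1" "\<alpha> @ [j]" x]
    by (simp add: mderiv_append)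
  then show "\<exists>C M. \<forall>i\<in>I. \<forall>\<phi>\<in>schwartz. \<forall>x.
      (1 + norm x) ^ k * norm (mderiv \<alpha> (partial j \<phi>) x) \<le> C * schwartz_norm M (\<phi> :: real^'b \<Rightarrow> 'c)"
    by blast
qed

lemma tame_affine:
  fixes a :: "real^'n::finite"
  assumes b: "b \<noteq> 0"
  shows "tame I (\<lambda>i (\<phi> :: real^'n \<Rightarrow> 'c::real_normed_vector) x. \<phi> (a + b *\<^sub>R x))"
proof (rule tameI)
  fix \<phi> assume "(\<phi> :: real^'n \<Rightarrow> 'c) \<in> schwartz"
  then show "smooth (\<lambda>x. \<phi> (a + b *\<^sub>R x))" by (rule smooth_affine[OF schwartz_smooth])
next
  fix k and \<alpha> :: "'n list"
  \<comment> \<open>a comparison constant for the weights at \<open>x\<close> and at \<open>a + b x\<close>\<close>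
  define K where "K = 1 + (1 + norm a) / \<bar>b\<bar>"
  have K: "1 + norm x \<le> K * (1 + norm (a + b *\<^sub>R x))" for x
  proof -
    have "norm (b *\<^sub>R x) \<le> norm (a + b *\<^sub>R x) + norm a"
      using norm_triangle_ineq4[of "a + b *\<^sub>R x" a] by simp
    also have "\<dots> \<le> (1 + norm a) * (1 + norm (a + b *\<^sub>R x))" by (simp add: algebra_simps)
    finally have "norm x \<le> (1 + norm a) / \<bar>b\<bar> * (1 + norm (a + b *\<^sub>R x))"
      using b by (simp add: field_simps)
    then show ?thesis
      unfolding K_def distrib_right by (intro add_mono) (use b in \<open>auto simp: field_simps\<close>)
  qed
  have "(1 + norm x) ^ k * norm (mderiv \<alpha> (\<lambda>x. \<phi> (a + b *\<^sub>R x)) x)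
      \<le> (K ^ k * \<bar>b\<bar> ^ length \<alpha>) * schwartz_norm (k + length \<alpha>) \<phi>"
    if phi: "\<phi> \<in> schwartz" for x and \<phi> :: "real^'n \<Rightarrow> 'c"
  proof -
    have "mderiv \<alpha> (\<lambda>x. \<phi> (a + b *\<^sub>R x)) x = b ^ length \<alpha> *\<^sub>R mderiv \<alpha> \<phi> (a + b *\<^sub>R x)"
      by (simp add: mderiv_affine[OF schwartz_smooth[OF phi]])
    then have "(1 + norm x) ^ k * norm (mderiv \<alpha> (\<lambda>x. \<phi> (a + b *\<^sub>R x)) x)
       = (1 + norm x) ^ k * (\<bar>b\<bar> ^ length \<alpha> * norm (mderiv \<alpha> \<phi> (a + b *\<^sub>R x)))"
      by (simp add: power_abs)
    also have "\<dots> \<le> (K * (1 + norm (a + b *\<^sub>R x))) ^ k * (\<bar>b\<bar> ^ length \<alpha> * norm (mderiv \<alpha> \<phi> (a + b *\<^sub>R x)))"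
      by (intro mult_right_mono power_mono K) auto
    also have "\<dots> = (K ^ k * \<bar>b\<bar> ^ length \<alpha>) * ((1 + norm (a + b *\<^sub>R x)) ^ k * norm (mderiv \<alpha> \<phi> (a + b *\<^sub>R x)))"
      by (simp add: power_mult_distrib)
    also have "\<dots> \<le> (K ^ k * \<bar>b\<bar> ^ length \<alpha>) * schwartz_norm (k + length \<alpha>) \<phi>"
      by (intro mult_left_mono schwartz_norm_upper phi) (auto simp: K_def intro!: divide_nonneg_nonneg)
    finally show ?thesis .
  qed
  then show "\<exists>C M. \<forall>i\<in>I. \<forall>\<phi>\<in>schwartz. \<forall>x.
      (1 + norm x) ^ k * norm (mderiv \<alpha> (\<lambda>x. \<phi> (a + b *\<^sub>R x)) x) \<le> C * schwartz_norm M (\<phi> :: real^'n \<Rightarrow> 'c)"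
    by blast
qed

lemma schwartz_operator:
  assumes "tame {()} (\<lambda>_. U)" "\<phi> \<in> schwartz"
  shows "U \<phi> \<in> schwartz"
  using tame_schwartz[OF assms(1) _ assms(2), of "()"] by simp

lemmas schwartz_linear = schwartz_operator[OF tame_linear]
lemmas schwartz_partial = schwartz_operator[OF tame_partial]
lemmas schwartz_affine = schwartz_operator[OF tame_affine]

lemma schwartz_mderiv: "\<phi> \<in> schwartz \<Longrightarrow> mderiv \<alpha> \<phi> \<in> schwartz"
  by (induction \<alpha>) (auto intro: schwartz_partial)

lemma schwartz_seminorm_bound:
  assumes "\<phi> \<in> schwartz"
  obtains C where "C \<ge> 0" "\<And>x. (1 + norm x) ^ k * norm (mderiv \<alpha> \<phi> x) \<le> C"
  using seminorm_upper[OF assms] seminorm_nonneg[OF assms] by blast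

lemma schwartz_add:
  assumes "\<phi> \<in> schwartz" "\<psi> \<in> schwartz"
  shows "(\<lambda>x. \<phi> x + \<psi> x) \<in> schwartz"
proof (rule schwartzI)
  show "smooth (\<lambda>x. \<phi> x + \<psi> x)" by (intro smooth_add schwartz_smooth assms)
  fix k \<alpha>
  have "(1 + norm x) ^ k * norm (mderiv \<alpha> (\<lambda>x. \<phi> x + \<psi> x) x)
      \<le> schwartz_seminorm k \<alpha> \<phi> + schwartz_seminorm k \<alpha> \<psi>" for x
  proof -
    have "mderiv \<alpha> (\<lambda>x. \<phi> x + \<psi> x) x = mderiv \<alpha> \<phi> x + mderiv \<alpha> \<psi> x"
      by (subst mderiv_add[OF _ _ order_refl]) (auto intro!: smooth_diff_order schwartz_smooth assms)
    then have "(1 + norm x) ^ k * norm (mderiv \<alpha> (\<lambda>x. \<phi> x + \<psi> x) x)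
        \<le> (1 + norm x) ^ k * (norm (mderiv \<alpha> \<phi> x) + norm (mderiv \<alpha> \<psi> x))"
      by (auto intro!: mult_left_mono norm_triangle_ineq)
    also have "\<dots> \<le> schwartz_seminorm k \<alpha> \<phi> + schwartz_seminorm k \<alpha> \<psi>"
      unfolding distrib_left by (intro add_mono seminorm_upper assms)
    finally show ?thesis .
  qed
  then show "\<exists>C. \<forall>x. (1 + norm x) ^ k * norm (mderiv \<alpha> (\<lambda>x. \<phi> x + \<psi> x) x) \<le> C" by blast
qed

lemma schwartz_diff:
  assumes "\<phi> \<in> schwartz" "\<psi> \<in> schwartz"
  shows "(\<lambda>x. \<phi> x - \<psi> x) \<in> schwartz"
  using schwartz_add[OF assms(1) schwartz_linear[OF bounded_linear_minus[OF bounded_linear_ident] assms(2)]]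
  by simp

lemma schwartz_zero: "(\<lambda>x. 0) \<in> schwartz"
  by (rule schwartzI) (auto simp: smooth_const mderiv_const)

lemma seminorm_triangle:
  assumes "f \<in> schwartz" "g \<in> schwartz" "h \<in> schwartz"
  shows "schwartz_seminorm k \<alpha> (\<lambda>x. f x - h x)
    \<le> schwartz_seminorm k \<alpha> (\<lambda>x. f x - g x) + schwartz_seminorm k \<alpha> (\<lambda>x. g x - h x)"
proof (rule seminorm_least)
  fix x
  have "mderiv \<alpha> (\<lambda>x. (f x - g x) + (g x - h x)) x
      = mderiv \<alpha> (\<lambda>x. f x - g x) x + mderiv \<alpha> (\<lambda>x. g x - h x) x"
    by (subst mderiv_add[OF _ _ order_refl])
      (auto intro!: smooth_diff_order schwartz_smooth schwartz_diff assms)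
  then have "(1 + norm x) ^ k * norm (mderiv \<alpha> (\<lambda>x. f x - h x) x)
        \<le> (1 + norm x) ^ k * (norm (mderiv \<alpha> (\<lambda>x. f x - g x) x) + norm (mderiv \<alpha> (\<lambda>x. g x - h x) x))"
    by (auto intro!: mult_left_mono norm_triangle_ineq)
  also have "\<dots> \<le> schwartz_seminorm k \<alpha> (\<lambda>x. f x - g x) + schwartz_seminorm k \<alpha> (\<lambda>x. g x - h x)"
    unfolding distrib_left by (intro add_mono seminorm_upper schwartz_diff assms)
  finally show "(1 + norm x) ^ k * norm (mderiv \<alpha> (\<lambda>x. f x - h x) x) \<le> \<dots>" .
qed

lemma seminorm_zero: "schwartz_seminorm k \<alpha> (\<lambda>x. 0) = 0"
  by (simp add: schwartz_seminorm_def mderiv_const)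

lemma schwartz_norm_scaleR:
  assumes "\<phi> \<in> schwartz"
  shows "schwartz_norm M (\<lambda>x. c *\<^sub>R \<phi> x) \<le> \<bar>c\<bar> * schwartz_norm M \<phi>"
  unfolding schwartz_norm_def sum_distrib_left
proof (intro sum_mono seminorm_least)
  fix \<alpha> x
  have "mderiv \<alpha> (\<lambda>x. c *\<^sub>R \<phi> x) x = c *\<^sub>R mderiv \<alpha> \<phi> x"
    using mderiv_linear[OF bounded_linear_scaleR_right smooth_diff_order[OF schwartz_smooth[OF assms]] order_refl]
    by metis
  then show "(1 + norm x) ^ M * norm (mderiv \<alpha> (\<lambda>x. c *\<^sub>R \<phi> x) x) \<le> \<bar>c\<bar> * schwartz_seminorm M \<alpha> \<phi>"
    using mult_left_mono[OF seminorm_upper[OF assms, of x M \<alpha>], of "\<bar>c\<bar>"] by (simp add: mult_ac)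
qed

section \<open>The topology of the Schwartz space\<close>

lemma openin_seminorm_ball:
  "f \<in> schwartz \<Longrightarrow> \<epsilon> > 0 \<Longrightarrow>
    openin schwartz_topology {g \<in> schwartz. schwartz_seminorm k \<alpha> (\<lambda>x. g x - f x) < \<epsilon>}"
  unfolding schwartz_topology_def by (intro topology_generated_by_Basis) blast

lemma topspace_schwartz [simp]: "topspace schwartz_topology = schwartz"
proof
  show "topspace schwartz_topology \<subseteq> (schwartz :: (real^'a \<Rightarrow> 'b) set)"
    unfolding schwartz_topology_def topology_generated_by_topspace by blast
  show "(schwartz :: (real^'a \<Rightarrow> 'b) set) \<subseteq> topspace schwartz_topology"
  proof
    fix f :: "real^'a \<Rightarrow> 'b" assume f: "f \<in> schwartz"
    have "f \<in> {g \<in> schwartz. schwartz_seminorm 0 [] (\<lambda>x. g x - f x) < 1}"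
      using f by (simp add: seminorm_zero)
    then show "f \<in> topspace schwartz_topology"
      using openin_seminorm_ball[OF f, of 1 0 "[]"] openin_subset by fastforce
  qed
qed

text \<open>Every neighbourhood contains a ball of some norm: a subbasic ball around another centre
  contains a smaller one by the triangle inequality, and finite intersections are handled by
  monotonicity in the index of the norm.\<close>

lemma schwartz_nhd_ball:
  assumes "openin schwartz_topology W" "f \<in> W"
  obtains M \<epsilon> where "\<epsilon> > 0" "{g \<in> schwartz. schwartz_norm M (\<lambda>x. g x - f x) < \<epsilon>} \<subseteq> W"
proof -
  let ?B = "\<lambda>M \<epsilon> f. {g \<in> schwartz. schwartz_norm M (\<lambda>x. g x - f x) < \<epsilon>}"
  have "\<forall>f\<in>W. \<exists>M \<epsilon>. \<epsilon> > 0 \<and> ?B M \<epsilon> f \<subseteq> W"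
    using assms(1) unfolding schwartz_topology_def openin_topology_generated_by_iff
  proof (induction rule: generate_topology_on.induct)
    case (Int V W)
    show ?case
    proof
      fix f assume f: "f \<in> V \<inter> W"
      obtain M \<epsilon> where 1: "\<epsilon> > 0" "?B M \<epsilon> f \<subseteq> V" using Int f by blast
      obtain N \<delta> where 2: "\<delta> > 0" "?B N \<delta> f \<subseteq> W" using Int f by blast
      have "openin schwartz_topology V"
        unfolding schwartz_topology_def openin_topology_generated_by_iff by (rule Int.hyps)
      from openin_subset[OF this] f have f': "f \<in> schwartz" by auto
      have sub: "?B (M + N) (min \<epsilon> \<delta>) f \<subseteq> V \<inter> W"
      proof
        fix g assume g: "g \<in> ?B (M + N) (min \<epsilon> \<delta>) f"
        then have "(\<lambda>x. g x - f x) \<in> schwartz" using f' by (auto intro: schwartz_diff)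
        from schwartz_norm_mono[OF this, of M "M + N"] schwartz_norm_mono[OF this, of N "M + N"] g
        have "g \<in> ?B M \<epsilon> f" "g \<in> ?B N \<delta> f" by auto
        then show "g \<in> V \<inter> W" using 1 2 by blast
      qed
      have "min \<epsilon> \<delta> > 0" using 1 2 by simp
      with sub show "\<exists>M \<epsilon>. \<epsilon> > 0 \<and> ?B M \<epsilon> f \<subseteq> V \<inter> W" by blast
    qed
  next
    case (UN K)
    show ?case
    proof
      fix f assume "f \<in> \<Union>K"
      then obtain k where k: "k \<in> K" "f \<in> k" by blast
      then obtain M \<epsilon> where "\<epsilon> > 0" "?B M \<epsilon> f \<subseteq> k" using UN.IH by blast
      with k(1) show "\<exists>M \<epsilon>. \<epsilon> > 0 \<and> ?B M \<epsilon> f \<subseteq> \<Union>K" by blast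
    qed
  next
    case (Basis s)
    then obtain h k \<alpha> e where s: "s = {g \<in> schwartz. schwartz_seminorm k \<alpha> (\<lambda>x. g x - h x) < e}"
      and h: "h \<in> schwartz" by blast
    show ?case
    proof
      fix f assume f: "f \<in> s"
      let ?e = "e - schwartz_seminorm k \<alpha> (\<lambda>x. f x - h x)"
      have f': "f \<in> schwartz" using f s by blast
      have "?B (k + length \<alpha>) ?e f \<subseteq> s"
      proof
        fix g assume g: "g \<in> ?B (k + length \<alpha>) ?e f"
        then have "schwartz_seminorm k \<alpha> (\<lambda>x. g x - f x) \<le> schwartz_norm (k + length \<alpha>) (\<lambda>x. g x - f x)"
          by (intro seminorm_le_norm schwartz_diff f') auto
        with g seminorm_triangle[of g f h k \<alpha>] f' h show "g \<in> s" by (auto simp: s)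
      qed
      moreover have "?e > 0" using f s by auto
      ultimately show "\<exists>M \<epsilon>. \<epsilon> > 0 \<and> ?B M \<epsilon> f \<subseteq> s" by blast
    qed
  qed auto
  with assms(2) that show thesis by blast
qed

lemma schwartz_ball_nhd:
  fixes f :: "real^'n::finite \<Rightarrow> 'b::real_normed_vector"
  assumes "f \<in> schwartz" "\<epsilon> > 0"
  obtains W where "openin schwartz_topology W" "f \<in> W"
    "W \<subseteq> {g \<in> schwartz. schwartz_norm M (\<lambda>x. g x - f x) < \<epsilon>}"
proof -
  let ?A = "{\<alpha> :: 'n list. length \<alpha> \<le> M}"
  \<comment> \<open>the norm is a sum of \<open>card ?A\<close> seminorms; the summand \<open>1\<close> makes the estimate strict\<close>
  define d where "d = \<epsilon> / (card ?A + 1)"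
  have d: "d > 0" using assms(2) by (simp add: d_def add_nonneg_pos)
  let ?W = "\<Inter>\<alpha>\<in>?A. {g \<in> schwartz. schwartz_seminorm M \<alpha> (\<lambda>x. g x - f x) < d}"
  have nil: "[] \<in> ?A" by simp
  show thesis
  proof (rule that)
    have "?A \<noteq> {}" using nil by blast
    then show "openin schwartz_topology ?W"
      by (intro openin_INT2 openin_seminorm_ball assms d finite_multiindices)
    show "f \<in> ?W" using assms d by (auto simp: seminorm_zero)
    show "?W \<subseteq> {g \<in> schwartz. schwartz_norm M (\<lambda>x. g x - f x) < \<epsilon>}"
    proof
      fix g assume g: "g \<in> ?W"
      then have "schwartz_norm M (\<lambda>x. g x - f x) \<le> of_nat (card ?A) * d"
        unfolding schwartz_norm_def by (intro sum_bounded_above) (auto intro: less_imp_le)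
      also have "\<dots> < (card ?A + 1) * d" using d by simp
      also have "\<dots> = \<epsilon>" by (simp add: d_def add_nonneg_eq_0_iff)
      finally show "g \<in> {g \<in> schwartz. schwartz_norm M (\<lambda>x. g x - f x) < \<epsilon>}"
        using g nil by blast
    qed
  qed
qed

text \<open>Uniform seminorm estimates turn a small norm ball into a subset of the preimage of every
  neighbourhood of \<open>0\<close>.\<close>

lemma tame_equicontinuous:
  fixes U :: "'i \<Rightarrow> (real^'n::finite \<Rightarrow> 'b::real_normed_vector) \<Rightarrow> real^'n \<Rightarrow> 'b"
  assumes "tame I U"
  shows "equicontinuous (U ` I)"
  unfolding equicontinuous_def
proof (intro allI impI, elim conjE)
  fix V :: "(real^'n \<Rightarrow> 'b) set" assume V: "openin schwartz_topology V" "(\<lambda>x. 0) \<in> V"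
  obtain N \<epsilon> where e: "\<epsilon> > 0" and N: "{g \<in> schwartz. schwartz_norm N (\<lambda>x. g x - 0) < \<epsilon>} \<subseteq> V"
    by (rule schwartz_nhd_ball[OF V])
  obtain C M where C: "C \<ge> 0" and
    M: "\<And>i \<phi>. i \<in> I \<Longrightarrow> \<phi> \<in> schwartz \<Longrightarrow> schwartz_norm N (U i \<phi>) \<le> C * schwartz_norm M \<phi>"
    by (rule tame_norm_bound[OF assms, of N]) blast
  define d where "d = \<epsilon> / (C + 1)"
  have d: "d > 0" using C e by (simp add: d_def)
  obtain W :: "(real^'n \<Rightarrow> 'b) set" where W: "openin schwartz_topology W" "(\<lambda>x. 0) \<in> W"
    "W \<subseteq> {g \<in> schwartz. schwartz_norm M (\<lambda>x. g x - 0) < d}"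
    by (rule schwartz_ball_nhd[OF schwartz_zero d])
  have "U i \<phi> \<in> V" if i: "i \<in> I" and phi: "\<phi> \<in> W" for i and \<phi> :: "real^'n \<Rightarrow> 'b"
  proof -
    have s: "\<phi> \<in> schwartz" "schwartz_norm M \<phi> < d" using phi W(3) by auto
    have "schwartz_norm N (U i \<phi>) \<le> C * schwartz_norm M \<phi>" by (rule M[OF i s(1)])
    also have "\<dots> \<le> C * d" using s C by (intro mult_left_mono) auto
    also have "\<dots> < \<epsilon>" using C e by (simp add: d_def field_simps)
    finally show ?thesis using N tame_schwartz[OF assms i s(1)] by auto
  qed
  then show "\<exists>W. openin schwartz_topology W \<and> (\<lambda>x. 0) \<in> W \<and> (\<forall>u\<in>U ` I. u ` W \<subseteq> V)"
    using W by blast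
qed

lemma tame_continuous:
  fixes U :: "(real^'n::finite \<Rightarrow> 'b::real_normed_vector) \<Rightarrow> real^'n \<Rightarrow> 'c::real_normed_vector"
  assumes t: "tame {()} (\<lambda>_. U)"
    and add: "\<And>\<phi> \<psi>. \<phi> \<in> schwartz \<Longrightarrow> \<psi> \<in> schwartz \<Longrightarrow> U (\<lambda>x. \<phi> x + \<psi> x) = (\<lambda>x. U \<phi> x + U \<psi> x)"
  shows "continuous_map schwartz_topology schwartz_topology U"
  unfolding continuous_map_def
proof (intro conjI allI impI)
  show "U \<in> topspace schwartz_topology \<rightarrow> topspace schwartz_topology"
    using schwartz_operator[OF t] by auto
  fix V :: "(real^'n \<Rightarrow> 'c) set" assume V: "openin schwartz_topology V"
  show "openin schwartz_topology {\<phi> \<in> topspace schwartz_topology. U \<phi> \<in> V}" (is "openin _ ?P")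
  proof (subst openin_subopen, intro ballI)
    fix \<phi> assume "\<phi> \<in> ?P"
    then have phi: "\<phi> \<in> schwartz" "U \<phi> \<in> V" by auto
    obtain N \<epsilon> where e: "\<epsilon> > 0" and N: "{g \<in> schwartz. schwartz_norm N (\<lambda>x. g x - U \<phi> x) < \<epsilon>} \<subseteq> V"
      by (rule schwartz_nhd_ball[OF V phi(2)])
    obtain C M where C: "C \<ge> 0" and
      M: "\<And>i \<phi>. i \<in> {()} \<Longrightarrow> \<phi> \<in> schwartz \<Longrightarrow> schwartz_norm N (U \<phi>) \<le> C * schwartz_norm M \<phi>"
      by (rule tame_norm_bound[OF t, of N]) blast
    define d where "d = \<epsilon> / (C + 1)"
    have d: "d > 0" using C e by (simp add: d_def)
    obtain W where W: "openin schwartz_topology W" "\<phi> \<in> W"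
      "W \<subseteq> {g \<in> schwartz. schwartz_norm M (\<lambda>x. g x - \<phi> x) < d}"
      by (rule schwartz_ball_nhd[OF phi(1) d])
    have "W \<subseteq> ?P"
    proof
      fix \<psi> assume "\<psi> \<in> W"
      then have s: "\<psi> \<in> schwartz" "schwartz_norm M (\<lambda>x. \<psi> x - \<phi> x) < d" using W(3) by auto
      note d' = schwartz_diff[OF s(1) phi(1)]
      have "U (\<lambda>x. (\<psi> x - \<phi> x) + \<phi> x) = (\<lambda>x. U (\<lambda>x. \<psi> x - \<phi> x) x + U \<phi> x)"
        by (rule add[OF d' phi(1)])
      then have "(\<lambda>x. U \<psi> x - U \<phi> x) = U (\<lambda>x. \<psi> x - \<phi> x)" by simp
      then have "schwartz_norm N (\<lambda>x. U \<psi> x - U \<phi> x) \<le> C * schwartz_norm M (\<lambda>x. \<psi> x - \<phi> x)"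
        using M[OF _ d'] by simp
      also have "\<dots> \<le> C * d" using s C by (intro mult_left_mono) auto
      also have "\<dots> < \<epsilon>" using C e by (simp add: d_def field_simps)
      finally show "\<psi> \<in> ?P" using N schwartz_operator[OF t s(1)] s(1) by auto
    qed
    with W show "\<exists>T. openin schwartz_topology T \<and> \<phi> \<in> T \<and> T \<subseteq> ?P" by blast
  qed
qed

section \<open>Functions of slow increase\<close>

lemma slow_coinduct:
  assumes "P f"
    and "\<And>f. P f \<Longrightarrow> f differentiable_on UNIV"
    and "\<And>f i. P f \<Longrightarrow> P (partial i f)"
    and "\<And>f. P f \<Longrightarrow> \<exists>C N. \<forall>x. norm (f x) \<le> C * (1 + norm x) ^ N"
  shows "slow I (\<lambda>_. f)"
proof -
  have "P (mderiv \<alpha> f)" for \<alpha>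
    by (induction \<alpha>) (use assms in auto)
  then have "\<exists>C N. \<forall>x. norm (mderiv \<alpha> f x) \<le> C * (1 + norm x) ^ N" for \<alpha>
    using assms(4) by blast
  moreover have "smooth f"
    by (rule smooth_coinduct[of P]) (use assms in auto)
  ultimately show ?thesis unfolding slow_def by blast
qed

text \<open>The version of finite order for a single function. It is closed under products, which settles
  the algebra properties of \<open>\<O>\<^sub>M\<close> as well, and it applies to the Fourier transforms of functions of
  finite decay.\<close>

definition slow_upto :: "nat \<Rightarrow> (real^'n::finite \<Rightarrow> 'b::real_normed_vector) \<Rightarrow> bool" where
  "slow_upto l f \<longleftrightarrow> diff_order l f \<and>
     (\<forall>\<alpha>. length \<alpha> \<le> l \<longrightarrow> (\<exists>C N. \<forall>x. norm (mderiv \<alpha> f x) \<le> C * (1 + norm x) ^ N))"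

lemma slow_upto_bound:
  assumes "slow_upto l f"
  obtains C N where "\<And>\<alpha>. C \<alpha> \<ge> 0"
    "\<And>\<alpha> x. length \<alpha> \<le> l \<Longrightarrow> norm (mderiv \<alpha> f x) \<le> C \<alpha> * (1 + norm x) ^ N \<alpha>"
proof -
  have "\<exists>C N. C \<ge> 0 \<and> (length \<alpha> \<le> l \<longrightarrow> (\<forall>x. norm (mderiv \<alpha> f x) \<le> C * (1 + norm x) ^ N))" for \<alpha>
  proof (cases "length \<alpha> \<le> l")
    case True
    then obtain C N where *: "\<forall>x. norm (mderiv \<alpha> f x) \<le> C * (1 + norm x) ^ N"
      using assms unfolding slow_upto_def by blast
    from spec[OF this, of 0] have "C \<ge> 0" by (simp add: order_trans[OF norm_ge_zero])
    with * show ?thesis by blast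
  qed auto
  with that show thesis by metis
qed

lemma slow_upto_mono: "slow_upto l f \<Longrightarrow> k \<le> l \<Longrightarrow> slow_upto k f"
  unfolding slow_upto_def diff_order_def by (meson le_trans less_le_trans)

lemma slow_upto_growth:
  assumes "slow_upto l f"
  obtains C N where "C \<ge> 0" "\<And>x. norm (f x) \<le> C * (1 + norm x) ^ N"
proof -
  obtain C N where "\<And>\<alpha>. C \<alpha> \<ge> 0" and
    N: "\<And>\<alpha> x. length \<alpha> \<le> l \<Longrightarrow> norm (mderiv \<alpha> f x) \<le> C \<alpha> * (1 + norm x) ^ N \<alpha>"
    by (rule slow_upto_bound[OF assms]) blast
  then show thesis using N[of "[]"] by (intro that[of "C []" "N []"]) auto
qed

lemma slow_iff_upto: "slow {()} (\<lambda>_. f) \<longleftrightarrow> (\<forall>l. slow_upto l f)"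
  unfolding slow_def slow_upto_def smooth_iff_diff_order by (auto intro: order_refl)

lemma OM_iff_slow: "f \<in> OM \<longleftrightarrow> slow {()} (\<lambda>_. f)"
proof -
  have "bdd_above (range (\<lambda>x. norm (mderiv \<alpha> f x) / (1 + norm x) ^ m)) \<longleftrightarrow>
      (\<exists>C. \<forall>x. norm (mderiv \<alpha> f x) \<le> C * (1 + norm x) ^ m)" for \<alpha> m
    unfolding bdd_above_def
    by (auto simp: divide_le_eq zero_less_power add_pos_nonneg)
  then have "(\<exists>m. bdd_above (range (\<lambda>x. norm (mderiv \<alpha> f x) / (1 + norm x) ^ m))) \<longleftrightarrow>
      (\<exists>C m. \<forall>x. norm (mderiv \<alpha> f x) \<le> C * (1 + norm x) ^ m)" for \<alpha>
    by (subst ex_comm) simp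
  then show ?thesis unfolding OM_def slow_def by simp
qed

lemma slow_upto_add:
  assumes "slow_upto l f" "slow_upto l g"
  shows "slow_upto l (\<lambda>x. f x + g x)"
proof -
  obtain B M where B: "\<And>\<alpha>. B \<alpha> \<ge> 0" and
    M: "\<And>\<alpha> x. length \<alpha> \<le> l \<Longrightarrow> norm (mderiv \<alpha> f x) \<le> B \<alpha> * (1 + norm x) ^ M \<alpha>"
    by (rule slow_upto_bound[OF assms(1)]) blast
  obtain C N where C: "\<And>\<alpha>. C \<alpha> \<ge> 0" and
    N: "\<And>\<alpha> x. length \<alpha> \<le> l \<Longrightarrow> norm (mderiv \<alpha> g x) \<le> C \<alpha> * (1 + norm x) ^ N \<alpha>"
    by (rule slow_upto_bound[OF assms(2)]) blast
  have d: "diff_order l f" "diff_order l g" using assms by (auto simp: slow_upto_def)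
  have "norm (mderiv \<alpha> (\<lambda>x. f x + g x) x) \<le> (B \<alpha> + C \<alpha>) * (1 + norm x) ^ (M \<alpha> + N \<alpha>)"
    if l: "length \<alpha> \<le> l" for \<alpha> x
  proof -
    have "norm (mderiv \<alpha> (\<lambda>x. f x + g x) x) \<le> B \<alpha> * (1 + norm x) ^ M \<alpha> + C \<alpha> * (1 + norm x) ^ N \<alpha>"
      unfolding mderiv_add[OF d l] using M[OF l, of x] N[OF l, of x] by (intro norm_triangle_le) simp
    also have "\<dots> \<le> B \<alpha> * (1 + norm x) ^ (M \<alpha> + N \<alpha>) + C \<alpha> * (1 + norm x) ^ (M \<alpha> + N \<alpha>)"
      using B C by (intro add_mono mult_left_mono power_increasing) auto
    finally show ?thesis by (simp add: distrib_right)
  qed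
  then show ?thesis using diff_order_add[OF d] unfolding slow_upto_def by blast
qed

lemma slow_upto_bilinear:
  fixes f :: "real^'n::finite \<Rightarrow> 'a::real_normed_vector"
  assumes p: "bounded_bilinear p" and "slow_upto l f" "slow_upto l g"
  shows "slow_upto l (\<lambda>x. p (f x) (g x))"
proof -
  obtain B M where B: "\<And>\<alpha>. B \<alpha> \<ge> 0" and
    M: "\<And>\<alpha> x. length \<alpha> \<le> l \<Longrightarrow> norm (mderiv \<alpha> f x) \<le> B \<alpha> * (1 + norm x) ^ M \<alpha>"
    by (rule slow_upto_bound[OF assms(2)]) blast
  obtain C N where C: "\<And>\<alpha>. C \<alpha> \<ge> 0" and
    N: "\<And>\<alpha> x. length \<alpha> \<le> l \<Longrightarrow> norm (mderiv \<alpha> g x) \<le> C \<alpha> * (1 + norm x) ^ N \<alpha>"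
    by (rule slow_upto_bound[OF assms(3)]) blast
  have d: "diff_order l f" "diff_order l g" using assms by (auto simp: slow_upto_def)
  obtain K where K: "K \<ge> 0" "\<And>a b. norm (p a b) \<le> norm a * norm b * K"
    using bounded_bilinear.nonneg_bounded[OF p] by metis
  have "\<exists>D L. \<forall>x. norm (mderiv \<alpha> (\<lambda>x. p (f x) (g x)) x) \<le> D * (1 + norm x) ^ L"
    if l: "length \<alpha> \<le> l" for \<alpha> :: "'n list"
  proof -
    define L where "L = (\<Sum>a\<leftarrow>splits \<alpha>. M (fst a) + N (snd a))"
    define D where "D = (\<Sum>a\<leftarrow>splits \<alpha>. B (fst a) * C (snd a) * K)"
    have "norm (mderiv \<alpha> (\<lambda>x. p (f x) (g x)) x) \<le> D * (1 + norm x) ^ L" for x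
    proof -
      have *: "norm (p (mderiv (fst a) f x) (mderiv (snd a) g x))
        \<le> B (fst a) * C (snd a) * K * (1 + norm x) ^ L" if a: "a \<in> set (splits \<alpha>)" for a
      proof -
        have le: "length (fst a) \<le> l" "length (snd a) \<le> l" using splits_length[OF a] l by auto
        have L: "M (fst a) + N (snd a) \<le> L"
          unfolding L_def by (rule member_le_sum_list) (use a in auto)
        have "norm (p (mderiv (fst a) f x) (mderiv (snd a) g x))
            \<le> norm (mderiv (fst a) f x) * norm (mderiv (snd a) g x) * K" by (rule K)
        also have "\<dots> \<le> (B (fst a) * (1 + norm x) ^ M (fst a)) * (C (snd a) * (1 + norm x) ^ N (snd a)) * K"
          using B C K by (intro mult_right_mono mult_mono M N le mult_nonneg_nonneg) auto
        also have "\<dots> = B (fst a) * C (snd a) * K * (1 + norm x) ^ (M (fst a) + N (snd a))"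
          by (simp add: power_add)
        also have "\<dots> \<le> B (fst a) * C (snd a) * K * (1 + norm x) ^ L"
          using B C K L by (intro mult_left_mono power_increasing mult_nonneg_nonneg) auto
        finally show ?thesis .
      qed
      have "mderiv \<alpha> (\<lambda>x. p (f x) (g x)) x =
        (\<Sum>a\<leftarrow>splits \<alpha>. p (mderiv (fst a) f x) (mderiv (snd a) g x))"
        unfolding mderiv_bilinear[OF p d l] by (simp only: case_prod_unfold)
      then have "norm (mderiv \<alpha> (\<lambda>x. p (f x) (g x)) x)
          \<le> (\<Sum>a\<leftarrow>splits \<alpha>. norm (p (mderiv (fst a) f x) (mderiv (snd a) g x)))"
        by (simp only: norm_sum_list_le)
      also have "\<dots> \<le> (\<Sum>a\<leftarrow>splits \<alpha>. B (fst a) * C (snd a) * K * (1 + norm x) ^ L)"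
        by (intro sum_list_mono *)
      also have "\<dots> = D * (1 + norm x) ^ L" by (simp add: D_def sum_list_mult_const)
      finally show ?thesis .
    qed
    then show ?thesis by blast
  qed
  then show ?thesis using diff_order_bilinear[OF p d] unfolding slow_upto_def by blast
qed

lemma slow_upto_linear:
  assumes h: "bounded_linear h" and "slow_upto l f"
  shows "slow_upto l (\<lambda>x. h (f x))"
proof -
  obtain B M where B: "\<And>\<alpha>. B \<alpha> \<ge> 0" and
    M: "\<And>\<alpha> x. length \<alpha> \<le> l \<Longrightarrow> norm (mderiv \<alpha> f x) \<le> B \<alpha> * (1 + norm x) ^ M \<alpha>"
    by (rule slow_upto_bound[OF assms(2)]) blast
  have d: "diff_order l f" using assms by (auto simp: slow_upto_def)
  obtain K where K: "K \<ge> 0" "\<And>a. norm (h a) \<le> norm a * K"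
    using bounded_linear.nonneg_bounded[OF h] by metis
  have "norm (mderiv \<alpha> (\<lambda>x. h (f x)) x) \<le> (B \<alpha> * K) * (1 + norm x) ^ M \<alpha>"
    if l: "length \<alpha> \<le> l" for \<alpha> x
    unfolding mderiv_linear[OF h d l]
    using order_trans[OF K(2) mult_right_mono[OF M[OF l] K(1)]] by (simp add: mult_ac)
  then show ?thesis using diff_order_linear[OF h d] unfolding slow_upto_def by blast
qed

lemma slow_upto_const: "slow_upto l (\<lambda>x. c)"
proof -
  have "norm (mderiv \<alpha> (\<lambda>x. c) x) \<le> norm c * (1 + norm x) ^ 0" for \<alpha> and x :: "real^'n::finite"
    by (simp add: mderiv_const)
  then show ?thesis unfolding slow_upto_def using smooth_diff_order[OF smooth_const] by blast
qed

lemma slow_upto_sum: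
  "(\<And>i. i \<in> I \<Longrightarrow> slow_upto l (f i)) \<Longrightarrow> slow_upto l (\<lambda>x. \<Sum>i\<in>I. f i x)"
  by (induction I rule: infinite_finite_induct) (auto intro: slow_upto_const slow_upto_add)

abbreviation slow1 :: "(real^'n::finite \<Rightarrow> 'b::real_normed_vector) \<Rightarrow> bool" where
  "slow1 f \<equiv> slow {()} (\<lambda>_. f)"

lemma slow_const: "slow1 (\<lambda>x. c)"
  by (simp add: slow_iff_upto slow_upto_const)

lemma slow_add: "slow1 f \<Longrightarrow> slow1 g \<Longrightarrow> slow1 (\<lambda>x. f x + g x)"
  by (simp add: slow_iff_upto slow_upto_add)

lemma slow_bilinear: "bounded_bilinear p \<Longrightarrow> slow1 f \<Longrightarrow> slow1 g \<Longrightarrow> slow1 (\<lambda>x. p (f x) (g x))"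
  by (simp add: slow_iff_upto slow_upto_bilinear)

lemma slow_linear: "bounded_linear h \<Longrightarrow> slow1 f \<Longrightarrow> slow1 (\<lambda>x. h (f x))"
  by (simp add: slow_iff_upto slow_upto_linear)

lemma slow_sum: "(\<And>i. i \<in> I \<Longrightarrow> slow1 (f i)) \<Longrightarrow> slow1 (\<lambda>x. \<Sum>i\<in>I. f i x)"
  by (simp add: slow_iff_upto slow_upto_sum)

lemma slow_upto_slow: "slow1 f \<Longrightarrow> slow_upto l f"
  by (simp add: slow_iff_upto)

lemma slow_smooth: "slow1 f \<Longrightarrow> smooth f"
  by (simp add: slow_def)

lemma slow_partial: "slow1 f \<Longrightarrow> slow1 (partial i f)"
  using smooth_partial[of f i] mderiv_append[of _ "[i]" f] by (simp add: slow_def) (metis mderiv_Cons mderiv_Nil)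

lemmas slow_growth = slow_upto_growth[OF slow_upto_slow[where l = 0]]

lemma partial_linear_part:
  assumes "bounded_linear h"
  shows "partial i (\<lambda>x. h x + c) = (\<lambda>x. h (axis i 1))"
proof
  fix x
  have "((\<lambda>x. h x + c) has_derivative h) (at x)"
    using bounded_linear_imp_has_derivative[OF assms] by (auto intro!: derivative_eq_intros)
  from partial_eq[OF this] show "partial i (\<lambda>x. h x + c) x = h (axis i 1)" .
qed

lemma slow_bounded_linear:
  assumes "bounded_linear h"
  shows "slow1 (h :: real^'n::finite \<Rightarrow> 'b::real_normed_vector)"
proof (rule slow_coinduct[where P = "\<lambda>f. \<exists>h c. bounded_linear h \<and> f = (\<lambda>x. h x + c)"])
  show "\<exists>h' c. bounded_linear h' \<and> h = (\<lambda>x. h' x + c)"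
    using assms by (intro exI[of _ h] exI[of _ 0]) auto
next
  fix f :: "real^'n \<Rightarrow> 'b" assume "\<exists>h c. bounded_linear h \<and> f = (\<lambda>x. h x + c)"
  then obtain h c where h: "bounded_linear h" and f: "f = (\<lambda>x. h x + c)" by blast
  show "f differentiable_on UNIV"
    unfolding f using bounded_linear_imp_differentiable_on[OF h] by (intro derivative_intros)
  show "\<exists>h c. bounded_linear h \<and> partial i f = (\<lambda>x. h x + c)" for i
    unfolding f partial_linear_part[OF h]
    by (intro exI[of _ "\<lambda>x. 0"] exI[of _ "h (axis i 1)"]) (auto intro: bounded_linear_zero)
  obtain K where K: "K \<ge> 0" "\<And>a. norm (h a) \<le> norm a * K"
    using bounded_linear.nonneg_bounded[OF h] by metis
  have "norm (f x) \<le> (K + norm c) * (1 + norm x) ^ 1" for x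
  proof -
    have "norm (f x) \<le> norm x * K + norm c"
      unfolding f using K(2)[of x] by (intro norm_triangle_le) auto
    also have "\<dots> \<le> (K + norm c) * (1 + norm x) ^ 1" using K(1) by (simp add: algebra_simps)
    finally show ?thesis .
  qed
  then show "\<exists>C N. \<forall>x. norm (f x) \<le> C * (1 + norm x) ^ N" by blast
qed

lemma slow_coordinate: "slow1 (\<lambda>x. complex_of_real (x $ i))"
  by (rule slow_bounded_linear[OF bounded_linear_compose[OF bounded_linear_of_real bounded_linear_vec_nth]])

lemma has_derivative_cis_inner:
  "((\<lambda>x. cis (x \<bullet> \<xi>)) has_derivative (\<lambda>h. \<i> * of_real (h \<bullet> \<xi>) * cis (x \<bullet> \<xi>))) (at x)"
  unfolding cis.code complex_eq_iff Complex_eq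
  by (rule derivative_eq_intros refl | simp)+ (auto simp: fun_eq_iff complex_eq_iff)

lemma partial_cis_inner:
  "partial i (\<lambda>x. cis (x \<bullet> \<xi>)) = (\<lambda>x. \<i> * of_real (\<xi> $ i) * cis (x \<bullet> \<xi>))"
  by (rule ext, subst partial_eq[OF has_derivative_cis_inner]) (simp add: inner_axis' )

lemma slow_cis_inner: "slow1 (\<lambda>x. cis (x \<bullet> \<xi>))"
proof (rule slow_coinduct[where P = "\<lambda>f. \<exists>c. f = (\<lambda>x. c * cis (x \<bullet> \<xi>))"])
  show "\<exists>c. (\<lambda>x. cis (x \<bullet> \<xi>)) = (\<lambda>x. c * cis (x \<bullet> \<xi>))" by (rule exI[of _ 1]) simp
next
  fix f assume "\<exists>c. f = (\<lambda>x. c * cis (x \<bullet> \<xi>))"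
  then obtain c where f: "f = (\<lambda>x. c * cis (x \<bullet> \<xi>))" by blast
  have d: "(\<lambda>x. cis (x \<bullet> \<xi>)) differentiable_on UNIV"
    unfolding differentiable_on_def differentiable_def using has_derivative_cis_inner by blast
  show "f differentiable_on UNIV"
    unfolding f by (rule differentiable_on_linear[OF bounded_linear_mult_right d])
  show "\<exists>c. partial i f = (\<lambda>x. c * cis (x \<bullet> \<xi>))" for i
    unfolding f partial_linear[OF bounded_linear_mult_right d] partial_cis_inner
    by (rule exI[of _ "c * (\<i> * of_real (\<xi> $ i))"]) (simp add: mult_ac)
  have "norm (f x) \<le> norm c * (1 + norm x) ^ 0" for x by (simp add: f norm_mult)
  then show "\<exists>C N. \<forall>x. norm (f x) \<le> C * (1 + norm x) ^ N" by blast
qed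

lemmas schwartz_slow_mult = schwartz_operator[OF tame_multiplication[OF bounded_bilinear_mult]]

section \<open>Integration of functions of sufficient decay\<close>

definition decaying :: "nat \<Rightarrow> (real^'n::finite \<Rightarrow> complex) \<Rightarrow> bool" where
  "decaying k f \<longleftrightarrow> continuous_on UNIV f \<and> (\<exists>C. \<forall>x. (1 + norm x) ^ k * norm (f x) \<le> C)"

lemma decaying_mult:
  assumes "decaying (j + k) f" "continuous_on UNIV u" "\<And>x. norm (u x) \<le> B * (1 + norm x) ^ j"
  shows "decaying k (\<lambda>x. u x * f x)"
proof -
  obtain C where C: "\<And>x. (1 + norm x) ^ (j + k) * norm (f x) \<le> C"
    using assms by (auto simp: decaying_def)
  have B: "B \<ge> 0" using order_trans[OF norm_ge_zero assms(3)[of 0]] by simp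
  have "(1 + norm x) ^ k * norm (u x * f x) \<le> B * C" for x
  proof -
    have "(1 + norm x) ^ k * norm (u x * f x) \<le> (1 + norm x) ^ k * ((B * (1 + norm x) ^ j) * norm (f x))"
      unfolding norm_mult by (intro mult_left_mono mult_right_mono assms) auto
    also have "\<dots> = B * ((1 + norm x) ^ (j + k) * norm (f x))" by (simp add: power_add)
    also have "\<dots> \<le> B * C" by (intro mult_left_mono C B)
    finally show ?thesis .
  qed
  moreover have "continuous_on UNIV (\<lambda>x. u x * f x)"
    using assms by (intro continuous_on_mult) (auto simp: decaying_def)
  ultimately show ?thesis unfolding decaying_def by blast
qed

lemma decaying_mono:
  assumes "decaying k f" "j \<le> k" shows "decaying j f"
proof -
  have "decaying j (\<lambda>x. 1 * f x)"
    by (rule decaying_mult[of "k - j" j f "\<lambda>_. 1" 1]) (use assms in \<open>auto intro: continuous_intros\<close>)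
  then show ?thesis by simp
qed

lemma decaying_unimodular:
  assumes "decaying k f" "continuous_on UNIV u" "\<And>x. norm (u x) \<le> 1"
  shows "decaying k (\<lambda>x. u x * f x)"
  using decaying_mult[of 0 k f u 1] assms by simp

lemma schwartz_decaying: "\<phi> \<in> schwartz \<Longrightarrow> decaying k \<phi>"
  using smooth_continuous[OF schwartz_smooth, of \<phi> "[]"] seminorm_upper[of \<phi> _ k "[]"]
  unfolding decaying_def by auto

text \<open>With the exponent \<open>2 n\<close> the weight is dominated by the product of the one-dimensional functions
  \<open>1 / (1 + x\<^sub>i\<^sup>2)\<close>, whose integral is known.\<close>

abbreviation weight :: "real^'n::finite \<Rightarrow> real" where
  "weight x \<equiv> 1 / (1 + norm x) ^ (2 * CARD('n))"

lemma integrable_weight: "integrable lborel (weight :: real^'n::finite \<Rightarrow> real)"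
proof (rule integrableI_nonneg)
  have m: "(\<lambda>t::real. ennreal (1 / (1 + t\<^sup>2))) \<in> borel_measurable borel" by measurable
  have "set_integrable lborel UNIV (\<lambda>x::real. 1 / (1 + x\<^sup>2))"
    using integrable_inverse_1_plus_square by (simp add: einterval_def inverse_eq_divide)
  then have fin: "(\<integral>\<^sup>+t. ennreal (1 / (1 + t\<^sup>2)) \<partial>lborel) < \<infinity>"
    by (simp add: set_integrable_def integrable_iff_bounded)
  have "(\<integral>\<^sup>+x. ennreal (weight (x :: real^'n)) \<partial>lborel)
      \<le> (\<integral>\<^sup>+x. (\<Prod>b\<in>Basis. ennreal (1 / (1 + ((x :: real^'n) \<bullet> b)\<^sup>2))) \<partial>lborel)"
  proof (rule nn_integral_mono)
    fix x :: "real^'n"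
    have "(\<Prod>b\<in>Basis. 1 + (x \<bullet> b)\<^sup>2) \<le> (\<Prod>b\<in>(Basis :: (real^'n) set). (1 + norm x)\<^sup>2)"
    proof (rule prod_mono, intro conjI)
      fix b :: "real^'n" assume "b \<in> Basis"
      then have "(x \<bullet> b)\<^sup>2 \<le> (norm x)\<^sup>2"
        using Basis_le_norm[of b x] by (simp add: abs_le_square_iff[symmetric])
      then show "1 + (x \<bullet> b)\<^sup>2 \<le> (1 + norm x)\<^sup>2"
        by (simp add: power2_sum add_increasing2)
    qed (simp add: add_nonneg_nonneg)
    also have "\<dots> = (1 + norm x) ^ (2 * CARD('n))" by (simp add: power_mult)
    finally have "weight x \<le> 1 / (\<Prod>b\<in>Basis. 1 + (x \<bullet> b)\<^sup>2)"
      by (intro divide_left_mono mult_pos_pos prod_pos) (auto simp: add_pos_nonneg)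
    also have "\<dots> = (\<Prod>b\<in>Basis. 1 / (1 + (x \<bullet> b)\<^sup>2))" by (simp add: prod_dividef)
    finally show "ennreal (weight x) \<le> (\<Prod>b\<in>Basis. ennreal (1 / (1 + (x \<bullet> b)\<^sup>2)))"
      by (simp add: prod_ennreal ennreal_leI)
  qed
  also have "\<dots> = (\<Prod>b\<in>(Basis :: (real^'n) set). \<integral>\<^sup>+t. ennreal (1 / (1 + t\<^sup>2)) \<partial>lborel)"
    by (rule nn_integral_lborel_prod) (use m in auto)
  also have "\<dots> < \<infinity>" using fin by (simp add: less_top[symmetric] power_eq_top_ennreal)
  finally show "(\<integral>\<^sup>+x. ennreal (weight (x :: real^'n)) \<partial>lborel) < \<infinity>" .
qed (auto intro!: AE_I2)

lemma decaying_measurable: "decaying k f \<Longrightarrow> f \<in> borel_measurable borel"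
  unfolding decaying_def by (intro borel_measurable_continuous_onI) auto

lemma norm_le_weight:
  fixes x :: "real^'n::finite"
  shows "(1 + norm x) ^ (2 * CARD('n)) * norm y \<le> C \<Longrightarrow> norm y \<le> C * weight x"
  by (simp add: field_simps add_pos_nonneg)

lemma decaying_integrable:
  fixes f :: "real^'n::finite \<Rightarrow> complex"
  assumes "decaying k f" "2 * CARD('n) \<le> k"
  shows "integrable lborel f"
proof -
  obtain C where C: "\<And>x. (1 + norm x) ^ (2 * CARD('n)) * norm (f x) \<le> C"
    using decaying_mono[OF assms] by (auto simp: decaying_def)
  show ?thesis
  proof (rule Bochner_Integration.integrable_bound)
    show "integrable lborel (\<lambda>x::real^'n. C * weight x)" by (intro integrable_mult_right integrable_weight)
    show "f \<in> borel_measurable lborel" using decaying_measurable[OF assms(1)] by simp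
    show "AE x in lborel. norm (f x) \<le> norm (C * weight x)"
    proof (rule AE_I2)
      fix x
      have "norm (f x) \<le> C * weight x" by (rule norm_le_weight[OF C])
      also have "\<dots> \<le> norm (C * weight x)" by (simp only: real_norm_def abs_ge_self)
      finally show "norm (f x) \<le> norm (C * weight x)" .
    qed
  qed
qed

lemma integral_norm_le_weight:
  fixes f :: "real^'n::finite \<Rightarrow> complex"
  assumes "integrable lborel f" "\<And>x. (1 + norm x) ^ (2 * CARD('n)) * norm (f x) \<le> C"
  shows "norm (\<integral>x. f x \<partial>lborel) \<le> C * (\<integral>x. weight (x :: real^'n) \<partial>lborel)"
proof -
  have "norm (\<integral>x. f x \<partial>lborel) \<le> (\<integral>x. C * weight (x :: real^'n) \<partial>lborel)"
    by (intro Bochner_Integration.integral_norm_bound_integral assms integrable_mult_right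
        integrable_weight norm_le_weight)
  then show ?thesis by (simp only: integral_mult_right_zero)
qed

lemma integral_affine:
  fixes f :: "real^'n::finite \<Rightarrow> complex"
  assumes [measurable]: "f \<in> borel_measurable borel" and c: "c \<noteq> 0"
  shows "(\<integral>x. f x \<partial>lborel) = \<bar>c\<bar> ^ CARD('n) *\<^sub>R (\<integral>x. f (a + c *\<^sub>R x) \<partial>lborel)"
  by (subst lborel_affine[OF c, of a]) (simp add: integral_density integral_distr)

lemma norm_diff_le_vector_derivative:
  fixes f :: "real \<Rightarrow> 'b::real_normed_vector"
  assumes "a \<le> b" "\<And>t. t \<in> {a..b} \<Longrightarrow> (f has_vector_derivative f' t) (at t within {a..b})"
    and "\<And>t. t \<in> {a..b} \<Longrightarrow> norm (f' t) \<le> B"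
  shows "norm (f b - f a) \<le> B * (b - a)"
proof -
  have "norm (f b - f a) \<le> B * norm (b - a)"
  proof (rule differentiable_bound[of "{a..b}" f "\<lambda>t h. h *\<^sub>R f' t"])
    fix t assume t: "t \<in> {a..b}"
    show "(f has_derivative (\<lambda>h. h *\<^sub>R f' t)) (at t within {a..b})"
      using assms(2)[OF t] by (simp add: has_vector_derivative_def)
    show "onorm (\<lambda>h. h *\<^sub>R f' t) \<le> B"
      using mult_left_mono[OF assms(3)[OF t] abs_ge_zero] by (intro onorm_le) (simp add: mult.commute)
  qed (use assms in auto)
  then show ?thesis using assms by simp
qed

lemma has_vector_derivative_iff_tendsto:
  fixes f :: "real \<Rightarrow> 'b::real_normed_vector"
  shows "(f has_vector_derivative D) (at t within S) \<longleftrightarrow>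
    ((\<lambda>s. (f s - f t) /\<^sub>R (s - t)) \<longlongrightarrow> D) (at t within S)"
proof -
  have "norm (f s - f t - (s - t) *\<^sub>R D) / norm (s - t) = norm ((f s - f t) /\<^sub>R (s - t) - D)"
    if "s \<noteq> t" for s
  proof -
    have "(f s - f t) /\<^sub>R (s - t) - D = (f s - f t - (s - t) *\<^sub>R D) /\<^sub>R (s - t)"
      using that by (simp add: scaleR_diff_right)
    then show ?thesis by (simp add: divide_inverse_commute)
  qed
  then have "((\<lambda>s. norm (f s - f t - (s - t) *\<^sub>R D) / norm (s - t)) \<longlongrightarrow> 0) (at t within S)
      \<longleftrightarrow> ((\<lambda>s. norm ((f s - f t) /\<^sub>R (s - t) - D)) \<longlongrightarrow> 0) (at t within S)"
    by (intro Lim_cong_within) auto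
  also have "\<dots> \<longleftrightarrow> ((\<lambda>s. (f s - f t) /\<^sub>R (s - t)) \<longlongrightarrow> D) (at t within S)"
    by (simp add: tendsto_norm_zero_iff LIM_zero_iff)
  finally show ?thesis
    by (simp add: has_vector_derivative_def has_derivative_iff_norm bounded_linear_scaleR_left)
qed

text \<open>Translation invariance makes the integrals of the difference quotients of \<open>\<psi>\<close> vanish, and these
  converge dominatedly.\<close>

lemma integral_partial_schwartz:
  fixes \<psi> :: "real^'n::finite \<Rightarrow> complex"
  assumes psi: "\<psi> \<in> schwartz"
  shows "(\<integral>x. partial i \<psi> x \<partial>lborel) = 0"
proof -
  let ?e = "axis i 1 :: real^'n"
  define h where "h j = 1 / real (Suc j)" for j
  have h: "h j > 0" "h j \<le> 1" for j by (auto simp: h_def divide_le_eq)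
  define s where "s j x = (\<psi> (x + h j *\<^sub>R ?e) - \<psi> x) /\<^sub>R h j" for j x
  let ?n = "2 * CARD('n)"
  obtain C where C: "C \<ge> 0" "\<And>x. (1 + norm x) ^ ?n * norm (mderiv [i] \<psi> x) \<le> C"
    by (rule schwartz_seminorm_bound[OF psi, of ?n "[i]"]) blast
  note d = smooth_differentiable[OF schwartz_smooth[OF psi]]
  have cont: "continuous_on UNIV \<psi>" by (rule differentiable_imp_continuous_on[OF d])
  have m[measurable]: "\<psi> \<in> borel_measurable borel" using cont by (rule borel_measurable_continuous_onI)
  have pm: "partial i \<psi> \<in> borel_measurable borel"
    using decaying_measurable[OF schwartz_decaying[OF schwartz_partial[OF psi]]] .
  have int: "integrable lborel \<psi>" by (rule decaying_integrable[OF schwartz_decaying[OF psi] order_refl])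
  have int2: "integrable lborel (\<lambda>x. \<psi> (x + h j *\<^sub>R ?e))" for j
    using decaying_integrable[OF schwartz_decaying[OF schwartz_affine[OF _ psi, of 1 "h j *\<^sub>R ?e"]] order_refl]
    by (simp add: add.commute)
  have "(\<integral>x. s j x \<partial>lborel) = 0" for j
  proof -
    have "(\<integral>x. \<psi> (x + h j *\<^sub>R ?e) \<partial>lborel) = (\<integral>x. \<psi> x \<partial>lborel)"
      using integral_affine[OF m, of 1 "h j *\<^sub>R ?e"] by (simp add: add.commute)
    then show ?thesis unfolding s_def by (simp add: int int2)
  qed
  moreover have "(\<lambda>j. \<integral>x. s j x \<partial>lborel) \<longlonglongrightarrow> (\<integral>x. partial i \<psi> x \<partial>lborel)"
  proof (rule integral_dominated_convergence)
    show "partial i \<psi> \<in> borel_measurable lborel" using pm by simp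
    show "s j \<in> borel_measurable lborel" for j unfolding s_def by measurable
    show "integrable lborel (\<lambda>x::real^'n. (2 ^ ?n * C) * weight x)" by (intro integrable_mult_right integrable_weight)
    show "AE x in lborel. (\<lambda>j. s j x) \<longlonglongrightarrow> partial i \<psi> x"
    proof (rule AE_I2)
      fix x
      have "((\<lambda>t. \<psi> (x + t *\<^sub>R ?e)) has_vector_derivative partial i \<psi> x) (at 0)"
        using has_vector_derivative_partial[OF d, of x i 0] by simp
      then have "((\<lambda>t. (\<psi> (x + t *\<^sub>R ?e) - \<psi> x) /\<^sub>R t) \<longlongrightarrow> partial i \<psi> x) (at 0)"
        by (simp add: has_vector_derivative_iff_tendsto)
      moreover have "filterlim h (at 0) sequentially"
        unfolding filterlim_at h_def using LIMSEQ_inverse_real_of_nat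
        by (auto simp: inverse_eq_divide)
      ultimately show "(\<lambda>j. s j x) \<longlonglongrightarrow> partial i \<psi> x"
        unfolding s_def by (rule filterlim_compose)
    qed
    show "AE x in lborel. norm (s j x) \<le> (2 ^ ?n * C) * weight x" for j
    proof (rule AE_I2)
      fix x
      have "norm (\<psi> (x + h j *\<^sub>R ?e) - \<psi> (x + 0 *\<^sub>R ?e)) \<le> (2 ^ ?n * C * weight x) * (h j - 0)"
      proof (rule norm_diff_le_vector_derivative[where f' = "\<lambda>t. partial i \<psi> (x + t *\<^sub>R ?e)"])
        fix t assume t: "t \<in> {0..h j}"
        show "((\<lambda>t. \<psi> (x + t *\<^sub>R ?e)) has_vector_derivative partial i \<psi> (x + t *\<^sub>R ?e)) (at t within {0..h j})"
          by (rule has_vector_derivative_at_within[OF has_vector_derivative_partial[OF d]])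
        have "norm x \<le> norm (x + t *\<^sub>R ?e) + norm (t *\<^sub>R ?e)"
          using norm_triangle_ineq4[of "x + t *\<^sub>R ?e" "t *\<^sub>R ?e"] by simp
        moreover have "norm (t *\<^sub>R ?e) \<le> 1" using t h[of j] by simp
        moreover have "1 + a \<le> 2 * (1 + b)" if "a \<le> b + c" "c \<le> 1" "0 \<le> b" for a b c :: real
          using that by simp
        ultimately have x: "1 + norm x \<le> 2 * (1 + norm (x + t *\<^sub>R ?e))"
          using norm_ge_zero by blast
        have "(1 + norm x) ^ ?n * norm (partial i \<psi> (x + t *\<^sub>R ?e))
            \<le> (2 * (1 + norm (x + t *\<^sub>R ?e))) ^ ?n * norm (partial i \<psi> (x + t *\<^sub>R ?e))"
          using x by (intro mult_right_mono power_mono) auto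
        also have "\<dots> \<le> 2 ^ ?n * C"
          unfolding power_mult_distrib mult.assoc
          using C(2)[of "x + t *\<^sub>R ?e"] by (intro mult_left_mono) auto
        finally show "norm (partial i \<psi> (x + t *\<^sub>R ?e)) \<le> 2 ^ ?n * C * weight x"
          by (rule norm_le_weight)
      qed (use h[of j] in simp)
      moreover have "norm (s j x) = norm (\<psi> (x + h j *\<^sub>R ?e) - \<psi> x) / h j"
        using h(1)[of j] by (simp add: s_def divide_inverse_commute)
      ultimately show "norm (s j x) \<le> (2 ^ ?n * C) * weight x"
        using h(1)[of j] by (simp add: pos_divide_le_eq)
    qed
  qed
  ultimately show ?thesis by (simp add: LIMSEQ_const_iff)
qed

section \<open>The Fourier transformation\<close>

lemma fourier_cis: "fourier \<phi> \<xi> = (\<integral>x. cis (- (x \<bullet> \<xi>)) * \<phi> x \<partial>lborel)"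
  by (simp add: fourier_def cis_conv_exp)

lemma decaying_fourier_integrand:
  fixes f :: "real^'n::finite \<Rightarrow> complex"
  assumes "decaying k f"
  shows "decaying k (\<lambda>x. cis (- (x \<bullet> \<xi>)) * f x)"
  by (rule decaying_unimodular[OF assms]) (auto intro!: continuous_intros)

lemma fourier_integrable:
  fixes f :: "real^'n::finite \<Rightarrow> complex"
  assumes "decaying k f" "2 * CARD('n) \<le> k"
  shows "integrable lborel (\<lambda>x. cis (- (x \<bullet> \<xi>)) * f x)"
  by (rule decaying_integrable[OF decaying_fourier_integrand[OF assms(1)] assms(2)])

lemma fourier_bound:
  fixes f :: "real^'n::finite \<Rightarrow> complex"
  assumes "decaying (2 * CARD('n)) f" "\<And>x. (1 + norm x) ^ (2 * CARD('n)) * norm (f x) \<le> C"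
  shows "norm (fourier f \<xi>) \<le> C * (\<integral>x. weight (x :: real^'n) \<partial>lborel)"
  unfolding fourier_cis using assms(2)
  by (intro integral_norm_le_weight fourier_integrable[OF assms(1)]) (auto simp: norm_mult)

lemma fourier_add:
  fixes f g :: "real^'n::finite \<Rightarrow> complex"
  assumes "decaying (2 * CARD('n)) f" "decaying (2 * CARD('n)) g"
  shows "fourier (\<lambda>x. f x + g x) \<xi> = fourier f \<xi> + fourier g \<xi>"
  unfolding fourier_cis distrib_left
  by (intro Bochner_Integration.integral_add fourier_integrable[OF assms(1)] fourier_integrable[OF assms(2)] order_refl)

lemma fourier_sum:
  fixes f :: "'j \<Rightarrow> real^'n::finite \<Rightarrow> complex"
  assumes "\<And>j. j \<in> J \<Longrightarrow> decaying (2 * CARD('n)) (f j)"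
  shows "fourier (\<lambda>x. \<Sum>j\<in>J. f j x) \<xi> = (\<Sum>j\<in>J. fourier (f j) \<xi>)"
  unfolding fourier_cis sum_distrib_left
  by (intro Bochner_Integration.integral_sum fourier_integrable[OF assms order_refl])

lemma fourier_cmult: "fourier (\<lambda>x. c * f x) \<xi> = c * fourier f \<xi>"
  unfolding fourier_cis by (simp add: mult.left_commute)

lemma norm_cis_minus_linear: "norm (cis s - 1 - \<i> * of_real s) \<le> s\<^sup>2"
proof -
  have "norm (cis s - 1 - \<i> * of_real s) \<le> \<bar>s\<bar> ^ 2 / 2"
    using iexp_approx1[of s 1] by (simp add: cis_conv_exp numeral_2_eq_2 algebra_simps)
  also have "\<dots> \<le> s\<^sup>2" by simp
  finally show ?thesis .
qed

lemma continuous_inner_complex: "continuous_on S (\<lambda>x. c * complex_of_real (x \<bullet> h))"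
  by (intro continuous_intros)

lemma decaying_inner:
  assumes "decaying (Suc k) f"
  shows "decaying k (\<lambda>x. c * complex_of_real (x \<bullet> h) * f x)"
proof (rule decaying_mult[where j = 1 and B = "norm c * norm h"])
  show "norm (c * complex_of_real (x \<bullet> h)) \<le> norm c * norm h * (1 + norm x) ^ 1" for x
  proof -
    have "norm c * \<bar>x \<bullet> h\<bar> \<le> norm c * (norm h * (1 + norm x))"
      using Cauchy_Schwarz_ineq2[of x h]
      by (intro mult_left_mono) (auto simp: distrib_left mult.commute intro: add_increasing)
    then show ?thesis by (simp add: norm_mult mult.assoc)
  qed
qed (use assms in \<open>auto intro: continuous_inner_complex\<close>)

text \<open>Differentiation under the integral sign; the remainder is estimated by
  \<open>|e\<^sup>i\<^sup>s - 1 - i s| \<le> s\<^sup>2\<close>.\<close>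

lemma fourier_has_derivative:
  fixes f :: "real^'n::finite \<Rightarrow> complex"
  assumes f: "decaying (2 * CARD('n) + 2) f"
  shows "(fourier f has_derivative (\<lambda>h. fourier (\<lambda>x. - \<i> * complex_of_real (x \<bullet> h) * f x) \<xi>)) (at \<xi>)"
proof -
  let ?n = "2 * CARD('n)"
  let ?D = "\<lambda>h. fourier (\<lambda>x. - \<i> * complex_of_real (x \<bullet> h) * f x) \<xi>"
  obtain C where C: "\<And>x. (1 + norm x) ^ (?n + 2) * norm (f x) \<le> C"
    using f by (auto simp: decaying_def)
  have f0: "decaying ?n f" and f1: "decaying (Suc ?n) f"
    using f by (auto intro: decaying_mono)
  have lin: "linear ?D"
  proof (rule linearI)
    fix h k
    have "?D (h + k) = fourier (\<lambda>x. - \<i> * complex_of_real (x \<bullet> h) * f x + - \<i> * complex_of_real (x \<bullet> k) * f x) \<xi>"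
      by (simp add: inner_add_right algebra_simps)
    also have "\<dots> = ?D h + ?D k" by (intro fourier_add decaying_inner f1)
    finally show "?D (h + k) = ?D h + ?D k" .
  next
    fix r h
    have "?D (r *\<^sub>R h) = fourier (\<lambda>x. of_real r * (- \<i> * complex_of_real (x \<bullet> h) * f x)) \<xi>"
      by (simp add: mult_ac)
    also have "\<dots> = r *\<^sub>R ?D h" unfolding fourier_cmult by (simp add: scaleR_conv_of_real)
    finally show "?D (r *\<^sub>R h) = r *\<^sub>R ?D h" .
  qed
  define W where "W = C * (\<integral>x. weight (x :: real^'n) \<partial>lborel)"
  have rem: "norm (fourier f (\<xi> + h) - fourier f \<xi> - ?D h) \<le> W * (norm h)\<^sup>2" for h
  proof -
    let ?r = "\<lambda>x. cis (- (x \<bullet> (\<xi> + h))) * f x - cis (- (x \<bullet> \<xi>)) * f x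
      - cis (- (x \<bullet> \<xi>)) * (- \<i> * complex_of_real (x \<bullet> h) * f x)"
    have i: "integrable lborel (\<lambda>x. cis (- (x \<bullet> (\<xi> + h))) * f x)"
      "integrable lborel (\<lambda>x. cis (- (x \<bullet> \<xi>)) * f x)"
      "integrable lborel (\<lambda>x. cis (- (x \<bullet> \<xi>)) * (- \<i> * complex_of_real (x \<bullet> h) * f x))"
      by (intro fourier_integrable[OF _ order_refl] f0 decaying_inner f1)+
    have "norm (\<integral>x. ?r x \<partial>lborel) \<le> (C * (norm h)\<^sup>2) * (\<integral>x. weight (x :: real^'n) \<partial>lborel)"
    proof (rule integral_norm_le_weight)
      show "integrable lborel ?r" by (intro Bochner_Integration.integrable_diff i)
      fix x
      have "?r x = cis (- (x \<bullet> \<xi>)) * (cis (- (x \<bullet> h)) - 1 - \<i> * of_real (- (x \<bullet> h))) * f x"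
        using cis_mult[of "- (x \<bullet> \<xi>)" "- (x \<bullet> h)"] by (simp add: inner_add_right algebra_simps)
      then have "norm (?r x) = norm (cis (- (x \<bullet> h)) - 1 - \<i> * of_real (- (x \<bullet> h))) * norm (f x)"
        by (simp add: norm_mult)
      also have "\<dots> \<le> (x \<bullet> h)\<^sup>2 * norm (f x)"
        using norm_cis_minus_linear[of "- (x \<bullet> h)"] by (intro mult_right_mono) auto
      also have "\<dots> \<le> ((1 + norm x)\<^sup>2 * (norm h)\<^sup>2) * norm (f x)"
      proof (intro mult_right_mono)
        have "\<bar>x \<bullet> h\<bar> \<le> norm x * norm h" by (rule Cauchy_Schwarz_ineq2)
        also have "\<dots> \<le> (1 + norm x) * norm h" by (intro mult_right_mono) auto
        finally have "\<bar>x \<bullet> h\<bar>\<^sup>2 \<le> ((1 + norm x) * norm h)\<^sup>2" by (intro power_mono) auto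
        then show "(x \<bullet> h)\<^sup>2 \<le> (1 + norm x)\<^sup>2 * (norm h)\<^sup>2" by (simp add: power_mult_distrib)
      qed simp
      finally have "norm (?r x) \<le> (1 + norm x)\<^sup>2 * (norm h)\<^sup>2 * norm (f x)" .
      then have "(1 + norm x) ^ ?n * norm (?r x) \<le> (1 + norm x) ^ ?n * ((1 + norm x)\<^sup>2 * (norm h)\<^sup>2 * norm (f x))"
        by (rule mult_left_mono) simp
      also have "\<dots> = ((1 + norm x) ^ (?n + 2) * norm (f x)) * (norm h)\<^sup>2"
        by (simp add: power_add power2_eq_square mult_ac)
      also have "\<dots> \<le> C * (norm h)\<^sup>2" by (intro mult_right_mono C) auto
      finally show "(1 + norm x) ^ ?n * norm (?r x) \<le> C * (norm h)\<^sup>2" .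
    qed
    moreover have "(\<integral>x. ?r x \<partial>lborel) = fourier f (\<xi> + h) - fourier f \<xi> - ?D h"
      unfolding fourier_cis
      by (simp only: Bochner_Integration.integral_diff[OF Bochner_Integration.integrable_diff[OF i(1,2)] i(3)]
          Bochner_Integration.integral_diff[OF i(1,2)])
    ultimately show ?thesis by (simp add: W_def mult_ac)
  qed
  show ?thesis
    unfolding has_derivative_at
  proof (intro conjI)
    show "bounded_linear ?D" using lin by (simp add: linear_conv_bounded_linear)
    show "(\<lambda>h. norm (fourier f (\<xi> + h) - fourier f \<xi> - ?D h) / norm h) \<midarrow>0\<rightarrow> 0"
    proof (rule Lim_null_comparison)
      have "norm (norm (fourier f (\<xi> + h) - fourier f \<xi> - ?D h) / norm h) \<le> W * norm h" for h
      proof (cases "h = 0")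
        case False
        then show ?thesis using rem[of h] by (simp add: divide_le_eq power2_eq_square mult_ac)
      qed simp
      then show "\<forall>\<^sub>F h in at 0. norm (norm (fourier f (\<xi> + h) - fourier f \<xi> - ?D h) / norm h) \<le> W * norm h"
        by (simp add: eventually_at_filter)
      show "(\<lambda>h::real^'n. W * norm h) \<midarrow>0\<rightarrow> 0" by (auto intro!: tendsto_eq_intros)
    qed
  qed
qed

lemma fourier_differentiable:
  fixes f :: "real^'n::finite \<Rightarrow> complex"
  assumes "decaying (2 * CARD('n) + 2) f"
  shows "fourier f differentiable_on UNIV"
  unfolding differentiable_on_def differentiable_def using fourier_has_derivative[OF assms] by blast

lemma partial_fourier:
  fixes f :: "real^'n::finite \<Rightarrow> complex"
  assumes "decaying (2 * CARD('n) + 2) f"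
  shows "partial i (fourier f) = fourier (\<lambda>x. - \<i> * complex_of_real (x $ i) * f x)"
  by (rule ext, subst partial_eq[OF fourier_has_derivative[OF assms]]) (simp add: inner_axis)

text \<open>The power \<open>(-i x)\<^sup>\<alpha>\<close>, the factor that \<open>\<partial>\<^sup>\<alpha>\<close> produces under the Fourier integral.\<close>

definition monomial :: "'n list \<Rightarrow> real^'n::finite \<Rightarrow> complex" where
  "monomial \<alpha> x = (\<Prod>i\<leftarrow>\<alpha>. - \<i> * complex_of_real (x $ i))"

lemma monomial_simps [simp]:
  "monomial [] = (\<lambda>x. 1)"
  "monomial (i # \<alpha>) = (\<lambda>x. - \<i> * complex_of_real (x $ i) * monomial \<alpha> x)"
  by (auto simp: monomial_def)

lemma slow_monomial: "slow1 (monomial \<alpha>)"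
proof (induction \<alpha>)
  case (Cons i \<alpha>)
  have "slow1 (\<lambda>x. - \<i> * complex_of_real (x $ i))"
    by (rule slow_linear[OF bounded_linear_mult_right slow_coordinate])
  from slow_bilinear[OF bounded_bilinear_mult this Cons] show ?case by simp
qed (simp add: slow_const)

lemma decaying_coordinate:
  assumes "decaying (Suc k) f"
  shows "decaying k (\<lambda>x. - \<i> * complex_of_real (x $ i) * f x)"
  using decaying_inner[OF assms, of "-\<i>" "axis i 1"] by (simp add: inner_axis)

lemma decaying_monomial:
  assumes "decaying (k + length \<alpha>) f"
  shows "decaying k (\<lambda>x. monomial \<alpha> x * f x)"
  using assms
proof (induction \<alpha> arbitrary: k)
  case (Cons i \<alpha>)
  then have "decaying (Suc k) (\<lambda>x. monomial \<alpha> x * f x)" by simp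
  from decaying_coordinate[OF this, of i] show ?case by (simp add: mult.assoc)
qed simp

lemma mderiv_fourier:
  fixes f :: "real^'n::finite \<Rightarrow> complex"
  assumes "decaying (2 * CARD('n) + 2 + l) f" "length \<alpha> \<le> Suc l"
  shows "mderiv \<alpha> (fourier f) = fourier (\<lambda>x. monomial \<alpha> x * f x)"
  using assms(2)
proof (induction \<alpha>)
  case (Cons i \<alpha>)
  have "decaying (2 * CARD('n) + 2) (\<lambda>x. monomial \<alpha> x * f x)"
    using Cons.prems by (intro decaying_monomial decaying_mono[OF assms(1)]) auto
  from partial_fourier[OF this, of i] Cons show ?case by (simp add: mult.assoc)
qed simp

lemma slow_upto_fourier:
  fixes f :: "real^'n::finite \<Rightarrow> complex"
  assumes "decaying (2 * CARD('n) + 2 + l) f"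
  shows "slow_upto l (fourier f)"
  unfolding slow_upto_def diff_order_def
proof (intro conjI allI impI)
  fix \<alpha> :: "'n list" assume "length \<alpha> < l"
  then show "mderiv \<alpha> (fourier f) differentiable_on UNIV"
    by (subst mderiv_fourier[OF assms])
      (auto intro!: fourier_differentiable decaying_monomial decaying_mono[OF assms])
next
  fix \<alpha> :: "'n list" assume l: "length \<alpha> \<le> l"
  then have d: "decaying (2 * CARD('n)) (\<lambda>x. monomial \<alpha> x * f x)"
    by (intro decaying_monomial decaying_mono[OF assms]) auto
  then obtain C where "\<And>x. (1 + norm x) ^ (2 * CARD('n)) * norm (monomial \<alpha> x * f x) \<le> C"
    by (auto simp: decaying_def)
  from fourier_bound[OF d this] obtain C where "\<And>\<xi>. norm (mderiv \<alpha> (fourier f) \<xi>) \<le> C * (1 + norm \<xi>) ^ 0"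
    unfolding mderiv_fourier[OF assms le_SucI[OF l]] by simp blast
  then show "\<exists>C N. \<forall>x. norm (mderiv \<alpha> (fourier f) x) \<le> C * (1 + norm x) ^ N" by blast
qed

lemma smooth_fourier: "\<phi> \<in> schwartz \<Longrightarrow> smooth (fourier \<phi>)"
  unfolding smooth_iff_diff_order
  using slow_upto_fourier[OF schwartz_decaying] by (auto simp: slow_upto_def)

lemma mderiv_fourier_schwartz:
  "\<phi> \<in> schwartz \<Longrightarrow> mderiv \<alpha> (fourier \<phi>) = fourier (\<lambda>x. monomial \<alpha> x * \<phi> x)"
  by (rule mderiv_fourier[OF schwartz_decaying le_SucI[OF order_refl]])

lemma slow_cis_neg_inner: "slow1 (\<lambda>x. cis (- (x \<bullet> \<xi>)))"
  using slow_cis_inner[of "- \<xi>"] by simp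

text \<open>Integration by parts: the integral of \<open>\<partial>\<^sub>i (e\<^bsup>-i x \<xi>\<^esup> \<phi>(x))\<close> vanishes.\<close>

lemma fourier_partial:
  assumes phi: "\<phi> \<in> schwartz"
  shows "fourier (partial i \<phi>) \<xi> = \<i> * of_real (\<xi> $ i) * fourier \<phi> \<xi>"
proof -
  let ?e = "\<lambda>x. cis (- (x \<bullet> \<xi>))"
  have s: "(\<lambda>x. ?e x * \<phi> x) \<in> schwartz" by (rule schwartz_slow_mult[OF slow_cis_neg_inner phi])
  have "partial i (\<lambda>x. ?e x * \<phi> x) = (\<lambda>x. partial i ?e x * \<phi> x + ?e x * partial i \<phi> x)"
    by (rule partial_bilinear[OF bounded_bilinear_mult smooth_differentiable[OF slow_smooth[OF slow_cis_neg_inner]]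
        smooth_differentiable[OF schwartz_smooth[OF phi]]])
  also have "partial i ?e = (\<lambda>x. - \<i> * of_real (\<xi> $ i) * ?e x)"
    using partial_cis_inner[of i "- \<xi>"] by simp
  finally have "0 = (\<integral>x. - \<i> * of_real (\<xi> $ i) * (?e x * \<phi> x) + ?e x * partial i \<phi> x \<partial>lborel)"
    using integral_partial_schwartz[OF s, of i] by (simp add: mult.assoc)
  also have "\<dots> = (\<integral>x. - \<i> * of_real (\<xi> $ i) * (?e x * \<phi> x) \<partial>lborel) + (\<integral>x. ?e x * partial i \<phi> x \<partial>lborel)"
    by (intro Bochner_Integration.integral_add integrable_mult_right
        fourier_integrable[OF schwartz_decaying order_refl] phi schwartz_partial)
  also have "\<dots> = - \<i> * of_real (\<xi> $ i) * fourier \<phi> \<xi> + fourier (partial i \<phi>) \<xi>"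
    by (simp add: fourier_cis)
  finally show ?thesis by (simp add: algebra_simps eq_neg_iff_add_eq_0)
qed

text \<open>Each power of \<open>1 + |\<xi>|\<close> costs one derivative of \<open>\<phi>\<close> in every coordinate direction.\<close>

lemma fourier_decay_bound:
  "\<exists>C M. C \<ge> 0 \<and> (\<forall>\<phi>\<in>schwartz. \<forall>\<xi>. (1 + norm \<xi>) ^ k * norm (fourier \<phi> \<xi>)
     \<le> C * schwartz_norm M (\<phi> :: real^'n::finite \<Rightarrow> complex))"
proof (induction k)
  case 0
  let ?n = "2 * CARD('n)"
  let ?W = "\<integral>x. weight (x :: real^'n) \<partial>lborel"
  have "norm (fourier \<phi> \<xi>) \<le> ?W * schwartz_norm ?n \<phi>"
    if phi: "\<phi> \<in> schwartz" for \<phi> :: "real^'n \<Rightarrow> complex" and \<xi>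
    using fourier_bound[OF schwartz_decaying[OF phi], of "schwartz_norm ?n \<phi>" \<xi>]
      schwartz_norm_upper[OF phi order_refl, of "[]"] by (simp add: mult.commute)
  moreover have "?W \<ge> 0" by (intro integral_nonneg_AE AE_I2) auto
  ultimately show ?case by (intro exI[of _ ?W] exI[of _ ?n]) auto
next
  case (Suc k)
  then obtain C M where C: "C \<ge> 0" and M: "\<And>\<phi> \<xi>. \<phi> \<in> schwartz \<Longrightarrow>
      (1 + norm \<xi>) ^ k * norm (fourier \<phi> \<xi>) \<le> C * schwartz_norm M (\<phi> :: real^'n \<Rightarrow> complex)" by blast
  have "\<exists>D L. D \<ge> 0 \<and> (\<forall>\<phi>\<in>schwartz. schwartz_norm M (partial i \<phi>)
      \<le> D * schwartz_norm L (\<phi> :: real^'n \<Rightarrow> complex))" for i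
    by (rule tame_norm_bound[OF tame_partial[of "{()}" i], of M]) blast
  then obtain D L where D: "\<And>i. D i \<ge> 0" and L: "\<And>i \<phi>. \<phi> \<in> schwartz \<Longrightarrow>
      schwartz_norm M (partial i \<phi>) \<le> D i * schwartz_norm (L i) (\<phi> :: real^'n \<Rightarrow> complex)"
    by metis
  define N where "N = M + (\<Sum>i\<in>UNIV. L i)"
  define E where "E = C + (\<Sum>i\<in>UNIV. C * D i)"
  have "(1 + norm \<xi>) ^ Suc k * norm (fourier \<phi> \<xi>) \<le> E * schwartz_norm N \<phi>"
    if phi: "\<phi> \<in> schwartz" for \<phi> :: "real^'n \<Rightarrow> complex" and \<xi>
  proof -
    let ?F = "(1 + norm \<xi>) ^ k"
    have "(1 + norm \<xi>) ^ Suc k * norm (fourier \<phi> \<xi>) = (1 + norm \<xi>) * (?F * norm (fourier \<phi> \<xi>))"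
      by simp
    also have "\<dots> \<le> (1 + (\<Sum>i\<in>UNIV. \<bar>\<xi> $ i\<bar>)) * (?F * norm (fourier \<phi> \<xi>))"
      by (intro mult_right_mono add_left_mono norm_le_l1_cart) auto
    also have "\<dots> = ?F * norm (fourier \<phi> \<xi>) + (\<Sum>i\<in>UNIV. ?F * norm (fourier (partial i \<phi>) \<xi>))"
      by (simp add: fourier_partial[OF phi] norm_mult distrib_right distrib_left sum_distrib_left mult_ac)
    also have "\<dots> \<le> C * schwartz_norm N \<phi> + (\<Sum>i\<in>UNIV. C * D i * schwartz_norm N \<phi>)"
    proof (intro add_mono sum_mono)
      have "?F * norm (fourier \<phi> \<xi>) \<le> C * schwartz_norm M \<phi>" by (rule M[OF phi])
      also have "\<dots> \<le> C * schwartz_norm N \<phi>"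
        by (intro mult_left_mono schwartz_norm_mono phi C) (simp add: N_def)
      finally show "?F * norm (fourier \<phi> \<xi>) \<le> C * schwartz_norm N \<phi>" .
      fix i
      have "?F * norm (fourier (partial i \<phi>) \<xi>) \<le> C * schwartz_norm M (partial i \<phi>)"
        by (intro M schwartz_partial phi)
      also have "\<dots> \<le> C * (D i * schwartz_norm (L i) \<phi>)" by (intro mult_left_mono L C phi)
      also have "\<dots> \<le> C * (D i * schwartz_norm N \<phi>)"
        by (intro mult_left_mono schwartz_norm_mono phi C D)
          (simp add: N_def trans_le_add2 member_le_sum)
      finally show "?F * norm (fourier (partial i \<phi>) \<xi>) \<le> C * D i * schwartz_norm N \<phi>"
        by (simp add: mult.assoc)
    qed
    also have "\<dots> = E * schwartz_norm N \<phi>" by (simp add: E_def distrib_right sum_distrib_right)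
    finally show ?thesis .
  qed
  moreover have "E \<ge> 0" unfolding E_def using C D by (intro add_nonneg_nonneg sum_nonneg mult_nonneg_nonneg) auto
  ultimately show ?case by blast
qed

text \<open>Derivatives of the Fourier transform are Fourier transforms of products with monomials, so that
  only the decay of a Fourier transform has to be estimated.\<close>

lemma tame_fourier: "tame I (\<lambda>i (\<phi> :: real^'n::finite \<Rightarrow> complex). fourier \<phi>)"
proof (rule tameI)
  show "smooth (fourier \<phi>)" if "\<phi> \<in> schwartz" for \<phi> :: "real^'n \<Rightarrow> complex"
    by (rule smooth_fourier[OF that])
  fix k and \<alpha> :: "'n list"
  obtain C M where C: "C \<ge> 0" and M: "\<And>\<phi> \<xi>. \<phi> \<in> schwartz \<Longrightarrow>
      (1 + norm \<xi>) ^ k * norm (fourier \<phi> \<xi>) \<le> C * schwartz_norm M (\<phi> :: real^'n \<Rightarrow> complex)"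
    using fourier_decay_bound[of k, where 'n = 'n] by blast
  have t: "tame {()} (\<lambda>_ (\<phi> :: real^'n \<Rightarrow> complex) x. monomial \<alpha> x * \<phi> x)"
    by (rule tame_multiplication[OF bounded_bilinear_mult slow_monomial])
  obtain D L where D: "D \<ge> 0" and L: "\<And>i \<phi>. i \<in> {()} \<Longrightarrow> \<phi> \<in> schwartz \<Longrightarrow>
      schwartz_norm M (\<lambda>x. monomial \<alpha> x * \<phi> x) \<le> D * schwartz_norm L (\<phi> :: real^'n \<Rightarrow> complex)"
    by (rule tame_norm_bound[OF t, of M]) blast
  have "(1 + norm \<xi>) ^ k * norm (mderiv \<alpha> (fourier \<phi>) \<xi>) \<le> (C * D) * schwartz_norm L \<phi>"
    if phi: "\<phi> \<in> schwartz" for \<phi> :: "real^'n \<Rightarrow> complex" and \<xi>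
  proof -
    have "(1 + norm \<xi>) ^ k * norm (mderiv \<alpha> (fourier \<phi>) \<xi>)
        \<le> C * schwartz_norm M (\<lambda>x. monomial \<alpha> x * \<phi> x)"
      unfolding mderiv_fourier_schwartz[OF phi] by (intro M schwartz_operator[OF t] phi)
    also have "\<dots> \<le> C * (D * schwartz_norm L \<phi>)" by (intro mult_left_mono C L phi) simp
    finally show ?thesis by simp
  qed
  then show "\<exists>C M. \<forall>i\<in>I. \<forall>\<phi>\<in>schwartz. \<forall>x. (1 + norm x) ^ k * norm (mderiv \<alpha> (fourier \<phi>) x)
      \<le> C * schwartz_norm M (\<phi> :: real^'n \<Rightarrow> complex)" by blast
qed

lemmas schwartz_fourier = schwartz_operator[OF tame_fourier]

text \<open>Fubini's theorem for \<open>(y, \<xi>) \<mapsto> e\<^bsup>-i y \<xi>\<^esup> f(y) g(\<xi>)\<close>.\<close>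

lemma fourier_multiplication:
  fixes f g :: "real^'n::finite \<Rightarrow> complex"
  assumes f: "decaying (2 * CARD('n)) f" and g: "decaying (2 * CARD('n)) g"
  shows "(\<integral>\<xi>. fourier f \<xi> * g \<xi> \<partial>lborel) = (\<integral>y. f y * fourier g y \<partial>lborel)"
proof -
  have c: "continuous_on UNIV f" "continuous_on UNIV g" using f g by (auto simp: decaying_def)
  have int: "integrable lborel f" "integrable lborel g"
    by (rule decaying_integrable[OF f order_refl], rule decaying_integrable[OF g order_refl])
  let ?h = "\<lambda>y \<xi>. cis (- (y \<bullet> \<xi>)) * f y * g \<xi>"
  have "continuous_on UNIV (case_prod ?h)"
    unfolding case_prod_unfold
    by (intro continuous_intros continuous_on_compose2[OF c(1)] continuous_on_compose2[OF c(2)]) auto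
  then have m: "case_prod ?h \<in> borel_measurable (lborel \<Otimes>\<^sub>M lborel)"
    by (simp add: lborel_prod borel_measurable_continuous_onI)
  have "integrable (lborel \<Otimes>\<^sub>M lborel) (case_prod ?h)"
  proof (rule lborel_pair.Fubini_integrable[OF m])
    have "(\<integral>\<xi>. norm (case_prod ?h (y, \<xi>)) \<partial>lborel) = norm (f y) * (\<integral>\<xi>. norm (g \<xi>) \<partial>lborel)" for y
      by (simp add: norm_mult)
    then show "integrable lborel (\<lambda>y. \<integral>\<xi>. norm (case_prod ?h (y, \<xi>)) \<partial>lborel)"
      using int by simp
    have "integrable lborel (\<lambda>\<xi>. f y * (cis (- (\<xi> \<bullet> y)) * g \<xi>))" for y
      by (intro integrable_mult_right fourier_integrable[OF g order_refl])
    then show "AE y in lborel. integrable lborel (\<lambda>\<xi>. case_prod ?h (y, \<xi>))"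
      by (intro AE_I2) (simp add: inner_commute mult_ac)
  qed
  from lborel_pair.Fubini_integral[OF this]
  have "(\<integral>\<xi>. (\<integral>y. (cis (- (y \<bullet> \<xi>)) * f y) * g \<xi> \<partial>lborel) \<partial>lborel)
      = (\<integral>y. (\<integral>\<xi>. f y * (cis (- (\<xi> \<bullet> y)) * g \<xi>) \<partial>lborel) \<partial>lborel)"
    by (simp add: inner_commute mult_ac)
  then show ?thesis by (simp add: fourier_cis)
qed

section \<open>The Gaussian function and Fourier inversion\<close>

definition gauss :: "real^'n::finite \<Rightarrow> complex" where
  "gauss x = complex_of_real (exp (- (x \<bullet> x) / 2))"

lemma gauss_has_derivative: "(gauss has_derivative (\<lambda>h. - of_real (x \<bullet> h) * gauss x)) (at x)"
  unfolding gauss_def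
  by (rule derivative_eq_intros refl | simp)+ (auto simp: fun_eq_iff inner_commute)

lemma gauss_differentiable: "gauss differentiable_on UNIV"
  unfolding differentiable_on_def differentiable_def using gauss_has_derivative by blast

lemma partial_gauss: "partial i gauss = (\<lambda>x. - of_real (x $ i) * gauss x)"
  by (rule ext, subst partial_eq[OF gauss_has_derivative]) (simp add: inner_axis)

lemma norm_gauss_le_1: "norm (gauss x) \<le> 1"
  by (simp add: gauss_def)

text \<open>From \<open>u \<le> e\<^sup>u\<close> for \<open>u = (1 + r) / k\<close> follows \<open>(1 + r)\<^sup>k \<le> k\<^sup>k e\<^bsup>1 + r\<^esup>\<close>, and \<open>r \<le> (1 + r\<^sup>2) / 2\<close> bounds the
  exponent that remains.\<close>

lemma gauss_decay: "(1 + norm x) ^ k * norm (gauss x) \<le> real k ^ k * exp (3 / 2)"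
proof -
  let ?r = "norm x"
  have "(1 + ?r) ^ k \<le> real k ^ k * exp (1 + ?r)"
  proof (cases "k = 0")
    case False
    have "(1 + ?r) / k \<le> exp ((1 + ?r) / k)"
      using exp_ge_add_one_self[of "(1 + ?r) / k"] by linarith
    then have "1 + ?r \<le> k * exp ((1 + ?r) / k)" using False by (simp add: divide_le_eq mult.commute)
    then have "(1 + ?r) ^ k \<le> (k * exp ((1 + ?r) / k)) ^ k" by (rule power_mono) simp
    also have "\<dots> = real k ^ k * exp (1 + ?r)"
      using False by (simp add: power_mult_distrib flip: exp_of_nat_mult)
    finally show ?thesis .
  qed simp
  then have "(1 + ?r) ^ k * norm (gauss x) \<le> real k ^ k * exp (1 + ?r) * exp (- (?r\<^sup>2) / 2)"
    unfolding gauss_def norm_of_real by (intro mult_mono) (auto simp: power2_norm_eq_inner)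
  also have "\<dots> = real k ^ k * exp (1 + ?r - ?r\<^sup>2 / 2)"
    by (simp add: mult.assoc flip: exp_add)
  also have "\<dots> \<le> real k ^ k * exp (3 / 2)"
  proof -
    have "0 \<le> (?r - 1)\<^sup>2" by simp
    then have "1 + ?r - ?r\<^sup>2 / 2 \<le> 3 / 2" by (simp add: power2_diff)
    then show ?thesis by (intro mult_left_mono) auto
  qed
  finally show ?thesis .
qed

text \<open>The products of the Gaussian with functions of slow increase form a class that is stable under
  partial derivatives and consists of rapidly decreasing functions.\<close>

lemma schwartz_slow_gauss:
  assumes q: "slow1 q"
  shows "(\<lambda>x. q x * gauss x) \<in> schwartz"
proof -
  let ?P = "\<lambda>f. \<exists>q. slow1 q \<and> f = (\<lambda>x. q x * gauss x)"
  have diff: "f differentiable_on UNIV" if "?P f" for f :: "real^'a \<Rightarrow> complex"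
    using that differentiable_on_bilinear[OF bounded_bilinear_mult _ gauss_differentiable]
      smooth_differentiable[OF slow_smooth] by blast
  have part: "?P (partial i f)" if "?P f" for i and f :: "real^'a \<Rightarrow> complex"
  proof -
    obtain q where q: "slow1 q" and f: "f = (\<lambda>x. q x * gauss x)" using \<open>?P f\<close> by blast
    have "partial i f = (\<lambda>x. partial i q x * gauss x + q x * partial i gauss x)"
      unfolding f by (rule partial_bilinear[OF bounded_bilinear_mult smooth_differentiable[OF slow_smooth[OF q]]
          gauss_differentiable])
    then have "partial i f = (\<lambda>x. (partial i q x + q x * - of_real (x $ i)) * gauss x)"
      by (simp add: partial_gauss algebra_simps)
    moreover have "slow1 (\<lambda>x. - complex_of_real (x $ i))"
      by (rule slow_linear[OF bounded_linear_minus[OF bounded_linear_ident] slow_coordinate])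
    then have "slow1 (\<lambda>x. partial i q x + q x * - of_real (x $ i))"
      by (intro slow_add slow_partial q slow_bilinear[OF bounded_bilinear_mult])
    ultimately show ?thesis by blast
  qed
  have bound: "\<exists>C. \<forall>x. (1 + norm x) ^ k * norm (f x) \<le> C" if "?P f" for k and f :: "real^'a \<Rightarrow> complex"
  proof -
    obtain q where q: "slow1 q" and f: "f = (\<lambda>x. q x * gauss x)" using \<open>?P f\<close> by blast
    obtain C N where C: "C \<ge> 0" and N: "\<And>x. norm (q x) \<le> C * (1 + norm x) ^ N"
      by (rule slow_growth[OF q]) blast
    have "(1 + norm x) ^ k * norm (f x) \<le> C * (real (N + k) ^ (N + k) * exp (3 / 2))" for x
    proof -
      have "(1 + norm x) ^ k * norm (f x) \<le> (1 + norm x) ^ k * ((C * (1 + norm x) ^ N) * norm (gauss x))"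
        unfolding f norm_mult by (intro mult_left_mono mult_right_mono N) auto
      also have "\<dots> = C * ((1 + norm x) ^ (N + k) * norm (gauss x))" by (simp add: power_add mult_ac)
      also have "\<dots> \<le> C * (real (N + k) ^ (N + k) * exp (3 / 2))" by (intro mult_left_mono gauss_decay C)
      finally show ?thesis .
    qed
    then show ?thesis by blast
  qed
  have "?P (\<lambda>x. q x * gauss x)" using q by blast
  then have all: "?P (mderiv \<alpha> (\<lambda>x. q x * gauss x))" for \<alpha>
    by (induction \<alpha>) (simp, simp only: mderiv_Cons part)
  show ?thesis
  proof (rule schwartzI)
    show "smooth (\<lambda>x. q x * gauss x)" unfolding smooth_def using all diff by blast
    show "\<exists>C. \<forall>x. (1 + norm x) ^ k * norm (mderiv \<alpha> (\<lambda>x. q x * gauss x) x) \<le> C" for k \<alpha>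
      using all bound by blast
  qed
qed

lemma schwartz_gauss: "gauss \<in> schwartz"
  using schwartz_slow_gauss[OF slow_const[of 1]] by simp

lemma has_derivative_sum_partial:
  assumes "(f has_derivative f') (at x)"
  shows "f' h = (\<Sum>i\<in>UNIV. h $ i *\<^sub>R partial i f x)"
proof -
  have l: "linear f'" using assms has_derivative_linear by blast
  have "f' h = f' (\<Sum>i\<in>UNIV. h $ i *\<^sub>R axis i 1)"
    by (rule arg_cong[where f = f']) (simp add: vec_eq_iff axis_def if_distrib cong: if_cong)
  also have "\<dots> = (\<Sum>i\<in>UNIV. h $ i *\<^sub>R f' (axis i 1))"
    by (simp add: linear_sum[OF l] linear_scale[OF l])
  finally show ?thesis by (simp add: partial_eq[OF assms])
qed

lemma constant_of_partial_zero:
  assumes d: "f differentiable_on UNIV" and z: "\<And>i x. partial i f x = 0"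
  shows "f x = f 0"
proof (rule has_derivative_zero_unique[of UNIV f])
  fix y
  obtain f' where f': "(f has_derivative f') (at y)" by (rule differentiable_on_UNIV_at[OF d])
  have "f' = (\<lambda>h. 0)" using has_derivative_sum_partial[OF f'] z by (simp add: fun_eq_iff)
  with f' show "(f has_derivative (\<lambda>h. 0)) (at y within UNIV)" by simp
qed auto

text \<open>This is \<open>(2 \<pi>)\<^bsup>n/2\<^esup>\<close>; its square is the constant of Fourier inversion.\<close>

definition gauss_integral :: "'n::finite itself \<Rightarrow> complex" where
  "gauss_integral _ = (\<integral>x. gauss (x :: real^'n) \<partial>lborel)"

lemma gauss_nonzero [simp]: "gauss x \<noteq> 0"
  by (simp add: gauss_def)

definition inverse_gauss :: "real^'n::finite \<Rightarrow> complex" where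
  "inverse_gauss x = complex_of_real (exp (x \<bullet> x / 2))"

lemma inverse_gauss_has_derivative:
  "(inverse_gauss has_derivative (\<lambda>h. of_real (x \<bullet> h) * inverse_gauss x)) (at x)"
  unfolding inverse_gauss_def
  by (rule derivative_eq_intros refl | simp)+ (auto simp: fun_eq_iff inner_commute)

lemma inverse_gauss_differentiable: "inverse_gauss differentiable_on UNIV"
  unfolding differentiable_on_def differentiable_def using inverse_gauss_has_derivative by blast

lemma partial_inverse_gauss: "partial i inverse_gauss = (\<lambda>x. of_real (x $ i) * inverse_gauss x)"
  by (rule ext, subst partial_eq[OF inverse_gauss_has_derivative]) (simp add: inner_axis)

lemma gauss_inverse_gauss: "gauss x * inverse_gauss x = 1"
  by (simp add: gauss_def inverse_gauss_def flip: of_real_mult exp_add)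

lemma smooth_inverse_gauss: "smooth inverse_gauss"
proof (rule smooth_coinduct[where P = "\<lambda>f. \<exists>q. smooth q \<and> f = (\<lambda>x. q x * inverse_gauss x)"])
  show "\<exists>q. smooth q \<and> inverse_gauss = (\<lambda>x. q x * inverse_gauss x)"
    by (rule exI[of _ "\<lambda>x. 1"]) (simp add: smooth_const)
next
  fix f :: "real^'a \<Rightarrow> complex" assume "\<exists>q. smooth q \<and> f = (\<lambda>x. q x * inverse_gauss x)"
  then obtain q where q: "smooth q" and f: "f = (\<lambda>x. q x * inverse_gauss x)" by blast
  show "f differentiable_on UNIV"
    unfolding f by (rule differentiable_on_bilinear[OF bounded_bilinear_mult smooth_differentiable[OF q]
        inverse_gauss_differentiable])
  fix i
  have "partial i f = (\<lambda>x. partial i q x * inverse_gauss x + q x * partial i inverse_gauss x)"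
    unfolding f by (rule partial_bilinear[OF bounded_bilinear_mult smooth_differentiable[OF q]
        inverse_gauss_differentiable])
  then have "partial i f = (\<lambda>x. (partial i q x + q x * of_real (x $ i)) * inverse_gauss x)"
    by (simp add: partial_inverse_gauss algebra_simps)
  moreover have "smooth (\<lambda>x. partial i q x + q x * of_real (x $ i))"
    by (intro smooth_add smooth_partial q smooth_mult slow_smooth slow_coordinate)
  ultimately show "\<exists>q. smooth q \<and> partial i f = (\<lambda>x. q x * inverse_gauss x)" by blast
qed

text \<open>The Gaussian and its Fourier transform solve the same system \<open>\<partial>\<^sub>i g = - x\<^sub>i g\<close>, so their quotient is
  constant, and its value is read off at \<open>0\<close>.\<close>

lemma fourier_gauss: "fourier gauss \<xi> = gauss_integral TYPE('n) * gauss (\<xi> :: real^'n::finite)"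
proof -
  let ?g = "fourier gauss :: real^'n \<Rightarrow> complex"
  have dg: "?g differentiable_on UNIV" by (rule smooth_differentiable[OF smooth_fourier[OF schwartz_gauss]])
  have "partial i ?g = (\<lambda>x. - of_real (x $ i) * ?g x)" for i
  proof -
    have "partial i ?g = fourier (\<lambda>x. - \<i> * complex_of_real (x $ i) * gauss x)"
      by (rule partial_fourier[OF schwartz_decaying[OF schwartz_gauss]])
    also have "\<dots> = fourier (\<lambda>x. \<i> * partial i gauss x)" by (simp add: partial_gauss mult.assoc)
    also have "\<dots> = (\<lambda>x. - of_real (x $ i) * ?g x)"
      by (simp add: fourier_cmult fourier_partial[OF schwartz_gauss] fun_eq_iff flip: mult.assoc)
    finally show ?thesis .
  qed
  then have "partial i (\<lambda>x. ?g x * inverse_gauss x) x = 0" for i x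
    by (simp add: partial_bilinear[OF bounded_bilinear_mult dg inverse_gauss_differentiable] partial_inverse_gauss)
  from constant_of_partial_zero[OF differentiable_on_bilinear[OF bounded_bilinear_mult dg
      inverse_gauss_differentiable] this, of \<xi>]
  have "?g \<xi> * inverse_gauss \<xi> = ?g 0" by (simp add: inverse_gauss_def)
  then have "?g \<xi> * (gauss \<xi> * inverse_gauss \<xi>) = ?g 0 * gauss \<xi>" by (simp add: mult_ac)
  then show ?thesis by (simp add: gauss_inverse_gauss fourier_cis gauss_integral_def)
qed

lemma integrable_gauss: "integrable lborel (gauss :: real^'n::finite \<Rightarrow> complex)"
  by (rule decaying_integrable[OF schwartz_decaying[OF schwartz_gauss] order_refl])

lemma gauss_integral_nonzero: "gauss_integral TYPE('n::finite) \<noteq> 0"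
proof
  assume "gauss_integral TYPE('n) = 0"
  then have "(\<integral>x. norm (gauss (x :: real^'n)) \<partial>lborel) = 0"
    unfolding gauss_integral_def gauss_def by (simp del: of_real_exp)
  then have "AE x in (lborel :: (real^'n) measure). norm (gauss x) = 0"
    using integrable_gauss by (subst (asm) integral_nonneg_eq_0_iff_AE) auto
  then have "AE x in (lborel :: (real^'n) measure). False" by simp
  then have "emeasure (lborel :: (real^'n) measure) UNIV = 0"
    using AE_iff_measurable[of UNIV "lborel :: (real^'n) measure" "\<lambda>x. False"] by simp
  then show False by simp
qed

text \<open>The rescaled Gaussians are an approximate identity, by dominated convergence. Both Fourier
  inversion and the uniqueness of symbols rest on this.\<close>

lemma gauss_approximate_identity:
  fixes w :: "real^'n::finite \<Rightarrow> complex"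
  assumes c: "continuous_on UNIV w" and C: "C \<ge> 0" and N: "\<And>x. norm (w x) \<le> C * (1 + norm x) ^ N"
  shows "(\<lambda>j. \<integral>z. w (x + (1 / real (Suc j)) *\<^sub>R z) * gauss z \<partial>lborel)
    \<longlonglongrightarrow> w x * gauss_integral TYPE('n)"
proof -
  let ?n = "2 * CARD('n)"
  let ?s = "\<lambda>j z. w (x + (1 / real (Suc j)) *\<^sub>R z) * gauss z"
  have g: "continuous_on UNIV (gauss :: real^'n \<Rightarrow> complex)"
    using schwartz_decaying[OF schwartz_gauss] by (auto simp: decaying_def)
  let ?K = "C * (2 + norm x) ^ N * (real (N + ?n) ^ (N + ?n) * exp (3 / 2))"
  have "(\<lambda>j. \<integral>z. ?s j z \<partial>lborel) \<longlonglongrightarrow> (\<integral>z. w x * gauss (z :: real^'n) \<partial>lborel)"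
  proof (rule integral_dominated_convergence[where w = "\<lambda>z::real^'n. ?K * weight z"])
    show "(\<lambda>z::real^'n. w x * gauss z) \<in> borel_measurable lborel"
      using g by (simp add: borel_measurable_continuous_onI continuous_on_mult_left)
    show "?s j \<in> borel_measurable lborel" for j
    proof -
      have "continuous_on UNIV (?s j)"
        by (intro continuous_intros continuous_on_compose2[OF c] g) auto
      then show ?thesis by (simp add: borel_measurable_continuous_onI)
    qed
    show "integrable lborel (\<lambda>z::real^'n. ?K * weight z)" by (intro integrable_mult_right integrable_weight)
    show "AE z in lborel. (\<lambda>j. ?s j z) \<longlonglongrightarrow> w x * gauss z"
    proof (rule AE_I2)
      fix z :: "real^'n"
      have "(\<lambda>j. x + (1 / real (Suc j)) *\<^sub>R z) \<longlonglongrightarrow> x + 0 *\<^sub>R z"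
        using tendsto_add[OF tendsto_const[of x] tendsto_scaleR[OF LIMSEQ_inverse_real_of_nat tendsto_const[of z]]]
        by (simp add: inverse_eq_divide)
      moreover have "isCont w x" using c by (simp add: continuous_on_eq_continuous_at)
      ultimately have "(\<lambda>j. w (x + (1 / real (Suc j)) *\<^sub>R z)) \<longlonglongrightarrow> w x"
        by (intro isCont_tendsto_compose[of x w]) auto
      then show "(\<lambda>j. ?s j z) \<longlonglongrightarrow> w x * gauss z" by (intro tendsto_intros)
    qed
    show "AE z in lborel. norm (?s j z) \<le> ?K * weight z" for j
    proof (rule AE_I2, rule norm_le_weight)
      fix z
      let ?y = "x + (1 / real (Suc j)) *\<^sub>R z"
      have "norm ((1 / real (Suc j)) *\<^sub>R z) \<le> norm z"
        using mult_right_mono[of "1 / real (Suc j)" 1 "norm z"] by simp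
      then have "norm ?y \<le> norm x + norm z" by (intro norm_triangle_le) simp
      then have "1 + norm ?y \<le> 2 + norm x + norm z + (1 + norm x) * norm z"
        using mult_nonneg_nonneg[of "1 + norm x" "norm z"] norm_ge_zero[of x] norm_ge_zero[of z] by linarith
      also have "\<dots> = (2 + norm x) * (1 + norm z)" by (simp add: algebra_simps)
      finally have y: "1 + norm ?y \<le> (2 + norm x) * (1 + norm z)" .
      have "norm (w ?y) \<le> C * (1 + norm ?y) ^ N" by (rule N)
      also have "\<dots> \<le> C * ((2 + norm x) * (1 + norm z)) ^ N"
        by (intro mult_left_mono power_mono y C) auto
      finally have "norm (w ?y) \<le> C * ((2 + norm x) * (1 + norm z)) ^ N" .
      then have "norm (?s j z) \<le> (C * ((2 + norm x) * (1 + norm z)) ^ N) * norm (gauss z)"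
        unfolding norm_mult by (rule mult_right_mono) simp
      then have "(1 + norm z) ^ ?n * norm (?s j z)
          \<le> (1 + norm z) ^ ?n * ((C * ((2 + norm x) * (1 + norm z)) ^ N) * norm (gauss z))"
        by (rule mult_left_mono) simp
      also have "\<dots> = C * (2 + norm x) ^ N * ((1 + norm z) ^ (N + ?n) * norm (gauss z))"
        by (simp add: power_add power_mult_distrib mult_ac)
      also have "\<dots> \<le> ?K"
        by (intro mult_left_mono gauss_decay mult_nonneg_nonneg C) auto
      finally show "(1 + norm z) ^ ?n * norm (?s j z) \<le> ?K" .
    qed
  qed
  then show ?thesis by (simp add: gauss_integral_def)
qed

lemma gauss_scaled_integral:
  fixes w :: "real^'n::finite \<Rightarrow> complex"
  assumes c: "continuous_on UNIV w" and e: "e > 0"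
  shows "(\<integral>y. w y * gauss ((1 / e) *\<^sub>R (y - x)) \<partial>lborel)
    = e ^ CARD('n) *\<^sub>R (\<integral>z. w (x + e *\<^sub>R z) * gauss z \<partial>lborel)"
proof -
  have g: "continuous_on UNIV (gauss :: real^'n \<Rightarrow> complex)"
    using schwartz_decaying[OF schwartz_gauss] by (auto simp: decaying_def)
  have "continuous_on UNIV (\<lambda>y. w y * gauss ((1 / e) *\<^sub>R (y - x)))"
    by (intro continuous_intros continuous_on_compose2[OF g] c) auto
  then have "(\<lambda>y. w y * gauss ((1 / e) *\<^sub>R (y - x))) \<in> borel_measurable borel"
    by (rule borel_measurable_continuous_onI)
  from integral_affine[OF this, of e x] e show ?thesis by simp
qed

text \<open>Testing against the rescaled Gaussians with centre \<open>x\<close> recovers \<open>w x\<close> in the limit.\<close>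

lemma zero_of_annihilates_schwartz:
  fixes w :: "real^'n::finite \<Rightarrow> complex"
  assumes c: "continuous_on UNIV w" and C: "C \<ge> 0" and N: "\<And>x. norm (w x) \<le> C * (1 + norm x) ^ N"
    and ann: "\<And>\<psi>. \<psi> \<in> schwartz \<Longrightarrow> (\<integral>y. w y * \<psi> y \<partial>lborel) = 0"
  shows "w x = 0"
proof -
  have "(\<integral>z. w (x + (1 / real (Suc j)) *\<^sub>R z) * gauss z \<partial>lborel) = 0" for j
  proof -
    let ?e = "1 / real (Suc j)"
    have e: "?e > 0" by simp
    have "(\<lambda>y. gauss ((- (1 / ?e) *\<^sub>R x) + (1 / ?e) *\<^sub>R y)) \<in> schwartz"
      by (rule schwartz_affine[OF _ schwartz_gauss]) simp
    moreover have "(- (1 / ?e) *\<^sub>R x) + (1 / ?e) *\<^sub>R y = (1 / ?e) *\<^sub>R (y - x)" for y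
      by (simp only: scaleR_diff_right scaleR_minus_left add.commute add_uminus_conv_diff)
    ultimately have "(\<lambda>y. gauss ((1 / ?e) *\<^sub>R (y - x))) \<in> schwartz" by simp
    from ann[OF this] gauss_scaled_integral[OF c e, of x] e show ?thesis by simp
  qed
  with gauss_approximate_identity[OF c C N, of x] have "w x * gauss_integral TYPE('n) = 0"
    by (simp add: LIMSEQ_const_iff)
  then show ?thesis by (simp add: gauss_integral_nonzero)
qed

lemma fourier_modulated_scaled_gauss:
  fixes x y :: "real^'n::finite"
  assumes e: "e > 0"
  shows "e ^ CARD('n) *\<^sub>R fourier (\<lambda>\<xi>. cis (x \<bullet> \<xi>) * gauss (e *\<^sub>R \<xi>)) y
    = gauss_integral TYPE('n) * gauss ((1 / e) *\<^sub>R (y - x))"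
proof -
  have g: "continuous_on UNIV (gauss :: real^'n \<Rightarrow> complex)"
    using schwartz_decaying[OF schwartz_gauss] by (auto simp: decaying_def)
  let ?h = "\<lambda>\<xi>. cis (- (\<xi> \<bullet> ((1 / e) *\<^sub>R (y - x)))) * gauss \<xi>"
  have "continuous_on UNIV ?h"
    by (intro continuous_intros g)
  then have "?h \<in> borel_measurable borel"
    by (rule borel_measurable_continuous_onI)
  from integral_affine[OF this, of e 0] e
  have "fourier gauss ((1 / e) *\<^sub>R (y - x)) = e ^ CARD('n) *\<^sub>R (\<integral>\<xi>. ?h (e *\<^sub>R \<xi>) \<partial>lborel)"
    by (simp add: fourier_cis)
  also have "(\<lambda>\<xi>. ?h (e *\<^sub>R \<xi>)) = (\<lambda>\<xi>. cis (- (\<xi> \<bullet> y)) * (cis (x \<bullet> \<xi>) * gauss (e *\<^sub>R \<xi>)))"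
    using e by (auto simp: fun_eq_iff inner_diff_right cis_mult inner_commute simp flip: mult.assoc)
  finally show ?thesis unfolding fourier_gauss by (simp only: fourier_cis)
qed

text \<open>The factor \<open>\<gamma>(\<epsilon> \<xi>)\<close> makes the iterated integral absolutely convergent. By the multiplication formula
  the integral is a mean of \<open>\<phi>\<close> against a rescaled Gaussian, and \<open>\<epsilon>\<close> tends to \<open>0\<close> on both sides.\<close>

theorem fourier_inversion:
  fixes \<phi> :: "real^'n::finite \<Rightarrow> complex"
  assumes phi: "\<phi> \<in> schwartz"
  shows "fourier (fourier \<phi>) (- x) = (gauss_integral TYPE('n))\<^sup>2 * \<phi> x"
proof -
  let ?c = "gauss_integral TYPE('n)"
  have g: "continuous_on UNIV (gauss :: real^'n \<Rightarrow> complex)"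
    using schwartz_decaying[OF schwartz_gauss] by (auto simp: decaying_def)
  have cphi: "continuous_on UNIV \<phi>" using schwartz_decaying[OF phi] by (auto simp: decaying_def)
  have F: "fourier \<phi> \<in> schwartz" by (rule schwartz_fourier[OF phi])
  have cF: "continuous_on UNIV (fourier \<phi>)" using schwartz_decaying[OF F] by (auto simp: decaying_def)
  have iF: "integrable lborel (fourier \<phi>)"
    by (rule decaying_integrable[OF schwartz_decaying[OF F] order_refl])
  define e where "e j = 1 / real (Suc j)" for j
  have e: "e j > 0" for j by (simp add: e_def)
  let ?s = "\<lambda>j \<xi>. fourier \<phi> \<xi> * (cis (x \<bullet> \<xi>) * gauss (e j *\<^sub>R \<xi>))"
  have "(\<lambda>j. \<integral>\<xi>. ?s j \<xi> \<partial>lborel) \<longlonglongrightarrow> (\<integral>\<xi>. fourier \<phi> \<xi> * cis (x \<bullet> \<xi>) \<partial>lborel)"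
  proof (rule integral_dominated_convergence)
    have "continuous_on UNIV (\<lambda>\<xi>. fourier \<phi> \<xi> * cis (x \<bullet> \<xi>))"
      by (intro continuous_intros cF)
    then show "(\<lambda>\<xi>. fourier \<phi> \<xi> * cis (x \<bullet> \<xi>)) \<in> borel_measurable lborel"
      by (simp add: borel_measurable_continuous_onI)
    show "?s j \<in> borel_measurable lborel" for j
    proof -
      have "continuous_on UNIV (?s j)"
        by (intro continuous_intros continuous_on_compose2[OF g] cF) auto
      then show ?thesis by (simp add: borel_measurable_continuous_onI)
    qed
    show "integrable lborel (\<lambda>\<xi>. norm (fourier \<phi> \<xi>))" using iF by simp
    show "AE \<xi> in lborel. (\<lambda>j. ?s j \<xi>) \<longlonglongrightarrow> fourier \<phi> \<xi> * cis (x \<bullet> \<xi>)"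
    proof (rule AE_I2)
      fix \<xi> :: "real^'n"
      have "(\<lambda>j. e j *\<^sub>R \<xi>) \<longlonglongrightarrow> 0 *\<^sub>R \<xi>"
        unfolding e_def using tendsto_scaleR[OF LIMSEQ_inverse_real_of_nat tendsto_const[of \<xi>]]
        by (simp add: inverse_eq_divide)
      moreover have "isCont gauss (0 :: real^'n)" using g by (simp add: continuous_on_eq_continuous_at)
      ultimately have "(\<lambda>j. gauss (e j *\<^sub>R \<xi>)) \<longlonglongrightarrow> gauss (0 :: real^'n)"
        by (intro isCont_tendsto_compose[of 0 gauss]) auto
      then have "(\<lambda>j. ?s j \<xi>) \<longlonglongrightarrow> fourier \<phi> \<xi> * (cis (x \<bullet> \<xi>) * gauss (0 :: real^'n))"
        by (intro tendsto_intros)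
      then show "(\<lambda>j. ?s j \<xi>) \<longlonglongrightarrow> fourier \<phi> \<xi> * cis (x \<bullet> \<xi>)" by (simp add: gauss_def)
    qed
    show "AE \<xi> in lborel. norm (?s j \<xi>) \<le> norm (fourier \<phi> \<xi>)" for j
      by (intro AE_I2) (simp add: norm_mult norm_gauss_le_1 mult_left_le)
  qed
  moreover have "(\<integral>\<xi>. ?s j \<xi> \<partial>lborel) = ?c * (\<integral>z. \<phi> (x + e j *\<^sub>R z) * gauss z \<partial>lborel)" for j
  proof -
    have "(\<lambda>\<xi>::real^'n. gauss (0 + e j *\<^sub>R \<xi>)) \<in> schwartz"
      by (rule schwartz_affine[OF _ schwartz_gauss]) (use e[of j] in simp)
    then have "decaying (2 * CARD('n)) (\<lambda>\<xi>::real^'n. gauss (e j *\<^sub>R \<xi>))"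
      by (simp add: schwartz_decaying)
    then have d: "decaying (2 * CARD('n)) (\<lambda>\<xi>. cis (x \<bullet> \<xi>) * gauss (e j *\<^sub>R \<xi>))"
      by (rule decaying_unimodular) (auto intro!: continuous_intros)
    have "e j ^ CARD('n) *\<^sub>R (\<integral>\<xi>. ?s j \<xi> \<partial>lborel)
        = (\<integral>y. \<phi> y * (e j ^ CARD('n) *\<^sub>R fourier (\<lambda>\<xi>. cis (x \<bullet> \<xi>) * gauss (e j *\<^sub>R \<xi>)) y) \<partial>lborel)"
      unfolding fourier_multiplication[OF schwartz_decaying[OF phi] d] by simp
    also have "\<dots> = (\<integral>y. ?c * (\<phi> y * gauss ((1 / e j) *\<^sub>R (y - x))) \<partial>lborel)"
      unfolding fourier_modulated_scaled_gauss[OF e] by (simp add: mult_ac)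
    also have "\<dots> = e j ^ CARD('n) *\<^sub>R (?c * (\<integral>z. \<phi> (x + e j *\<^sub>R z) * gauss z \<partial>lborel))"
      using gauss_scaled_integral[OF cphi e, of j x] by simp
    finally show ?thesis using e[of j] by simp
  qed
  moreover have "(\<lambda>j. ?c * (\<integral>z. \<phi> (x + e j *\<^sub>R z) * gauss z \<partial>lborel)) \<longlonglongrightarrow> ?c * (\<phi> x * ?c)"
  proof -
    obtain C where "C \<ge> 0" "\<And>x. (1 + norm x) ^ 0 * norm (mderiv [] \<phi> x) \<le> C"
      by (rule schwartz_seminorm_bound[OF phi, of 0 "[]"]) blast
    then have "(\<lambda>j. \<integral>z. \<phi> (x + (1 / real (Suc j)) *\<^sub>R z) * gauss z \<partial>lborel) \<longlonglongrightarrow> \<phi> x * ?c"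
      by (intro gauss_approximate_identity[OF cphi, of C 0]) auto
    then show ?thesis unfolding e_def by (intro tendsto_intros)
  qed
  ultimately have "(\<integral>\<xi>. fourier \<phi> \<xi> * cis (x \<bullet> \<xi>) \<partial>lborel) = ?c * (\<phi> x * ?c)"
    using LIMSEQ_unique by simp
  then show ?thesis by (simp add: fourier_cis power2_eq_square inner_commute mult_ac)
qed

section \<open>Symbols of rapidly decreasing distributions\<close>

definition inverse_fourier :: "(real^'n::finite \<Rightarrow> complex) \<Rightarrow> real^'n \<Rightarrow> complex" where
  "inverse_fourier \<phi> x = fourier \<phi> (- x) / (gauss_integral TYPE('n))\<^sup>2"

lemma fourier_reflect:
  fixes f :: "real^'n::finite \<Rightarrow> complex"
  assumes "f \<in> schwartz"
  shows "fourier (\<lambda>x. f (- x)) \<xi> = fourier f (- \<xi>)"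
proof -
  have "(\<lambda>x. cis (- (x \<bullet> - \<xi>)) * f x) \<in> borel_measurable borel"
    by (rule decaying_measurable[OF decaying_fourier_integrand[OF schwartz_decaying[OF assms, of 0]]])
  from integral_affine[OF this, of "-1" 0] show ?thesis by (simp add: fourier_cis)
qed

lemma tame_reflect: "tame I (\<lambda>i (\<phi> :: real^'n::finite \<Rightarrow> 'c::real_normed_vector) x. \<phi> (- x))"
  using tame_affine[of "-1" I "0 :: real^'n"] by simp

lemma fourier_inverse_fourier:
  fixes \<phi> :: "real^'n::finite \<Rightarrow> complex"
  assumes "\<phi> \<in> schwartz"
  shows "fourier (inverse_fourier \<phi>) = \<phi>"
proof
  fix y
  let ?c = "gauss_integral TYPE('n)"
  have "fourier (inverse_fourier \<phi>) y = fourier (\<lambda>x. (1 / ?c\<^sup>2) * fourier \<phi> (- x)) y"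
    by (simp add: inverse_fourier_def[abs_def])
  also have "\<dots> = (1 / ?c\<^sup>2) * fourier (fourier \<phi>) (- y)"
    unfolding fourier_cmult fourier_reflect[OF schwartz_fourier[OF assms]] ..
  finally show "fourier (inverse_fourier \<phi>) y = \<phi> y"
    by (simp add: fourier_inversion[OF assms] gauss_integral_nonzero)
qed

lemma tame_inverse_fourier: "tame I (\<lambda>i (\<phi> :: real^'n::finite \<Rightarrow> complex). inverse_fourier \<phi>)"
proof -
  have "tame I (\<lambda>i (\<phi> :: real^'n \<Rightarrow> complex) x. fourier \<phi> (- x) / (gauss_integral TYPE('n))\<^sup>2)"
    by (rule tame_compose[OF tame_linear[OF bounded_linear_divide] tame_compose[OF tame_reflect tame_fourier]])
  then show ?thesis by (simp add: inverse_fourier_def[abs_def])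
qed

lemmas schwartz_inverse_fourier = schwartz_operator[OF tame_inverse_fourier]

text \<open>\<open>g\<close> represents the Fourier transform of \<open>T\<close>. As a relation it is available before existence
  and uniqueness of the function are known.\<close>

definition has_symbol :: "'n::finite functional \<Rightarrow> (real^'n \<Rightarrow> complex) \<Rightarrow> bool" where
  "has_symbol T g \<longleftrightarrow> slow1 g \<and> (\<forall>\<psi>\<in>schwartz. T (fourier \<psi>) = (\<integral>x. g x * \<psi> x \<partial>lborel))"

lemma has_symbol_slow: "has_symbol T g \<Longrightarrow> slow1 g"
  by (simp add: has_symbol_def)

lemma integrable_slow_schwartz:
  fixes g :: "real^'n::finite \<Rightarrow> complex"
  assumes "slow1 g" "\<psi> \<in> schwartz"
  shows "integrable lborel (\<lambda>x. g x * \<psi> x)"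
  by (rule decaying_integrable[OF schwartz_decaying[OF schwartz_slow_mult[OF assms]] order_refl])

lemma integrable_upto_schwartz:
  fixes g :: "real^'n::finite \<Rightarrow> complex"
  assumes c: "continuous_on UNIV g" and N: "\<And>x. norm (g x) \<le> C * (1 + norm x) ^ N" and psi: "\<psi> \<in> schwartz"
  shows "integrable lborel (\<lambda>x. g x * \<psi> x)"
  by (rule decaying_integrable[OF decaying_mult[OF schwartz_decaying[OF psi] c N] order_refl])

lemma eq_of_eq_on_schwartz:
  fixes g h :: "real^'n::finite \<Rightarrow> complex"
  assumes g: "slow_upto (Suc l) g" and h: "slow_upto (Suc k) h"
    and eq: "\<And>\<psi>. \<psi> \<in> schwartz \<Longrightarrow> (\<integral>x. g x * \<psi> x \<partial>lborel) = (\<integral>x. h x * \<psi> x \<partial>lborel)"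
  shows "g = h"
proof
  fix x
  have cont: "continuous_on UNIV g" "continuous_on UNIV h"
    using g h diff_orderD[of "Suc l" g "[]"] diff_orderD[of "Suc k" h "[]"]
    by (auto simp: slow_upto_def intro: differentiable_imp_continuous_on)
  have s: "slow_upto 0 g" "slow_upto 0 h"
    by (rule slow_upto_mono[OF g], simp, rule slow_upto_mono[OF h], simp)
  have d: "slow_upto 0 (\<lambda>x. g x + - h x)"
    by (rule slow_upto_add[OF s(1) slow_upto_linear[OF bounded_linear_minus[OF bounded_linear_ident] s(2)]])
  obtain B L where B: "\<And>x. norm (g x) \<le> B * (1 + norm x) ^ L"
    by (rule slow_upto_growth[OF s(1)]) blast
  obtain D M where D: "\<And>x. norm (h x) \<le> D * (1 + norm x) ^ M"
    by (rule slow_upto_growth[OF s(2)]) blast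
  obtain C N where C: "C \<ge> 0" "\<And>x. norm (g x + - h x) \<le> C * (1 + norm x) ^ N"
    by (rule slow_upto_growth[OF d]) blast
  have "g x + - h x = 0"
  proof (rule zero_of_annihilates_schwartz[OF _ C])
    show "continuous_on UNIV (\<lambda>x. g x + - h x)" by (intro continuous_intros cont)
    fix \<psi> :: "real^'n \<Rightarrow> complex" assume psi: "\<psi> \<in> schwartz"
    have "(\<integral>x. (g x + - h x) * \<psi> x \<partial>lborel) = (\<integral>x. g x * \<psi> x - h x * \<psi> x \<partial>lborel)"
      by (simp add: algebra_simps)
    also have "\<dots> = (\<integral>x. g x * \<psi> x \<partial>lborel) - (\<integral>x. h x * \<psi> x \<partial>lborel)"
      by (rule Bochner_Integration.integral_diff[OF integrable_upto_schwartz[OF cont(1) B psi]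
          integrable_upto_schwartz[OF cont(2) D psi]])
    finally show "(\<integral>x. (g x + - h x) * \<psi> x \<partial>lborel) = 0" by (simp add: eq[OF psi])
  qed
  then show "g x = h x" by simp
qed

lemma has_symbol_unique:
  assumes "has_symbol T g" "has_symbol T h"
  shows "g = h"
proof (rule eq_of_eq_on_schwartz[of 0 g 0 h])
  show "slow_upto (Suc 0) g" "slow_upto (Suc 0) h"
    using assms by (auto simp: has_symbol_def intro: slow_upto_slow)
qed (use assms in \<open>simp add: has_symbol_def\<close>)

lemma fourier_symbol_eqI:
  assumes "has_symbol T g"
  shows "fourier_symbol T = g"
proof -
  have *: "dist_fourier T = regular_dist h \<longleftrightarrow> (\<forall>\<psi>\<in>schwartz. T (fourier \<psi>) = (\<integral>x. h x * \<psi> x \<partial>lborel))" for h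
    by (auto simp: dist_fourier_def regular_dist_def on_schwartz_def fun_eq_iff)
  show ?thesis
    unfolding fourier_symbol_def OM_iff_slow *
    using assms has_symbol_unique[OF _ assms] by (intro the_equality) (auto simp: has_symbol_def)
qed

lemma has_symbol_delta: "has_symbol delta_dist (\<lambda>_. 1)"
  unfolding has_symbol_def
proof (intro conjI ballI)
  show "slow1 (\<lambda>_. 1 :: complex)" by (rule slow_const)
  fix \<psi> :: "real^'a \<Rightarrow> complex" assume "\<psi> \<in> schwartz"
  then show "delta_dist (fourier \<psi>) = (\<integral>x. 1 * \<psi> x \<partial>lborel)"
    by (simp add: delta_dist_def on_schwartz_def schwartz_fourier fourier_cis)
qed

lemma has_symbol_zero: "has_symbol (\<lambda>_. 0) (\<lambda>_. 0)"
  by (simp add: has_symbol_def slow_const)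

lemma has_symbol_scaled_diff:
  fixes g h :: "real^'n::finite \<Rightarrow> complex"
  assumes "has_symbol T g" "has_symbol U h"
  shows "has_symbol (\<lambda>\<phi>. c * (T \<phi> - U \<phi>)) (\<lambda>\<xi>. c * (g \<xi> - h \<xi>))"
  unfolding has_symbol_def
proof (intro conjI ballI)
  have s: "slow1 g" "slow1 h" using assms by (auto simp: has_symbol_def)
  have "slow1 (\<lambda>\<xi>. g \<xi> + - h \<xi>)"
    by (rule slow_add[OF s(1) slow_linear[OF bounded_linear_minus[OF bounded_linear_ident] s(2)]])
  from slow_linear[OF bounded_linear_mult_right this]
  show "slow1 (\<lambda>\<xi>. c * (g \<xi> - h \<xi>))" by simp
  fix \<psi> :: "real^'n \<Rightarrow> complex" assume psi: "\<psi> \<in> schwartz"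
  have "(\<integral>x. c * (g x - h x) * \<psi> x \<partial>lborel) = (\<integral>x. c * (g x * \<psi> x - h x * \<psi> x) \<partial>lborel)"
    by (simp add: algebra_simps)
  also have "\<dots> = c * ((\<integral>x. g x * \<psi> x \<partial>lborel) - (\<integral>x. h x * \<psi> x \<partial>lborel))"
    by (simp only: integral_mult_right_zero Bochner_Integration.integral_diff[OF
        integrable_slow_schwartz[OF s(1) psi] integrable_slow_schwartz[OF s(2) psi]])
  finally show "c * (T (fourier \<psi>) - U (fourier \<psi>)) = (\<integral>x. c * (g x - h x) * \<psi> x \<partial>lborel)"
    using assms psi by (simp add: has_symbol_def)
qed

lemma has_symbol_scale:
  assumes "has_symbol T g"
  shows "has_symbol (\<lambda>\<phi>. c * T \<phi>) (\<lambda>\<xi>. c * g \<xi>)"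
  using has_symbol_scaled_diff[OF assms has_symbol_zero, of c] by simp

lemma has_symbol_sum:
  fixes g :: "'j \<Rightarrow> real^'n::finite \<Rightarrow> complex"
  assumes "\<And>j. j \<in> J \<Longrightarrow> has_symbol (T j) (g j)"
  shows "has_symbol (\<lambda>\<phi>. \<Sum>j\<in>J. T j \<phi>) (\<lambda>\<xi>. \<Sum>j\<in>J. g j \<xi>)"
  unfolding has_symbol_def
proof (intro conjI ballI)
  show "slow1 (\<lambda>\<xi>. \<Sum>j\<in>J. g j \<xi>)" using assms by (intro slow_sum) (auto simp: has_symbol_def)
  fix \<psi> :: "real^'n \<Rightarrow> complex" assume psi: "\<psi> \<in> schwartz"
  have "(\<integral>x. (\<Sum>j\<in>J. g j x) * \<psi> x \<partial>lborel) = (\<Sum>j\<in>J. \<integral>x. g j x * \<psi> x \<partial>lborel)"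
    unfolding sum_distrib_right
    by (intro Bochner_Integration.integral_sum integrable_slow_schwartz[OF has_symbol_slow[OF assms] psi])
  then show "(\<Sum>j\<in>J. T j (fourier \<psi>)) = (\<integral>x. (\<Sum>j\<in>J. g j x) * \<psi> x \<partial>lborel)"
    using assms psi by (simp add: has_symbol_def)
qed

lemma fourier_modulate: "fourier (\<lambda>\<xi>. cis (x \<bullet> \<xi>) * f \<xi>) y = fourier f (y - x)"
  unfolding fourier_cis
  by (intro Bochner_Integration.integral_cong refl)
     (simp add: inner_diff_right inner_commute cis_mult flip: mult.assoc)

lemma schwartz_modulate:
  assumes "\<psi> \<in> schwartz"
  shows "(\<lambda>\<xi>. cis (x \<bullet> \<xi>) * \<psi> \<xi>) \<in> schwartz"
  using schwartz_slow_mult[OF slow_cis_inner[of x] assms] by (simp add: inner_commute)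

text \<open>A translate of \<open>\<F> \<psi>\<close> is the Fourier transform of a modulation of \<open>\<psi>\<close>, so that the inner pairing in
  \<open>U * V\<close> is \<open>\<F>(v \<psi>)\<close>.\<close>

lemma has_symbol_conv_dist:
  fixes u v :: "real^'n::finite \<Rightarrow> complex"
  assumes "has_symbol U u" "has_symbol V v"
  shows "has_symbol (conv_dist U V) (\<lambda>\<xi>. u \<xi> * v \<xi>)"
  unfolding has_symbol_def
proof (intro conjI ballI)
  have s: "slow1 u" "slow1 v" using assms by (auto simp: has_symbol_def)
  show "slow1 (\<lambda>\<xi>. u \<xi> * v \<xi>)" by (rule slow_bilinear[OF bounded_bilinear_mult s])
  fix \<psi> :: "real^'n \<Rightarrow> complex" assume psi: "\<psi> \<in> schwartz"
  have "V (\<lambda>y. fourier \<psi> (x + y)) = fourier (\<lambda>\<xi>. v \<xi> * \<psi> \<xi>) x" for x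
  proof -
    have "V (\<lambda>y. fourier \<psi> (x + y)) = V (fourier (\<lambda>\<xi>. cis (- x \<bullet> \<xi>) * \<psi> \<xi>))"
      unfolding fourier_modulate by (simp add: add.commute)
    also have "\<dots> = (\<integral>\<xi>. v \<xi> * (cis (- x \<bullet> \<xi>) * \<psi> \<xi>) \<partial>lborel)"
      using assms(2) schwartz_modulate[OF psi, of "- x"] unfolding has_symbol_def by blast
    finally show ?thesis by (simp add: fourier_cis inner_commute mult_ac)
  qed
  then have "conv_dist U V (fourier \<psi>) = U (fourier (\<lambda>\<xi>. v \<xi> * \<psi> \<xi>))"
    using schwartz_fourier[OF psi] by (simp add: conv_dist_def on_schwartz_def)
  also have "\<dots> = (\<integral>x. u x * (v x * \<psi> x) \<partial>lborel)"
    using assms(1) schwartz_slow_mult[OF s(2) psi] by (simp add: has_symbol_def)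
  finally show "conv_dist U V (fourier \<psi>) = (\<integral>x. u x * v x * \<psi> x \<partial>lborel)" by (simp add: mult.assoc)
qed

text \<open>By Fourier inversion \<open>y \<mapsto> \<phi>(x - y)\<close> is the Fourier transform of a modulation of \<open>\<F> \<phi>\<close>, to which \<open>T\<close> can
  be applied through its symbol.\<close>

lemma conv_fun_eq:
  fixes \<phi> :: "real^'n::finite \<Rightarrow> complex"
  assumes T: "has_symbol T g" and phi: "\<phi> \<in> schwartz"
  shows "conv_fun T \<phi> = inverse_fourier (\<lambda>\<xi>. g \<xi> * fourier \<phi> \<xi>)"
proof
  fix x
  let ?c = "gauss_integral TYPE('n)"
  let ?\<psi> = "\<lambda>\<xi>. (1 / ?c\<^sup>2) * (cis (x \<bullet> \<xi>) * fourier \<phi> \<xi>)"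
  have psi: "?\<psi> \<in> schwartz"
    by (rule schwartz_linear[OF bounded_linear_mult_right schwartz_modulate[OF schwartz_fourier[OF phi]]])
  have F: "fourier ?\<psi> y = \<phi> (x - y)" for y
    unfolding fourier_cmult fourier_modulate
    using fourier_inversion[OF phi, of "x - y"] by (simp add: gauss_integral_nonzero)
  have "conv_fun T \<phi> x = T (fourier ?\<psi>)" unfolding conv_fun_def F[symmetric] ..
  also have "\<dots> = (\<integral>\<xi>. g \<xi> * ?\<psi> \<xi> \<partial>lborel)" using T psi unfolding has_symbol_def by blast
  also have "\<dots> = (\<integral>\<xi>. (cis (- (\<xi> \<bullet> - x)) * (g \<xi> * fourier \<phi> \<xi>)) / ?c\<^sup>2 \<partial>lborel)"
    by (simp add: inner_commute mult_ac)
  finally show "conv_fun T \<phi> x = inverse_fourier (\<lambda>\<xi>. g \<xi> * fourier \<phi> \<xi>) x"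
    by (simp add: inverse_fourier_def fourier_cis)
qed

lemma fourier_conv_fun:
  assumes "has_symbol T g" "\<phi> \<in> schwartz"
  shows "fourier (conv_fun T \<phi>) = (\<lambda>\<xi>. g \<xi> * fourier \<phi> \<xi>)"
  unfolding conv_fun_eq[OF assms]
  by (intro fourier_inverse_fourier schwartz_slow_mult has_symbol_slow[OF assms(1)] schwartz_fourier assms(2))

lemma schwartz_conv_fun:
  assumes "has_symbol T g" "\<phi> \<in> schwartz"
  shows "conv_fun T \<phi> \<in> schwartz"
  unfolding conv_fun_eq[OF assms]
  by (intro schwartz_inverse_fourier schwartz_slow_mult has_symbol_slow[OF assms(1)] schwartz_fourier assms(2))

lemma conv_fun_add:
  assumes T: "has_symbol T g" and "\<phi> \<in> schwartz" "\<psi> \<in> schwartz"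
  shows "conv_fun T (\<lambda>x. \<phi> x + \<psi> x) = (\<lambda>x. conv_fun T \<phi> x + conv_fun T \<psi> x)"
proof -
  have s: "(\<lambda>\<xi>. g \<xi> * fourier f \<xi>) \<in> schwartz" if "f \<in> schwartz" for f
    by (intro schwartz_slow_mult has_symbol_slow[OF T] schwartz_fourier that)
  show ?thesis
    unfolding conv_fun_eq[OF T assms(2)] conv_fun_eq[OF T assms(3)]
      conv_fun_eq[OF T schwartz_add[OF assms(2,3)]] inverse_fourier_def
      fourier_add[OF schwartz_decaying[OF assms(2)] schwartz_decaying[OF assms(3)]] distrib_left
      fourier_add[OF schwartz_decaying[OF s[OF assms(2)]] schwartz_decaying[OF s[OF assms(3)]]]
    by (simp add: add_divide_distrib)
qed

lemma conv_fun_cmult: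
  assumes T: "has_symbol T g" and "\<phi> \<in> schwartz"
  shows "conv_fun T (\<lambda>x. c * \<phi> x) = (\<lambda>x. c * conv_fun T \<phi> x)"
proof -
  have "(\<lambda>x. c * \<phi> x) \<in> schwartz" by (rule schwartz_linear[OF bounded_linear_mult_right assms(2)])
  from conv_fun_eq[OF T this] show ?thesis
    unfolding conv_fun_eq[OF assms] inverse_fourier_def fourier_cmult mult.left_commute[of _ c]
    by simp
qed

lemma decaying_bigo:
  fixes f :: "real^'n::finite \<Rightarrow> complex"
  assumes c: "continuous_on UNIV f" and O: "(\<lambda>x. norm (f x)) \<in> O[at_infinity](\<lambda>x. 1 / norm x ^ k)"
  shows "decaying k f"
proof -
  from O obtain c b where c0: "c > 0" and b: "\<And>x. norm x \<ge> b \<Longrightarrow> norm (f x) \<le> c * (1 / norm x ^ k)"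
    by (elim landau_o.bigE) (auto simp: eventually_at_infinity)
  define R where "R = max b 1"
  have "compact ((\<lambda>x. (1 + norm x) ^ k * norm (f x)) ` cball 0 R)"
    by (intro compact_continuous_image continuous_intros continuous_on_subset[OF c]) auto
  then obtain B where B: "\<And>x. norm x \<le> R \<Longrightarrow> (1 + norm x) ^ k * norm (f x) \<le> B"
    by (fastforce dest!: compact_imp_bounded simp: bounded_iff)
  have "(1 + norm x) ^ k * norm (f x) \<le> max B (2 ^ k * c)" for x
  proof (cases "norm x \<le> R")
    case True
    then show ?thesis using B by (simp add: le_max_iff_disj)
  next
    case False
    then have x: "norm x \<ge> b" "norm x \<ge> 1" by (auto simp: R_def)
    have "norm x > 0" using x by linarith
    have "(1 + norm x) ^ k * norm (f x) \<le> (2 * norm x) ^ k * (c * (1 / norm x ^ k))"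
      by (intro mult_mono power_mono b) (use x in auto)
    also have "(2 * norm x) ^ k * (c * (1 / norm x ^ k)) = 2 ^ k * c"
      using \<open>norm x > 0\<close> by (simp add: power_mult_distrib)
    finally show ?thesis by simp
  qed
  with c show ?thesis by (auto simp: decaying_def)
qed

text \<open>A continuous \<open>f\<close> with \<open>f(x) = O(|x|\<^bsup>-k\<^esup>)\<close> for \<open>k = 2 n + 2 + l\<close> has a Fourier transform with \<open>l\<close> bounded
  derivatives, and \<open>\<partial>\<^sup>\<alpha>\<close> turns into multiplication by a monomial.\<close>

lemma OC_symbol_finite_order:
  fixes T :: "'n::finite functional"
  assumes "T \<in> OC"
  shows "\<exists>g. slow_upto l g \<and> (\<forall>\<psi>\<in>schwartz. T (fourier \<psi>) = (\<integral>x. g x * \<psi> x \<partial>lborel))"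
proof -
  obtain m and f :: "'n list \<Rightarrow> real^'n \<Rightarrow> complex" where
    f: "\<And>\<alpha>. length \<alpha> \<le> m \<Longrightarrow> continuous_on UNIV (f \<alpha>) \<and>
        (\<lambda>x. norm (f \<alpha> x)) \<in> O[at_infinity](\<lambda>x. 1 / norm x ^ (2 * CARD('n) + 2 + l))"
    and T: "T = (\<lambda>\<phi>. \<Sum>\<alpha> | length \<alpha> \<le> m. dist_mderiv \<alpha> (regular_dist (f \<alpha>)) \<phi>)"
    using assms unfolding OC_def by blast
  have d: "decaying (2 * CARD('n) + 2 + l) (f \<alpha>)" if "length \<alpha> \<le> m" for \<alpha>
    using f[OF that] decaying_bigo by blast
  have d0: "decaying (2 * CARD('n)) (f \<alpha>)" if "length \<alpha> \<le> m" for \<alpha>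
    by (rule decaying_mono[OF d[OF that]]) simp
  define h where "h \<alpha> x = (-1) ^ length \<alpha> * (fourier (f \<alpha>) x * monomial \<alpha> x)" for \<alpha> x
  have h: "slow_upto l (h \<alpha>)" if "length \<alpha> \<le> m" for \<alpha>
    unfolding h_def using slow_upto_linear[OF bounded_linear_mult_right slow_upto_bilinear[OF
      bounded_bilinear_mult slow_upto_fourier[OF d[OF that]] slow_upto_slow[OF slow_monomial]]] .
  have *: "dist_mderiv \<alpha> (regular_dist (f \<alpha>)) (fourier \<psi>) = (\<integral>x. h \<alpha> x * \<psi> x \<partial>lborel)
      \<and> integrable lborel (\<lambda>x. h \<alpha> x * \<psi> x)"
    if a: "length \<alpha> \<le> m" and psi: "\<psi> \<in> schwartz" for \<alpha> \<psi>
  proof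
    have mp: "(\<lambda>x. monomial \<alpha> x * \<psi> x) \<in> schwartz" by (rule schwartz_slow_mult[OF slow_monomial psi])
    have "dist_mderiv \<alpha> (regular_dist (f \<alpha>)) (fourier \<psi>)
        = (-1) ^ length \<alpha> * (\<integral>x. f \<alpha> x * fourier (\<lambda>x. monomial \<alpha> x * \<psi> x) x \<partial>lborel)"
      using schwartz_fourier[OF psi] schwartz_mderiv[OF schwartz_fourier[OF psi], of \<alpha>]
      by (simp add: dist_mderiv_def regular_dist_def on_schwartz_def mderiv_fourier_schwartz[OF psi])
    also have "(\<integral>x. f \<alpha> x * fourier (\<lambda>x. monomial \<alpha> x * \<psi> x) x \<partial>lborel)
        = (\<integral>x. fourier (f \<alpha>) x * (monomial \<alpha> x * \<psi> x) \<partial>lborel)"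
      by (rule fourier_multiplication[symmetric, OF d0[OF a] schwartz_decaying[OF mp]])
    finally show "dist_mderiv \<alpha> (regular_dist (f \<alpha>)) (fourier \<psi>) = (\<integral>x. h \<alpha> x * \<psi> x \<partial>lborel)"
      by (simp add: h_def mult.assoc)
    obtain C where C: "\<And>x. (1 + norm x) ^ (2 * CARD('n)) * norm (f \<alpha> x) \<le> C"
      using d0[OF a] by (auto simp: decaying_def)
    have "continuous_on UNIV (fourier (f \<alpha>))"
      by (rule differentiable_imp_continuous_on[OF fourier_differentiable[OF decaying_mono[OF d[OF a]]]]) simp
    moreover have "norm (fourier (f \<alpha>) x) \<le> (C * (\<integral>x. weight (x :: real^'n) \<partial>lborel)) * (1 + norm x) ^ 0" for x
      using fourier_bound[OF d0[OF a] C] by simp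
    ultimately have "integrable lborel (\<lambda>x. fourier (f \<alpha>) x * (monomial \<alpha> x * \<psi> x))"
      by (rule integrable_upto_schwartz) (rule mp)
    then have "integrable lborel (\<lambda>x. (-1) ^ length \<alpha> * (fourier (f \<alpha>) x * (monomial \<alpha> x * \<psi> x)))"
      by (rule integrable_mult_right)
    then show "integrable lborel (\<lambda>x. h \<alpha> x * \<psi> x)" by (simp add: h_def mult.assoc)
  qed
  show ?thesis
  proof (intro exI conjI ballI)
    show "slow_upto l (\<lambda>x. \<Sum>\<alpha> | length \<alpha> \<le> m. h \<alpha> x)" by (intro slow_upto_sum h) simp
    fix \<psi> :: "real^'n \<Rightarrow> complex" assume psi: "\<psi> \<in> schwartz"
    have "T (fourier \<psi>) = (\<Sum>\<alpha> | length \<alpha> \<le> m. \<integral>x. h \<alpha> x * \<psi> x \<partial>lborel)"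
      unfolding T using *[OF _ psi] by (intro sum.cong) auto
    also have "\<dots> = (\<integral>x. (\<Sum>\<alpha> | length \<alpha> \<le> m. h \<alpha> x * \<psi> x) \<partial>lborel)"
      using *[OF _ psi] by (intro Bochner_Integration.integral_sum[symmetric]) auto
    finally show "T (fourier \<psi>) = (\<integral>x. (\<Sum>\<alpha> | length \<alpha> \<le> m. h \<alpha> x) * \<psi> x \<partial>lborel)"
      by (simp add: sum_distrib_right)
  qed
qed

text \<open>The symbols of the various finite orders coincide by uniqueness, so this one function is smooth.\<close>

lemma has_symbol_OC:
  assumes "T \<in> OC"
  shows "has_symbol T (fourier_symbol T)"
proof -
  have "\<forall>l. \<exists>g. slow_upto (Suc l) g \<and> (\<forall>\<psi>\<in>schwartz. T (fourier \<psi>) = (\<integral>x. g x * \<psi> x \<partial>lborel))"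
    using OC_symbol_finite_order[OF assms] by blast
  from choice[OF this] obtain g where g: "\<And>l. slow_upto (Suc l) (g l)" and
    T: "\<And>l \<psi>. \<psi> \<in> schwartz \<Longrightarrow> T (fourier \<psi>) = (\<integral>x. g l x * \<psi> x \<partial>lborel)"
    by blast
  have "g l = g 0" for l
    by (rule eq_of_eq_on_schwartz[OF g g]) (simp only: T[symmetric])
  then have "slow_upto l (g 0)" for l
    using slow_upto_mono[OF g le_SucI[OF order_refl], of l] by metis
  then have "has_symbol T (g 0)" using T by (simp add: has_symbol_def slow_iff_upto)
  then show ?thesis by (simp add: fourier_symbol_eqI)
qed

section \<open>Matrix convolution operators\<close>

lemma tame_cong:
  assumes "tame I V" "\<And>i \<phi>. i \<in> I \<Longrightarrow> \<phi> \<in> schwartz \<Longrightarrow> U i \<phi> = V i \<phi>"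
  shows "tame I U"
  using assms unfolding tame_def by simp

lemma tame_conv_fun:
  assumes "slow I g" "\<And>t. t \<in> I \<Longrightarrow> has_symbol (T t) (g t)"
  shows "tame I (\<lambda>t. conv_fun (T t))"
proof (rule tame_cong)
  show "tame I (\<lambda>t \<phi>. inverse_fourier (\<lambda>\<xi>. g t \<xi> * fourier \<phi> \<xi>))"
    by (rule tame_compose[OF tame_inverse_fourier tame_compose[OF
        tame_multiplication[OF bounded_bilinear_mult assms(1)] tame_fourier]])
qed (use assms(2) conv_fun_eq in blast)

text \<open>Convolution is multiplication by the symbol between two Fourier transformations, and these are
  tame; the matrix structure only adds coordinate maps and finite sums.\<close>

lemma tame_mat_conv_fun:
  fixes A :: "'t \<Rightarrow> ('n::finite, 'm::finite) mfunctional"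
  assumes "\<And>i j. slow I (g i j)" "\<And>i j t. t \<in> I \<Longrightarrow> has_symbol (A t $ i $ j) (g i j t)"
  shows "tame I (\<lambda>t. mat_conv_fun (A t))"
proof -
  have "tame I (\<lambda>t \<phi> x. \<Sum>i\<in>UNIV. axis i (\<Sum>j\<in>UNIV. conv_fun (A t $ i $ j) (\<lambda>y. \<phi> y $ j) x))"
    by (intro tame_sum tame_compose[OF tame_linear[OF bounded_linear_axis]]
        tame_compose[OF tame_conv_fun[OF assms] tame_linear[OF bounded_linear_vec_nth]])
  then show ?thesis
  proof (rule tame_cong)
    show "mat_conv_fun (A t) \<phi>
      = (\<lambda>x. \<Sum>i\<in>UNIV. axis i (\<Sum>j\<in>UNIV. conv_fun (A t $ i $ j) (\<lambda>y. \<phi> y $ j) x))" for t \<phi>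
      by (rule ext, subst vec_eq_sum_axis) (simp add: mat_conv_fun_def)
  qed
qed

section \<open>Complex matrices and their spectrum\<close>

lemma bounded_bilinear_matrix_mult:
  "bounded_bilinear ((**) :: complex^'m::finite^'m \<Rightarrow> complex^'m^'m \<Rightarrow> complex^'m^'m)"
  unfolding bilinear_conv_bounded_bilinear[symmetric] bilinear_def
  by (auto intro!: linearI simp: matrix_matrix_mult_def vec_eq_iff distrib_left distrib_right
      sum.distrib scaleR_sum_right)

lemma bounded_bilinear_matrix_vector_mult:
  "bounded_bilinear ((*v) :: complex^'m::finite^'m \<Rightarrow> complex^'m \<Rightarrow> complex^'m)"
  unfolding bilinear_conv_bounded_bilinear[symmetric] bilinear_def
  by (auto intro!: linearI simp: matrix_vector_mult_def vec_eq_iff distrib_left distrib_right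
      sum.distrib scaleR_sum_right)

lemma bounded_bilinear_vector_scalar_mult:
  "bounded_bilinear ((*s) :: complex \<Rightarrow> complex^'m::finite \<Rightarrow> complex^'m)"
  unfolding bilinear_conv_bounded_bilinear[symmetric] bilinear_def
  by (auto intro!: linearI simp: vec_eq_iff distrib_left distrib_right)

lemma norm_vector_scalar_mult: "norm (c *s (v :: complex^'m::finite)) = norm c * norm v"
  by (simp add: norm_vec_def norm_mult L2_set_right_distrib)

lemma mat_mult_vec: "mat z *v (v :: complex^'m::finite) = z *s v"
  by (simp add: vec_eq_iff matrix_vector_mult_def mat_def if_distrib if_distribR sum.delta cong: if_cong)

lemma spectrum_iff_eigenvector:
  "z \<in> spectrum A \<longleftrightarrow> (\<exists>v. v \<noteq> 0 \<and> A *v v = z *s v)"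
proof -
  have "(mat z - A) *v v = z *s v - A *v v" for v
    by (simp add: matrix_vector_mult_diff_rdistrib mat_mult_vec)
  then have "invertible (mat z - A) \<longleftrightarrow> (\<forall>v. z *s v - A *v v = 0 \<longrightarrow> v = 0)"
    unfolding invertible_left_inverse matrix_left_invertible_ker by simp
  then show ?thesis by (auto simp: spectrum_def)
qed

lemma norm_vec_le_sum: "norm (v :: 'b::real_normed_vector^'m::finite) \<le> (\<Sum>i\<in>UNIV. norm (v $ i))"
  unfolding norm_vec_def by (rule L2_set_le_sum) simp

lemma norm_matrix_le_columns:
  fixes A :: "complex^'m::finite^'m"
  assumes "\<And>j. norm (A *v axis j 1) \<le> B"
  shows "norm A \<le> real CARD('m) * (real CARD('m) * B)"
proof -
  have "norm (A $ i $ j) \<le> B" for i j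
  proof -
    have "(A *v axis j 1) $ i = A $ i $ j"
      by (simp add: matrix_vector_mult_def axis_def if_distrib cong: if_cong)
    then show ?thesis using assms[of j] Finite_Cartesian_Product.norm_nth_le[of "A *v axis j 1" i] by simp
  qed
  then have "(\<Sum>j\<in>UNIV. norm (A $ i $ j)) \<le> real CARD('m) * B" for i
    by (intro sum_bounded_above) auto
  then have "norm (A $ i) \<le> real CARD('m) * B" for i
    using norm_vec_le_sum[of "A $ i"] by (rule order_trans[rotated])
  then have "(\<Sum>i\<in>UNIV. norm (A $ i)) \<le> real CARD('m) * (real CARD('m) * B)"
    by (intro sum_bounded_above) auto
  then show ?thesis using norm_vec_le_sum[of A] by (rule order_trans[rotated])
qed

text \<open>The vector \<open>p(A) v\<close>, by Horner's scheme.\<close>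

definition poly_apply :: "complex^'m::finite^'m \<Rightarrow> complex poly \<Rightarrow> complex^'m \<Rightarrow> complex^'m" where
  "poly_apply A p v = fold_coeffs (\<lambda>c w. c *s v + A *v w) p 0"

lemma poly_apply_0 [simp]: "poly_apply A 0 v = 0"
  by (simp add: poly_apply_def)

lemma poly_apply_pCons [simp]: "poly_apply A (pCons c p) v = c *s v + A *v poly_apply A p v"
  by (cases "p = 0 \<and> c = 0") (auto simp: poly_apply_def)

lemma poly_apply_add: "poly_apply A (p + q) v = poly_apply A p v + poly_apply A q v"
  by (induction p q rule: poly_induct2)
     (simp_all add: matrix_vector_right_distrib vector_sadd_rdistrib)

lemma poly_apply_smult: "poly_apply A (smult c p) v = c *s poly_apply A p v"
  by (induction p) (simp_all add: vector_add_ldistrib vector_smult_assoc vector_scalar_commute)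

lemma poly_apply_commute:
  assumes "A ** B = B ** A"
  shows "poly_apply A p (B *v v) = B *v poly_apply A p v"
  by (induction p)
     (simp_all add: matrix_vector_right_distrib vector_scalar_commute matrix_vector_mul_assoc assms)

lemma poly_apply_diff: "poly_apply A p (v - w) = poly_apply A p v - poly_apply A p w"
  by (induction p) (simp_all add: vector_ssub_ldistrib matrix_vector_mult_diff_distrib)

lemma poly_apply_scale: "poly_apply A p (c *s v) = c *s poly_apply A p v"
  by (induction p) (simp_all add: vector_add_ldistrib vector_smult_assoc vector_scalar_commute mult.commute)

lemma poly_apply_linear_factor:
  "poly_apply A ([:- z, 1:] * q) v = A *v poly_apply A q v - z *s poly_apply A q v"
proof -
  have "[:- z, 1:] * q = smult (- z) q + pCons 0 q" by simp
  then show ?thesis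
    by (simp only: poly_apply_add poly_apply_smult poly_apply_pCons) (simp add: vec_eq_iff)
qed

lemma poly_apply_monom: "poly_apply A (monom c i) v = c *s (((*v) A) ^^ i) v"
  by (induction i) (simp_all add: monom_0 monom_Suc vector_scalar_commute)

lemma poly_apply_sum: "poly_apply A (\<Sum>i\<in>I. p i) v = (\<Sum>i\<in>I. poly_apply A (p i) v)"
  by (induction I rule: infinite_finite_induct) (simp_all add: poly_apply_add)

text \<open>The vectors \<open>v, A v, A\<^sup>2 v, \<dots>\<close> are linearly dependent over the reals as soon as there are more than
  \<open>2 m\<close> of them. What counts is a bound for the degree that depends on \<open>m\<close> alone.\<close>

lemma annihilating_poly:
  fixes A :: "complex^'m::finite^'m"
  obtains p where "p \<noteq> 0" "degree p \<le> DIM(complex^'m)" "poly_apply A p v = 0"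
proof -
  let ?N = "DIM(complex^'m)"
  let ?x = "\<lambda>i. (((*v) A) ^^ i) v"
  have "\<exists>c :: nat \<Rightarrow> real. (\<exists>i\<le>?N. c i \<noteq> 0) \<and> (\<Sum>i\<le>?N. c i *\<^sub>R ?x i) = 0"
  proof (cases "inj_on ?x {..?N}")
    case True
    have "dependent (?x ` {..?N})"
      by (rule dependent_biggerset) (use True in \<open>simp add: card_image\<close>)
    then obtain u where u: "\<exists>x\<in>?x ` {..?N}. u x \<noteq> 0" "(\<Sum>x\<in>?x ` {..?N}. u x *\<^sub>R x) = 0"
      by (auto simp: dependent_finite)
    then show ?thesis
      using True by (intro exI[of _ "u \<circ> ?x"]) (auto simp: sum.reindex)
  next
    case False
    then obtain i j where ij: "i \<le> ?N" "j \<le> ?N" "i \<noteq> j" "?x i = ?x j"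
      unfolding inj_on_def by auto
    let ?c = "\<lambda>k. if k = i then 1 else if k = j then -1 else (0::real)"
    have "(\<Sum>k\<le>?N. ?c k *\<^sub>R ?x k) = (\<Sum>k\<in>{i, j}. ?c k *\<^sub>R ?x k)"
      by (rule sum.mono_neutral_right) (use ij in auto)
    also have "\<dots> = 0" using ij by simp
    finally show ?thesis using ij(1) by (intro exI[of _ ?c]) auto
  qed
  then obtain c :: "nat \<Rightarrow> real" and k where c: "k \<le> ?N" "c k \<noteq> 0" "(\<Sum>i\<le>?N. c i *\<^sub>R ?x i) = 0" by blast
  let ?p = "\<Sum>i\<le>?N. monom (complex_of_real (c i)) i"
  show thesis
  proof (rule that)
    have "coeff ?p k = complex_of_real (c k)"
      using c(1) by (simp add: coeff_sum if_distrib sum.delta cong: if_cong)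
    then show "?p \<noteq> 0" using c(2) by auto
    show "degree ?p \<le> ?N"
      by (intro degree_sum_le) (auto intro: order_trans[OF degree_monom_le])
    have "complex_of_real r *s w = r *\<^sub>R w" for r and w :: "complex^'m"
      by (simp add: vec_eq_iff scaleR_conv_of_real[of r "w $ i" for i])
    then show "poly_apply A ?p v = 0" using c(3) by (simp add: poly_apply_sum poly_apply_monom)
  qed
qed

section \<open>Growth of matrix semigroups\<close>

text \<open>If \<open>u' = A u\<close> and \<open>p(A) u = 0\<close>, split off a root \<open>z\<close> of \<open>p\<close>. If \<open>z\<close> is no eigenvalue, the linear factor
  can be cancelled. Otherwise \<open>w = (A - z) u\<close> solves the same equation, is annihilated by a
  polynomial of smaller degree, and \<open>(e\<^sup>-\<^sup>z\<^sup>t u)' = e\<^sup>-\<^sup>z\<^sup>t w\<close>. So every degree costs a factor \<open>1 + t\<close>.\<close>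

lemma annihilated_solution_growth:
  fixes A :: "complex^'m::finite^'m"
  assumes spec: "\<And>z. z \<in> spectrum A \<Longrightarrow> Re z \<le> \<omega>"
    and M: "M \<ge> 1" "\<And>z w. z \<in> spectrum A \<Longrightarrow> norm (A *v w - z *s w) \<le> M * norm w"
    and p: "p \<noteq> 0" "degree p = d"
    and u: "\<And>t. t \<ge> 0 \<Longrightarrow> (u has_vector_derivative A *v u t) (at t within {0..})"
      "\<And>t. t \<ge> 0 \<Longrightarrow> poly_apply A p (u t) = 0"
    and t: "t \<ge> 0"
  shows "norm (u t) \<le> exp (\<omega> * t) * (1 + t) ^ d * M ^ d * norm (u 0)"
  using p u t
proof (induction d arbitrary: p u t)
  case 0
  then obtain c where "p = [:c:]" "c \<noteq> 0" by (metis degree_eq_zeroE pCons_0_0)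
  then have "u s = 0" if "s \<ge> 0" for s using "0.prems"(4)[OF that] by simp
  then show ?case using "0.prems"(5) by simp
next
  case (Suc d)
  have "\<not> constant (poly p)" using Suc.prems(2) by (simp add: constant_degree)
  then obtain z where "poly p z = 0" using fundamental_theorem_of_algebra by blast
  then obtain q where q: "p = [:- z, 1:] * q" by (auto simp: poly_eq_0_iff_dvd)
  have q0: "q \<noteq> 0" using q Suc.prems(1) by auto
  have dq: "degree q = d"
    using Suc.prems(2) q0 unfolding q by (subst (asm) degree_mult_eq) auto
  have q_u: "A *v poly_apply A q (u s) - z *s poly_apply A q (u s) = 0" if "s \<ge> 0" for s
    using Suc.prems(4)[OF that] unfolding q poly_apply_linear_factor .
  let ?R = "M ^ d * (M * norm (u 0))"
  show ?case
  proof (cases "z \<in> spectrum A")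
    case False
    have "poly_apply A q (u s) = 0" if "s \<ge> 0" for s
      using q_u[OF that] False unfolding spectrum_iff_eigenvector by (metis eq_iff_diff_eq_0)
    then have "norm (u t) \<le> exp (\<omega> * t) * (1 + t) ^ d * M ^ d * norm (u 0)"
      by (intro Suc.IH[OF q0 dq Suc.prems(3)] Suc.prems(5)) auto
    also have "\<dots> \<le> exp (\<omega> * t) * (1 + t) ^ Suc d * M ^ Suc d * norm (u 0)"
      using Suc.prems(5) M(1) by (intro mult_right_mono mult_mono mult_left_mono power_increasing) auto
    finally show ?thesis .
  next
    case True
    define w where "w s = A *v u s - z *s u s" for s
    have w': "(w has_vector_derivative A *v w s) (at s within {0..})" if s: "s \<ge> 0" for s
    proof -
      have "(w has_vector_derivative A *v (A *v u s) - z *s (A *v u s)) (at s within {0..})"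
        unfolding w_def
        by (intro has_vector_derivative_diff
            bounded_linear.has_vector_derivative[OF bounded_bilinear.bounded_linear_right[OF bounded_bilinear_matrix_vector_mult]]
            bounded_linear.has_vector_derivative[OF bounded_bilinear.bounded_linear_right[OF bounded_bilinear_vector_scalar_mult]]
            Suc.prems(3) s)
      then show ?thesis by (simp add: w_def matrix_vector_mult_diff_distrib vector_scalar_commute)
    qed
    have qw: "poly_apply A q (w s) = 0" if "s \<ge> 0" for s
      using q_u[OF that] by (simp add: w_def poly_apply_diff poly_apply_scale poly_apply_commute)
    have w: "norm (w s) \<le> exp (\<omega> * s) * (1 + s) ^ d * ?R" if s: "s \<ge> 0" for s
    proof -
      have "norm (w s) \<le> exp (\<omega> * s) * (1 + s) ^ d * M ^ d * norm (w 0)"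
        by (rule Suc.IH[OF q0 dq w' qw s])
      also have "\<dots> \<le> exp (\<omega> * s) * (1 + s) ^ d * M ^ d * (M * norm (u 0))"
        using M s True by (intro mult_left_mono) (auto simp: w_def)
      finally show ?thesis by (simp add: mult_ac)
    qed
    let ?v = "\<lambda>s. exp (- z * of_real s) *s u s"
    let ?B = "exp ((\<omega> - Re z) * t) * (1 + t) ^ d * ?R"
    have "norm (?v t - ?v 0) \<le> ?B * (t - 0)"
    proof (rule norm_diff_le_vector_derivative[OF Suc.prems(5)])
      fix s assume s: "s \<in> {0..t}"
      have "((\<lambda>s. exp (- z * of_real s)) has_vector_derivative - z * exp (- z * of_real s)) (at s within {0..t})"
        by (rule has_vector_derivative_real_field[THEN has_vector_derivative_at_within])
          (auto intro!: derivative_eq_intros)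
      moreover have "(u has_vector_derivative A *v u s) (at s within {0..t})"
        using s by (intro has_vector_derivative_within_subset[OF Suc.prems(3)]) auto
      ultimately have "(?v has_vector_derivative
          exp (- z * of_real s) *s (A *v u s) + (- z * exp (- z * of_real s)) *s u s) (at s within {0..t})"
        by (rule bounded_bilinear.has_vector_derivative[OF bounded_bilinear_vector_scalar_mult])
      moreover have "exp (- z * of_real s) *s (A *v u s) + (- z * exp (- z * of_real s)) *s u s
          = exp (- z * of_real s) *s w s"
        by (simp add: w_def vec_eq_iff right_diff_distrib mult.left_commute mult.assoc)
      ultimately show "(?v has_vector_derivative exp (- z * of_real s) *s w s) (at s within {0..t})"
        by simp
      have "norm (exp (- z * of_real s) *s w s) = exp (- Re z * s) * norm (w s)"
        unfolding norm_vector_scalar_mult norm_exp_eq_Re by simp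
      also have "\<dots> \<le> exp (- Re z * s) * (exp (\<omega> * s) * (1 + s) ^ d * ?R)"
        using s by (intro mult_left_mono w) auto
      also have "\<dots> = (exp (- Re z * s) * exp (\<omega> * s)) * (1 + s) ^ d * ?R"
        by (simp only: mult.assoc)
      also have "exp (- Re z * s) * exp (\<omega> * s) = exp ((\<omega> - Re z) * s)"
        by (simp add: left_diff_distrib flip: exp_add)
      also have "exp ((\<omega> - Re z) * s) * (1 + s) ^ d * ?R \<le> ?B"
      proof (rule mult_right_mono)
        show "exp ((\<omega> - Re z) * s) * (1 + s) ^ d \<le> exp ((\<omega> - Re z) * t) * (1 + t) ^ d"
          using s spec[OF True] by (intro mult_mono power_mono) (auto intro!: mult_left_mono)
      qed (use M(1) in simp)
      finally show "norm (exp (- z * of_real s) *s w s) \<le> ?B" .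
    qed
    then have "norm (?v t) \<le> norm (u 0) + ?B * t"
      using norm_triangle_ineq2[of "?v t" "?v 0"] by simp
    moreover have "norm (?v t) = exp (- Re z * t) * norm (u t)"
      unfolding norm_vector_scalar_mult norm_exp_eq_Re by simp
    ultimately have "exp (- Re z * t) * norm (u t) \<le> norm (u 0) + ?B * t" by simp
    then have "exp (Re z * t) * (exp (- Re z * t) * norm (u t)) \<le> exp (Re z * t) * (norm (u 0) + ?B * t)"
      by (rule mult_left_mono) simp
    moreover have "exp (Re z * t) * (exp (- Re z * t) * norm (u t)) = norm (u t)"
      by (simp add: exp_minus)
    moreover have "exp (Re z * t) * (norm (u 0) + ?B * t)
        = exp (Re z * t) * norm (u 0) + exp (Re z * t) * exp ((\<omega> - Re z) * t) * (1 + t) ^ d * ?R * t"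
      by (simp only: distrib_left mult.assoc)
    ultimately have "norm (u t) \<le> exp (Re z * t) * norm (u 0)
        + exp (Re z * t) * exp ((\<omega> - Re z) * t) * (1 + t) ^ d * ?R * t"
      by (simp only:)
    also have "exp (Re z * t) * exp ((\<omega> - Re z) * t) = exp (\<omega> * t)"
      by (simp add: left_diff_distrib flip: exp_add)
    also have "exp (Re z * t) * norm (u 0) \<le> exp (\<omega> * t) * (1 + t) ^ d * ?R"
    proof -
      have "1 * norm (u 0) \<le> M ^ Suc d * norm (u 0)"
        using M(1) by (intro mult_right_mono one_le_power) auto
      then have "norm (u 0) \<le> ?R" by (simp add: mult_ac)
      then have "exp (Re z * t) * 1 * norm (u 0) \<le> exp (\<omega> * t) * (1 + t) ^ d * ?R"
        using spec[OF True] Suc.prems(5)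
        by (intro mult_mono) (auto intro!: mult_right_mono one_le_power)
      then show ?thesis by simp
    qed
    finally show ?thesis by (simp add: algebra_simps)
  qed
qed

text \<open>Annihilating polynomials for the basis vectors, with \<open>|z| \<le> K |A|\<close> for every eigenvalue \<open>z\<close>. The
  bound is polynomial in \<open>A\<close>, which is what a symbol of polynomial growth requires.\<close>

lemma matrix_semigroup_growth:
  fixes A :: "complex^'m::finite^'m" and E :: "real \<Rightarrow> complex^'m^'m"
  assumes K: "K \<ge> 0" "\<And>(B :: complex^'m^'m) v. norm (B *v v) \<le> norm B * norm v * K"
    and spec: "\<And>z. z \<in> spectrum A \<Longrightarrow> Re z \<le> \<omega>"
    and E: "\<And>t. t \<ge> 0 \<Longrightarrow> (E has_vector_derivative A ** E t) (at t within {0..})"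
      "\<And>t. t \<ge> 0 \<Longrightarrow> A ** E t = E t ** A" "E 0 = mat 1"
    and t: "t \<ge> 0"
  shows "norm (E t) \<le> real CARD('m) * (real CARD('m) *
    (exp (\<omega> * t) * (1 + t) ^ DIM(complex^'m) * (1 + 2 * K * norm A) ^ DIM(complex^'m)))"
proof (rule norm_matrix_le_columns)
  fix j
  let ?e = "axis j 1 :: complex^'m"
  let ?M = "1 + 2 * K * norm A"
  obtain p where p: "p \<noteq> 0" "degree p \<le> DIM(complex^'m)" "poly_apply A p ?e = 0"
    by (rule annihilating_poly)
  have M: "?M \<ge> 1" using K(1) by simp
  have "norm (E t *v ?e) \<le> exp (\<omega> * t) * (1 + t) ^ degree p * ?M ^ degree p * norm (E 0 *v ?e)"
  proof (rule annihilated_solution_growth[OF spec M _ p(1) refl _ _ t])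
    fix z and w :: "complex^'m" assume z: "z \<in> spectrum A"
    then obtain v where v: "v \<noteq> 0" "A *v v = z *s v" by (auto simp: spectrum_iff_eigenvector)
    then have "norm z * norm v \<le> (norm A * K) * norm v"
      using K(2)[of A v] by (simp add: norm_vector_scalar_mult mult_ac)
    then have "norm z \<le> norm A * K" using v(1) by simp
    then have "norm (z *s w) \<le> (norm A * K) * norm w"
      unfolding norm_vector_scalar_mult by (rule mult_right_mono) simp
    then have "norm (A *v w) + norm (z *s w) \<le> norm A * norm w * K + (norm A * K) * norm w"
      by (intro add_mono K)
    also have "\<dots> \<le> ?M * norm w" by (simp add: algebra_simps)
    finally show "norm (A *v w - z *s w) \<le> ?M * norm w"
      using norm_triangle_ineq4[of "A *v w" "z *s w"] by linarith
  next
    fix s :: real assume s: "s \<ge> 0"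
    have "((\<lambda>s. E s *v ?e) has_vector_derivative (A ** E s) *v ?e) (at s within {0..})"
      by (rule bounded_linear.has_vector_derivative[OF bounded_bilinear.bounded_linear_left[OF
          bounded_bilinear_matrix_vector_mult] E(1)[OF s]])
    then show "((\<lambda>s. E s *v ?e) has_vector_derivative A *v (E s *v ?e)) (at s within {0..})"
      by (simp add: matrix_vector_mul_assoc)
    show "poly_apply A p (E s *v ?e) = 0"
      using poly_apply_commute[OF E(2)[OF s]] p(3) by simp
  qed
  also have "norm (E 0 *v ?e) = 1" by (simp add: E(3))
  also have "exp (\<omega> * t) * (1 + t) ^ degree p * ?M ^ degree p * 1
      \<le> exp (\<omega> * t) * (1 + t) ^ DIM(complex^'m) * ?M ^ DIM(complex^'m)"
    unfolding mult_1_right using t M p(2) by (intro mult_mono mult_left_mono power_increasing) auto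
  finally show "norm (E t *v ?e) \<le> exp (\<omega> * t) * (1 + t) ^ DIM(complex^'m) * ?M ^ DIM(complex^'m)" .
qed

text \<open>Duhamel's formula in the form of an estimate, from the derivative of \<open>s \<mapsto> E(t - s) u(s)\<close>.\<close>

lemma duhamel_bound:
  fixes A :: "complex^'m::finite^'m" and E u f :: "real \<Rightarrow> complex^'m^'m"
  assumes K: "K \<ge> 0" "\<And>(B :: complex^'m^'m) (C :: complex^'m^'m). norm (B ** C) \<le> norm B * norm C * K"
    and E: "\<And>t. t \<ge> 0 \<Longrightarrow> (E has_vector_derivative A ** E t) (at t within {0..})"
      "\<And>t. t \<ge> 0 \<Longrightarrow> A ** E t = E t ** A" "E 0 = mat 1"
    and u: "\<And>t. t \<ge> 0 \<Longrightarrow> (u has_vector_derivative A ** u t + f t) (at t within {0..})" "u 0 = 0"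
    and B: "B \<ge> 0" "\<And>s. s \<in> {0..t} \<Longrightarrow> norm (E s) \<le> B * exp (\<omega> * s)"
    and D: "\<And>s. s \<in> {0..t} \<Longrightarrow> norm (f s) \<le> D * exp (\<omega> * s)"
    and t: "t \<ge> 0"
  shows "norm (u t) \<le> K * B * D * t * exp (\<omega> * t)"
proof -
  let ?w = "\<lambda>s. E (t - s) ** u s"
  have "norm (?w t - ?w 0) \<le> (B * exp (\<omega> * t) * D * K) * (t - 0)"
  proof (rule norm_diff_le_vector_derivative[OF t])
    fix s assume s: "s \<in> {0..t}"
    have "((\<lambda>s. t - s) has_vector_derivative - 1) (at s within {0..t})"
      by (auto intro!: derivative_eq_intros)
    moreover have "(E has_vector_derivative A ** E (t - s)) (at (t - s) within (\<lambda>s. t - s) ` {0..t})"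
      using s by (intro has_vector_derivative_within_subset[OF E(1)]) auto
    ultimately have "((\<lambda>s. E (t - s)) has_vector_derivative - (A ** E (t - s))) (at s within {0..t})"
      using vector_diff_chain_within[of "\<lambda>s. t - s" "-1" s "{0..t}" E "A ** E (t - s)"] by (simp add: o_def)
    moreover have "(u has_vector_derivative A ** u s + f s) (at s within {0..t})"
      using s by (intro has_vector_derivative_within_subset[OF u(1)]) auto
    ultimately have "(?w has_vector_derivative
        E (t - s) ** (A ** u s + f s) + - (A ** E (t - s)) ** u s) (at s within {0..t})"
      by (rule bounded_bilinear.has_vector_derivative[OF bounded_bilinear_matrix_mult])
    moreover have "E (t - s) ** (A ** u s + f s) + - (A ** E (t - s)) ** u s = E (t - s) ** f s"
      using s E(2)[of "t - s"] bounded_bilinear.minus_left[OF bounded_bilinear_matrix_mult, of "A ** E (t - s)" "u s"]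
      by (simp add: matrix_add_ldistrib matrix_mul_assoc)
    ultimately show "(?w has_vector_derivative E (t - s) ** f s) (at s within {0..t})" by simp
    have "norm (E (t - s) ** f s) \<le> norm (E (t - s)) * norm (f s) * K" by (rule K)
    also have "\<dots> \<le> (B * exp (\<omega> * (t - s))) * (D * exp (\<omega> * s)) * K"
      using s B(1) by (intro mult_right_mono mult_mono B(2) D K) auto
    also have "\<dots> = B * (exp (\<omega> * (t - s)) * exp (\<omega> * s)) * D * K" by (simp add: mult_ac)
    also have "exp (\<omega> * (t - s)) * exp (\<omega> * s) = exp (\<omega> * t)"
      by (simp add: algebra_simps flip: exp_add)
    finally show "norm (E (t - s) ** f s) \<le> B * exp (\<omega> * t) * D * K" .
  qed
  moreover have "?w t - ?w 0 = u t"
    using u(2) by (simp add: E(3) bounded_bilinear.zero_right[OF bounded_bilinear_matrix_mult])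
  ultimately show ?thesis by (simp add: mult_ac)
qed

section \<open>Growth of the derivatives of the symbol\<close>

text \<open>A single exponent for \<open>t\<close> and \<open>\<xi>\<close> keeps sums and products of such bounds in the same form.\<close>

definition exp_growth :: "real \<Rightarrow> (real \<Rightarrow> real^'n::finite \<Rightarrow> 'b::real_normed_vector) \<Rightarrow> bool" where
  "exp_growth \<omega> F \<longleftrightarrow> (\<exists>C N. C \<ge> 0 \<and> (\<forall>t\<ge>0. \<forall>\<xi>. norm (F t \<xi>) \<le> C * ((1 + t) * (1 + norm \<xi>)) ^ N * exp (\<omega> * t)))"

lemma one_le_growth_base: "t \<ge> 0 \<Longrightarrow> 1 \<le> (1 + t) * (1 + norm \<xi>)"
  using mult_mono[of 1 "1 + t" 1 "1 + norm \<xi>"] by simp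

lemma exp_growth_add:
  assumes "exp_growth \<omega> F" "exp_growth \<omega> G"
  shows "exp_growth \<omega> (\<lambda>t \<xi>. F t \<xi> + G t \<xi>)"
proof -
  obtain B M where B: "B \<ge> 0" and M: "\<And>t \<xi>. t \<ge> 0 \<Longrightarrow> norm (F t \<xi>) \<le> B * ((1 + t) * (1 + norm \<xi>)) ^ M * exp (\<omega> * t)"
    using assms(1) unfolding exp_growth_def by blast
  obtain C N where C: "C \<ge> 0" and N: "\<And>t \<xi>. t \<ge> 0 \<Longrightarrow> norm (G t \<xi>) \<le> C * ((1 + t) * (1 + norm \<xi>)) ^ N * exp (\<omega> * t)"
    using assms(2) unfolding exp_growth_def by blast
  have "norm (F t \<xi> + G t \<xi>) \<le> (B + C) * ((1 + t) * (1 + norm \<xi>)) ^ (M + N) * exp (\<omega> * t)"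
    if t: "t \<ge> 0" for t \<xi>
  proof -
    let ?r = "(1 + t) * (1 + norm \<xi>)"
    have "norm (F t \<xi> + G t \<xi>) \<le> B * ?r ^ M * exp (\<omega> * t) + C * ?r ^ N * exp (\<omega> * t)"
      by (intro norm_triangle_le add_mono M N t)
    also have "\<dots> \<le> B * ?r ^ (M + N) * exp (\<omega> * t) + C * ?r ^ (M + N) * exp (\<omega> * t)"
      using one_le_growth_base[OF t, of \<xi>] B C
      by (intro add_mono mult_right_mono mult_left_mono power_increasing) auto
    finally show ?thesis by (simp add: distrib_right)
  qed
  then show ?thesis unfolding exp_growth_def using B C by (intro exI[of _ "B + C"] exI[of _ "M + N"]) auto
qed

lemma exp_growth_sum_list:
  "(\<And>a. a \<in> set as \<Longrightarrow> exp_growth \<omega> (F a)) \<Longrightarrow> exp_growth \<omega> (\<lambda>t \<xi>. \<Sum>a\<leftarrow>as. F a t \<xi>)"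
proof (induction as)
  case Nil
  show ?case unfolding exp_growth_def by (intro exI[of _ 0]) simp
next
  case (Cons a as)
  then show ?case using exp_growth_add[of \<omega> "F a"] by simp
qed

lemma exp_growth_bilinear:
  assumes p: "bounded_bilinear p" and g: "slow1 g" and F: "exp_growth \<omega> F"
  shows "exp_growth \<omega> (\<lambda>t \<xi>. p (g \<xi>) (F t \<xi>))"
proof -
  obtain K where K: "K \<ge> 0" "\<And>a b. norm (p a b) \<le> norm a * norm b * K"
    using bounded_bilinear.nonneg_bounded[OF p] by metis
  obtain B M where B: "B \<ge> 0" and M: "\<And>\<xi>. norm (g \<xi>) \<le> B * (1 + norm \<xi>) ^ M"
    by (rule slow_growth[OF g]) blast
  obtain C N where C: "C \<ge> 0" and N: "\<And>t \<xi>. t \<ge> 0 \<Longrightarrow> norm (F t \<xi>) \<le> C * ((1 + t) * (1 + norm \<xi>)) ^ N * exp (\<omega> * t)"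
    using F unfolding exp_growth_def by blast
  have "norm (p (g \<xi>) (F t \<xi>)) \<le> (B * C * K) * ((1 + t) * (1 + norm \<xi>)) ^ (M + N) * exp (\<omega> * t)"
    if t: "t \<ge> 0" for t \<xi>
  proof -
    let ?r = "(1 + t) * (1 + norm \<xi>)"
    have "B * (1 + norm \<xi>) ^ M \<le> B * ?r ^ M"
      using t B by (intro mult_left_mono power_mono) (auto simp: distrib_right)
    then have g: "norm (g \<xi>) \<le> B * ?r ^ M" using M order_trans by blast
    have "norm (p (g \<xi>) (F t \<xi>)) \<le> norm (g \<xi>) * norm (F t \<xi>) * K" by (rule K)
    also have "\<dots> \<le> (B * ?r ^ M) * (C * ?r ^ N * exp (\<omega> * t)) * K"
      using t B K by (intro mult_right_mono mult_mono g N) auto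
    finally show ?thesis by (simp add: power_add mult_ac)
  qed
  then show ?thesis unfolding exp_growth_def using B C K
    by (intro exI[of _ "B * C * K"] exI[of _ "M + N"]) auto
qed

lemma splits_remove_last:
  obtains as where "\<And>F :: 'n list \<times> 'n list \<Rightarrow> 'b::comm_monoid_add.
      (\<Sum>a\<leftarrow>splits \<alpha>. F a) = F ([], \<alpha>) + (\<Sum>a\<leftarrow>as. F a)"
    "\<And>a. a \<in> set as \<Longrightarrow> length (snd a) < length \<alpha>"
proof -
  have "\<exists>as. (\<forall>F :: 'n list \<times> 'n list \<Rightarrow> 'b. (\<Sum>a\<leftarrow>splits \<alpha>. F a) = F ([], \<alpha>) + (\<Sum>a\<leftarrow>as. F a))
      \<and> (\<forall>a\<in>set as. length (snd a) < length \<alpha>)"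
  proof (induction \<alpha>)
    case Nil
    show ?case by (intro exI[of _ "[]"]) auto
  next
    case (Cons i \<alpha>)
    then obtain as where as: "\<And>F :: 'n list \<times> 'n list \<Rightarrow> 'b.
        (\<Sum>a\<leftarrow>splits \<alpha>. F a) = F ([], \<alpha>) + (\<Sum>a\<leftarrow>as. F a)"
      "\<forall>a\<in>set as. length (snd a) < length \<alpha>" by blast
    let ?as = "map (\<lambda>(\<beta>, \<gamma>). (i # \<beta>, \<gamma>)) (splits \<alpha>) @ map (\<lambda>(\<beta>, \<gamma>). (\<beta>, i # \<gamma>)) as"
    have "(\<Sum>a\<leftarrow>splits (i # \<alpha>). F a) = F ([], i # \<alpha>) + (\<Sum>a\<leftarrow>?as. F a)" for F :: "'n list \<times> 'n list \<Rightarrow> 'b"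
      using as(1)[of "\<lambda>(\<beta>, \<gamma>). F (\<beta>, i # \<gamma>)"] by (simp add: o_def case_prod_unfold add_ac)
    moreover have "\<forall>a\<in>set ?as. length (snd a) < length (i # \<alpha>)"
      using as(2) splits_length[of _ \<alpha>] by (fastforce simp: case_prod_unfold)
    ultimately show ?case by blast
  qed
  with that show thesis by blast
qed

text \<open>By Leibniz' rule \<open>\<partial>\<^sup>\<alpha> A\<^sub>t\<close> solves the equation of \<open>A\<^sub>t\<close> with an inhomogeneity that involves only
  derivatives of lower order, so Duhamel's estimate bounds the derivatives by induction.\<close>

lemma symbol_derivatives_growth:
  fixes g :: "real^'n::finite \<Rightarrow> complex^'m::finite^'m" and A :: "real \<Rightarrow> real^'n \<Rightarrow> complex^'m^'m"
  assumes g: "slow1 g"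
    and spec: "\<And>z \<xi>. z \<in> spectrum (g \<xi>) \<Longrightarrow> Re z \<le> \<omega>"
    and smooth: "\<And>t. t \<ge> 0 \<Longrightarrow> smooth (A t)"
    and der: "\<And>\<alpha> t \<xi>. t \<ge> 0 \<Longrightarrow> ((\<lambda>t. mderiv \<alpha> (A t) \<xi>) has_vector_derivative
        mderiv \<alpha> (\<lambda>\<xi>. g \<xi> ** A t \<xi>) \<xi>) (at t within {0..})"
    and comm: "\<And>t \<xi>. t \<ge> 0 \<Longrightarrow> g \<xi> ** A t \<xi> = A t \<xi> ** g \<xi>"
    and A0: "\<And>\<xi>. A 0 \<xi> = mat 1"
  shows "exp_growth \<omega> (\<lambda>t \<xi>. mderiv \<alpha> (A t) \<xi>)"
proof -
  have E: "((\<lambda>t. A t \<xi>) has_vector_derivative g \<xi> ** A t \<xi>) (at t within {0..})" if "t \<ge> 0" for t \<xi>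
    using der[OF that, of "[]"] by simp
  have base: "exp_growth \<omega> A"
  proof -
    obtain K where K: "K \<ge> 0" "\<And>(B :: complex^'m^'m) v. norm (B *v v) \<le> norm B * norm v * K"
      using bounded_bilinear.nonneg_bounded[OF bounded_bilinear_matrix_vector_mult] by metis
    obtain B M where B: "B \<ge> 0" and M: "\<And>\<xi>. norm (g \<xi>) \<le> B * (1 + norm \<xi>) ^ M"
      by (rule slow_growth[OF g]) blast
    let ?d = "DIM(complex^'m)" and ?m = "real CARD('m)"
    let ?C = "?m * ?m * (1 + 2 * K * B) ^ ?d"
    have "norm (A t \<xi>) \<le> ?C * ((1 + t) * (1 + norm \<xi>)) ^ (?d + M * ?d) * exp (\<omega> * t)"
      if t: "t \<ge> 0" for t \<xi>
    proof -
      have "1 + 2 * K * norm (g \<xi>) \<le> 1 * (1 + norm \<xi>) ^ M + 2 * K * (B * (1 + norm \<xi>) ^ M)"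
        using K M by (intro add_mono mult_left_mono) auto
      also have "\<dots> = (1 + 2 * K * B) * (1 + norm \<xi>) ^ M" by (simp add: algebra_simps)
      finally have "(1 + 2 * K * norm (g \<xi>)) ^ ?d \<le> ((1 + 2 * K * B) * (1 + norm \<xi>) ^ M) ^ ?d"
        using K by (intro power_mono) auto
      then have P: "(1 + 2 * K * norm (g \<xi>)) ^ ?d \<le> (1 + 2 * K * B) ^ ?d * (1 + norm \<xi>) ^ (M * ?d)"
        by (simp add: power_mult_distrib power_mult)
      have "norm (A t \<xi>) \<le> ?m * (?m * (exp (\<omega> * t) * (1 + t) ^ ?d * (1 + 2 * K * norm (g \<xi>)) ^ ?d))"
        by (rule matrix_semigroup_growth[OF K spec E comm A0 t])
      also have "\<dots> \<le> ?m * (?m * (exp (\<omega> * t) * (1 + t) ^ ?d * ((1 + 2 * K * B) ^ ?d * (1 + norm \<xi>) ^ (M * ?d))))"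
        using t by (intro mult_left_mono P) auto
      also have "\<dots> = ?C * ((1 + t) ^ ?d * (1 + norm \<xi>) ^ (M * ?d)) * exp (\<omega> * t)" by (simp add: mult_ac)
      also have "\<dots> \<le> ?C * ((1 + t) ^ (?d + M * ?d) * (1 + norm \<xi>) ^ (?d + M * ?d)) * exp (\<omega> * t)"
        using t K B by (intro mult_right_mono mult_left_mono mult_mono power_increasing) auto
      finally show ?thesis by (simp add: power_mult_distrib)
    qed
    moreover have "?C \<ge> 0" using K B by auto
    ultimately show ?thesis unfolding exp_growth_def by blast
  qed
  obtain K where K: "K \<ge> 0" "\<And>(B :: complex^'m^'m) (C :: complex^'m^'m). norm (B ** C) \<le> norm B * norm C * K"
    using bounded_bilinear.nonneg_bounded[OF bounded_bilinear_matrix_mult] by metis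
  show ?thesis
  proof (induction "length \<alpha>" arbitrary: \<alpha> rule: less_induct)
    case less
    show ?case
    proof (cases "\<alpha> = []")
      case True
      then show ?thesis using base by simp
    next
      case False
      obtain as where as: "\<And>F :: 'n list \<times> 'n list \<Rightarrow> complex^'m^'m.
          (\<Sum>a\<leftarrow>splits \<alpha>. F a) = F ([], \<alpha>) + (\<Sum>a\<leftarrow>as. F a)"
        "\<And>a. a \<in> set as \<Longrightarrow> length (snd a) < length \<alpha>"
        by (rule splits_remove_last[of \<alpha>]) blast
      define f where "f t \<xi> = (\<Sum>a\<leftarrow>as. mderiv (fst a) g \<xi> ** mderiv (snd a) (A t) \<xi>)" for t \<xi>
      have leibniz: "mderiv \<alpha> (\<lambda>\<xi>. g \<xi> ** A t \<xi>) \<xi> = g \<xi> ** mderiv \<alpha> (A t) \<xi> + f t \<xi>"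
        if t: "t \<ge> 0" for t \<xi>
        unfolding mderiv_bilinear[OF bounded_bilinear_matrix_mult smooth_diff_order[OF slow_smooth[OF g]]
            smooth_diff_order[OF smooth[OF t]] order_refl] f_def case_prod_unfold as(1) by simp
      have slow_mderiv: "slow1 (mderiv \<beta> g)" for \<beta>
        by (induction \<beta>) (auto intro: g slow_partial)
      have "exp_growth \<omega> f"
        unfolding f_def
        by (intro exp_growth_sum_list exp_growth_bilinear[OF bounded_bilinear_matrix_mult slow_mderiv] less as(2))
      then obtain D N where D: "D \<ge> 0" and
        N: "\<And>t \<xi>. t \<ge> 0 \<Longrightarrow> norm (f t \<xi>) \<le> D * ((1 + t) * (1 + norm \<xi>)) ^ N * exp (\<omega> * t)"
        unfolding exp_growth_def by blast
      obtain B M where B: "B \<ge> 0" and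
        M: "\<And>t \<xi>. t \<ge> 0 \<Longrightarrow> norm (A t \<xi>) \<le> B * ((1 + t) * (1 + norm \<xi>)) ^ M * exp (\<omega> * t)"
        using base unfolding exp_growth_def by blast
      have "norm (mderiv \<alpha> (A t) \<xi>) \<le> (K * B * D) * ((1 + t) * (1 + norm \<xi>)) ^ (M + N + 1) * exp (\<omega> * t)"
        if t: "t \<ge> 0" for t \<xi>
      proof -
        let ?r = "(1 + t) * (1 + norm \<xi>)"
        have mono: "c * ((1 + s) * (1 + norm \<xi>)) ^ k * exp (\<omega> * s) \<le> c * ?r ^ k * exp (\<omega> * s)"
          if "c \<ge> 0" "s \<in> {0..t}" for c k s
          using that by (intro mult_right_mono mult_left_mono power_mono) auto
        have "A 0 = (\<lambda>\<xi>. mat 1)" using A0 by blast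
        then have u0: "mderiv \<alpha> (A 0) \<xi> = 0" using False by (simp add: mderiv_const)
        have "norm (mderiv \<alpha> (A t) \<xi>) \<le> K * (B * ?r ^ M) * (D * ?r ^ N) * t * exp (\<omega> * t)"
        proof (rule duhamel_bound[where E = "\<lambda>t. A t \<xi>" and A = "g \<xi>" and f = "\<lambda>t. f t \<xi>"
            and u = "\<lambda>t. mderiv \<alpha> (A t) \<xi>", OF K E comm A0 _ u0 _ _ _ t])
          show "((\<lambda>t. mderiv \<alpha> (A t) \<xi>) has_vector_derivative g \<xi> ** mderiv \<alpha> (A s) \<xi> + f s \<xi>) (at s within {0..})"
            if "s \<ge> 0" for s
            using der[OF that, of \<alpha> \<xi>] by (simp add: leibniz[OF that])
          show "B * ?r ^ M \<ge> 0" using B t by simp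
          show "norm (A s \<xi>) \<le> B * ?r ^ M * exp (\<omega> * s)" if "s \<in> {0..t}" for s
            using that by (intro order_trans[OF M mono[OF B that]]) auto
          show "norm (f s \<xi>) \<le> D * ?r ^ N * exp (\<omega> * s)" if "s \<in> {0..t}" for s
            using that by (intro order_trans[OF N mono[OF D that]]) auto
        qed
        also have "\<dots> = (K * B * D * ?r ^ (M + N) * exp (\<omega> * t)) * t" by (simp add: power_add mult_ac)
        also have "\<dots> \<le> (K * B * D * ?r ^ (M + N) * exp (\<omega> * t)) * ?r"
        proof (rule mult_left_mono)
          have "(1 + t) * 1 \<le> ?r" using t by (intro mult_left_mono) auto
          then show "t \<le> ?r" by (rule order_trans[rotated]) simp
        qed (use K B D t in auto)
        finally show ?thesis by (simp add: mult_ac)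
      qed
      then show ?thesis unfolding exp_growth_def using K B D
        by (intro exI[of _ "K * B * D"] exI[of _ "M + N + 1"]) auto
    qed
  qed
qed

lemma power_le_exp:
  assumes "\<delta> > 0"
  obtains C where "C \<ge> 0" "\<And>t::real. t \<ge> 0 \<Longrightarrow> (1 + t) ^ N \<le> C * exp (\<delta> * t)"
proof (rule that)
  show "0 \<le> max 1 (real N / \<delta>) ^ N * exp \<delta>" by simp
  fix t :: real assume t: "t \<ge> 0"
  show "(1 + t) ^ N \<le> max 1 (real N / \<delta>) ^ N * exp \<delta> * exp (\<delta> * t)"
  proof (cases "N = 0")
    case False
    let ?x = "\<delta> * (1 + t) / N"
    have "?x \<le> exp ?x" using exp_ge_add_one_self[of ?x] by linarith
    then have "1 + t \<le> real N / \<delta> * exp ?x" using False assms by (simp add: field_simps)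
    also have "\<dots> \<le> max 1 (real N / \<delta>) * exp ?x" by (intro mult_right_mono) auto
    finally have "(1 + t) ^ N \<le> (max 1 (real N / \<delta>) * exp ?x) ^ N" using t by (intro power_mono) auto
    also have "\<dots> = max 1 (real N / \<delta>) ^ N * exp (\<delta> * (1 + t))"
      using False by (simp add: power_mult_distrib flip: exp_of_nat_mult)
    finally show ?thesis by (simp add: distrib_left exp_add mult_ac)
  qed (use assms t in \<open>simp flip: exp_add\<close>)
qed

section \<open>Convergence in the topology of rapidly decreasing distributions\<close>

text \<open>Singletons are compact, so the compact-open topology refines pointwise convergence.\<close>

lemma openin_OC_ball:
  fixes \<phi> \<psi> :: "real^'n::finite \<Rightarrow> complex"
  assumes phi: "\<phi> \<in> schwartz" and psi: "\<psi> \<in> schwartz" and e: "\<epsilon> > 0"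
  shows "openin OC_topology {T \<in> OC. restrict (conv_fun T) schwartz \<in> schwartz_ops (*) \<and>
    schwartz_seminorm k \<alpha> (\<lambda>x. conv_fun T \<phi> x - \<psi> x) < \<epsilon> \<and> conv_fun T \<phi> \<in> schwartz}" (is "openin _ ?S")
proof -
  let ?V = "{g \<in> schwartz. schwartz_seminorm k \<alpha> (\<lambda>x. g x - \<psi> x) < \<epsilon>}"
  let ?U = "{u. continuous_map schwartz_topology schwartz_topology u \<and> u ` {\<phi>} \<subseteq> ?V}"
  have "compactin schwartz_topology {\<phi>}" using phi by simp
  moreover have "openin schwartz_topology ?V" by (rule openin_seminorm_ball[OF psi e])
  ultimately have "openin (compact_open_topology schwartz_topology schwartz_topology) ?U"
    unfolding compact_open_topology_def by (intro topology_generated_by_Basis) blast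
  then have "openin (subtopology (compact_open_topology schwartz_topology schwartz_topology) (schwartz_ops (*)))
      (?U \<inter> schwartz_ops (*))"
    unfolding openin_subtopology by blast
  then have "openin OC_topology ((\<lambda>T. restrict (conv_fun T) schwartz) -` (?U \<inter> schwartz_ops (*)) \<inter> OC)"
    unfolding OC_topology_def openin_pullback_topology by blast
  moreover have "(\<lambda>T. restrict (conv_fun T) schwartz) -` (?U \<inter> schwartz_ops (*)) \<inter> OC = ?S"
    using phi by (auto simp: schwartz_ops_def)
  ultimately show ?thesis by simp
qed

lemma topspace_OC_topology:
  "T \<in> topspace OC_topology \<Longrightarrow> T \<in> OC \<and> restrict (conv_fun T) schwartz \<in> schwartz_ops (*)"
  unfolding OC_topology_def topspace_pullback_topology by auto

lemma limitin_OC_mat: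
  assumes "limitin OC_mat_topology Q D F"
  shows "limitin OC_topology (\<lambda>s. Q s $ i $ j) (D $ i $ j) F"
proof -
  let ?f = "\<lambda>(A :: ('a, 'b) mfunctional) (i, j). A $ i $ j"
  let ?P = "product_topology (\<lambda>_ :: 'b \<times> 'b. OC_topology :: 'a functional topology) UNIV"
  have D: "?f D \<in> topspace ?P" "D \<in> OC_mat"
    using limitin_topspace[OF assms] unfolding OC_mat_topology_def topspace_pullback_topology by auto
  show ?thesis
    unfolding limitin_def
  proof (intro conjI allI impI)
    show "D $ i $ j \<in> topspace OC_topology" using D(1) by (auto simp: topspace_product_topology PiE_iff)
    fix W assume W: "openin OC_topology W \<and> D $ i $ j \<in> W"
    have "openin ?P {h \<in> topspace ?P. h (i, j) \<in> W}"
      using continuous_map_product_projection[of "(i, j)" UNIV "\<lambda>_. OC_topology"] W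
      by (auto simp: continuous_map_def)
    then have "openin OC_mat_topology (?f -` {h \<in> topspace ?P. h (i, j) \<in> W} \<inter> OC_mat)"
      unfolding OC_mat_topology_def openin_pullback_topology by blast
    moreover have "D \<in> ?f -` {h \<in> topspace ?P. h (i, j) \<in> W} \<inter> OC_mat" using D W by auto
    ultimately have "eventually (\<lambda>s. Q s \<in> ?f -` {h \<in> topspace ?P. h (i, j) \<in> W} \<inter> OC_mat) F"
      using assms unfolding limitin_def by blast
    then show "eventually (\<lambda>s. Q s $ i $ j \<in> W) F"
      by (rule eventually_mono) auto
  qed
qed

lemma limitin_OC_conv_fun:
  assumes lim: "limitin OC_topology Q D F" and phi: "\<phi> \<in> schwartz"
  shows "((\<lambda>s. schwartz_norm M (\<lambda>x. conv_fun (Q s) \<phi> x - conv_fun D \<phi> x)) \<longlongrightarrow> 0) F"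
proof -
  have D: "D \<in> OC" "restrict (conv_fun D) schwartz \<in> schwartz_ops (*)"
    using topspace_OC_topology[OF limitin_topspace[OF lim]] by auto
  note Ds = schwartz_conv_fun[OF has_symbol_OC[OF D(1)] phi]
  have "((\<lambda>s. schwartz_seminorm k \<alpha> (\<lambda>x. conv_fun (Q s) \<phi> x - conv_fun D \<phi> x)) \<longlongrightarrow> 0) F" for k \<alpha>
  proof (rule tendstoI)
    fix e :: real assume e: "e > 0"
    let ?S = "{T \<in> OC. restrict (conv_fun T) schwartz \<in> schwartz_ops (*) \<and>
      schwartz_seminorm k \<alpha> (\<lambda>x. conv_fun T \<phi> x - conv_fun D \<phi> x) < e \<and> conv_fun T \<phi> \<in> schwartz}"
    have "openin OC_topology ?S" by (rule openin_OC_ball[OF phi Ds e])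
    moreover have "D \<in> ?S" using D Ds e by (simp add: seminorm_zero)
    ultimately have "eventually (\<lambda>s. Q s \<in> ?S) F" using lim unfolding limitin_def by blast
    then show "eventually (\<lambda>s. dist (schwartz_seminorm k \<alpha> (\<lambda>x. conv_fun (Q s) \<phi> x - conv_fun D \<phi> x)) 0 < e) F"
    proof (rule eventually_mono)
      fix s assume s: "Q s \<in> ?S"
      then have "0 \<le> schwartz_seminorm k \<alpha> (\<lambda>x. conv_fun (Q s) \<phi> x - conv_fun D \<phi> x)"
        by (intro seminorm_nonneg schwartz_diff Ds) auto
      with s show "dist (schwartz_seminorm k \<alpha> (\<lambda>x. conv_fun (Q s) \<phi> x - conv_fun D \<phi> x)) 0 < e"
        by (auto simp: dist_real_def)
    qed
  qed
  then show ?thesis unfolding schwartz_norm_def by (intro tendsto_null_sum) auto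
qed

lemma tendsto_sum_list_zero:
  fixes f :: "'a \<Rightarrow> 's \<Rightarrow> 'b::real_normed_vector"
  shows "(\<And>a. a \<in> set as \<Longrightarrow> ((\<lambda>s. f a s) \<longlongrightarrow> 0) F) \<Longrightarrow> ((\<lambda>s. \<Sum>a\<leftarrow>as. f a s) \<longlongrightarrow> 0) F"
  by (induction as) (auto intro: tendsto_add_zero)

text \<open>Convergence of the symbols: \<open>T\<^sub>s * \<gamma>\<close> converges in the Schwartz space for the Gaussian \<open>\<gamma>\<close>, hence so
  does its Fourier transform, which is the symbol times a multiple of \<open>\<gamma>\<close>; and \<open>\<gamma>\<close> can be cancelled
  because \<open>1 / \<gamma>\<close> is smooth.\<close>

lemma limitin_OC_symbol:
  fixes D :: "'n::finite functional"
  assumes lim: "limitin OC_topology Q D F" and Q: "eventually (\<lambda>s. has_symbol (Q s) (q s)) F"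
    and D: "has_symbol D d"
  shows "((\<lambda>s. mderiv \<alpha> (q s) \<xi>) \<longlongrightarrow> mderiv \<alpha> d \<xi>) F"
proof -
  let ?c = "gauss_integral TYPE('n)"
  let ?\<psi> = "\<lambda>s x. conv_fun (Q s) gauss x - conv_fun D gauss x"
  let ?r = "\<lambda>s \<xi>. (q s \<xi> - d \<xi>) * gauss \<xi>"
  have psi: "?\<psi> s \<in> schwartz" if "has_symbol (Q s) (q s)" for s
    by (intro schwartz_diff schwartz_conv_fun[OF that] schwartz_conv_fun[OF D] schwartz_gauss)
  have r: "?r s = (\<lambda>\<xi>. (1 / ?c) * fourier (?\<psi> s) \<xi>)" if s: "has_symbol (Q s) (q s)" for s
  proof
    fix \<xi>
    have "fourier (?\<psi> s) \<xi> = fourier (\<lambda>x. conv_fun (Q s) gauss x + (-1) * conv_fun D gauss x) \<xi>" by simp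
    also have "\<dots> = fourier (conv_fun (Q s) gauss) \<xi> + (-1) * fourier (conv_fun D gauss) \<xi>"
      unfolding fourier_cmult[symmetric]
      by (intro fourier_add schwartz_decaying schwartz_linear[OF bounded_linear_mult_right]
          schwartz_conv_fun[OF s] schwartz_conv_fun[OF D] schwartz_gauss)
    also have "\<dots> = ?c * ?r s \<xi>"
      by (simp add: fourier_conv_fun[OF s schwartz_gauss] fourier_conv_fun[OF D schwartz_gauss]
          fourier_gauss algebra_simps)
    finally show "?r s \<xi> = (1 / ?c) * fourier (?\<psi> s) \<xi>" by (simp add: gauss_integral_nonzero)
  qed
  have t: "tame {()} (\<lambda>_ \<phi> \<xi>. (1 / ?c) * fourier \<phi> \<xi>)"
    by (rule tame_compose[OF tame_linear[OF bounded_linear_mult_right] tame_fourier])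
  have lim_r: "((\<lambda>s. mderiv \<beta> (?r s) \<xi>) \<longlongrightarrow> 0) F" for \<beta>
  proof -
    obtain C M where C: "C \<ge> 0" and M: "\<And>i \<phi> x. i \<in> {()} \<Longrightarrow> \<phi> \<in> schwartz \<Longrightarrow>
        (1 + norm x) ^ 0 * norm (mderiv \<beta> (\<lambda>\<xi>. (1 / ?c) * fourier \<phi> \<xi>) x) \<le> C * schwartz_norm M \<phi>"
      by (rule tame_bound[OF t, of 0 \<beta>]) blast
    have "eventually (\<lambda>s. norm (mderiv \<beta> (?r s) \<xi>) \<le> C * schwartz_norm M (?\<psi> s)) F"
      using Q
    proof (rule eventually_mono)
      fix s assume s: "has_symbol (Q s) (q s)"
      show "norm (mderiv \<beta> (?r s) \<xi>) \<le> C * schwartz_norm M (?\<psi> s)"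
        unfolding r[OF s] using M[OF _ psi[OF s], of "()" \<xi>] by simp
    qed
    moreover have "((\<lambda>s. C * schwartz_norm M (?\<psi> s)) \<longlongrightarrow> C * 0) F"
      by (intro tendsto_intros limitin_OC_conv_fun lim schwartz_gauss)
    ultimately show ?thesis unfolding mult_zero_right by (rule Lim_null_comparison)
  qed
  have "((\<lambda>s. \<Sum>a\<leftarrow>splits \<alpha>. mderiv (fst a) (?r s) \<xi> * mderiv (snd a) inverse_gauss \<xi>) \<longlongrightarrow> 0) F"
    by (intro tendsto_sum_list_zero tendsto_mult_left_zero lim_r)
  moreover have "eventually (\<lambda>s. (\<Sum>a\<leftarrow>splits \<alpha>. mderiv (fst a) (?r s) \<xi> * mderiv (snd a) inverse_gauss \<xi>)
      = mderiv \<alpha> (q s) \<xi> - mderiv \<alpha> d \<xi>) F"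
    using Q
  proof (rule eventually_mono)
    fix s assume s: "has_symbol (Q s) (q s)"
    have sm: "smooth (q s)" "smooth d"
      using s D by (auto simp: has_symbol_def intro: slow_smooth)
    have sr: "smooth (?r s)"
      unfolding r[OF s] by (rule schwartz_smooth[OF schwartz_operator[OF t psi[OF s]]])
    have "(\<Sum>a\<leftarrow>splits \<alpha>. mderiv (fst a) (?r s) \<xi> * mderiv (snd a) inverse_gauss \<xi>)
        = mderiv \<alpha> (\<lambda>\<xi>. ?r s \<xi> * inverse_gauss \<xi>) \<xi>"
      unfolding mderiv_bilinear[OF bounded_bilinear_mult smooth_diff_order[OF sr]
          smooth_diff_order[OF smooth_inverse_gauss] order_refl] by (simp only: case_prod_unfold)
    also have "(\<lambda>\<xi>. ?r s \<xi> * inverse_gauss \<xi>) = (\<lambda>\<xi>. q s \<xi> + - d \<xi>)"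
      by (simp add: mult.assoc gauss_inverse_gauss)
    also have "mderiv \<alpha> \<dots> \<xi> = mderiv \<alpha> (q s) \<xi> - mderiv \<alpha> d \<xi>"
      using mderiv_add[OF smooth_diff_order[OF sm(1)] smooth_diff_order[OF smooth_linear[OF
          bounded_linear_minus[OF bounded_linear_ident] sm(2)]] order_refl, of \<alpha>]
        mderiv_linear[OF bounded_linear_minus[OF bounded_linear_ident] smooth_diff_order[OF sm(2)] order_refl, of \<alpha>]
      by simp
    finally show "(\<Sum>a\<leftarrow>splits \<alpha>. mderiv (fst a) (?r s) \<xi> * mderiv (snd a) inverse_gauss \<xi>)
      = mderiv \<alpha> (q s) \<xi> - mderiv \<alpha> d \<xi>" .
  qed
  ultimately have "((\<lambda>s. mderiv \<alpha> (q s) \<xi> - mderiv \<alpha> d \<xi>) \<longlongrightarrow> 0) F"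
    by (rule Lim_transform_eventually)
  then show ?thesis by (simp add: LIM_zero_iff)
qed

section \<open>The symbol of a convolution semigroup\<close>

lemma has_vector_derivative_vec:
  fixes f :: "real \<Rightarrow> 'b::real_normed_vector^'m::finite"
  assumes "\<And>i. ((\<lambda>t. f t $ i) has_vector_derivative D $ i) (at t within S)"
  shows "(f has_vector_derivative D) (at t within S)"
  unfolding has_vector_derivative_iff_tendsto
  by (rule vec_tendstoI) (use assms in \<open>simp add: has_vector_derivative_iff_tendsto\<close>)

lemma mat_symbol_nth: "mat_symbol A \<xi> $ i $ j = fourier_symbol (A $ i $ j) \<xi>"
  by (simp add: mat_symbol_def)

lemma smooth_mat_symbol:
  assumes "A \<in> OC_mat" shows "smooth (mat_symbol A)"
proof -
  have "smooth (fourier_symbol (A $ i $ j))" for i j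
    by (rule slow_smooth[OF has_symbol_slow[OF has_symbol_OC]]) (use assms in \<open>simp add: OC_mat_def\<close>)
  then show ?thesis by (intro smooth_vec) (simp add: mat_symbol_nth)
qed

lemma slow_vec:
  fixes f :: "real^'n::finite \<Rightarrow> ('b::euclidean_space)^'m::finite"
  assumes "\<And>i. slow1 (\<lambda>x. f x $ i)"
  shows "slow1 f"
proof -
  have "slow1 (\<lambda>x. \<Sum>i\<in>UNIV. axis i (f x $ i))"
    by (rule slow_sum, rule slow_linear[OF bounded_linear_axis assms])
  then show ?thesis by (simp flip: vec_eq_sum_axis)
qed

lemma slow_mat_symbol:
  assumes "A \<in> OC_mat" shows "slow1 (mat_symbol A)"
proof -
  have "slow1 (fourier_symbol (A $ i $ j))" for i j
    by (rule has_symbol_slow[OF has_symbol_OC]) (use assms in \<open>simp add: OC_mat_def\<close>)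
  then show ?thesis by (intro slow_vec) (simp add: mat_symbol_nth)
qed

lemma mderiv_mat_symbol:
  assumes "A \<in> OC_mat"
  shows "mderiv \<alpha> (mat_symbol A) \<xi> $ i $ j = mderiv \<alpha> (fourier_symbol (A $ i $ j)) \<xi>"
proof -
  note s = smooth_mat_symbol[OF assms]
  have "mderiv \<alpha> (\<lambda>\<xi>. mat_symbol A \<xi> $ i $ j) = (\<lambda>\<xi>. mderiv \<alpha> (\<lambda>\<xi>. mat_symbol A \<xi> $ i) \<xi> $ j)"
    by (rule mderiv_vec_nth[OF smooth_linear[OF bounded_linear_vec_nth s]])
  also have "\<dots> = (\<lambda>\<xi>. mderiv \<alpha> (mat_symbol A) \<xi> $ i $ j)"
    by (simp only: mderiv_vec_nth[OF s])
  finally show ?thesis by (simp add: mat_symbol_nth fun_eq_iff)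
qed

text \<open>The difference quotients of \<open>S\<close> have the difference quotients of the symbols as their symbols.\<close>

lemma idcs_symbol_derivative:
  fixes S :: "real \<Rightarrow> ('n::finite, 'm::finite) mfunctional"
  assumes S: "idcs S" and t: "t \<ge> 0" and D: "has_OC_deriv S D t"
  shows "D \<in> OC_mat" and "((\<lambda>s. mderiv \<alpha> (mat_symbol (S s)) \<xi>) has_vector_derivative
    mderiv \<alpha> (mat_symbol D) \<xi>) (at t within {0..})"
proof -
  have OC: "S s $ i $ j \<in> OC" "S s \<in> OC_mat" if "s \<ge> 0" for s i j
    using S that by (auto simp: idcs_def OC_mat_def)
  let ?Q = "\<lambda>s. mat_scale (1 / (s - t)) (mat_diff (S s) (S t))"
  have lim: "limitin OC_topology (\<lambda>s. ?Q s $ i $ j) (D $ i $ j) (at t within {0..})" for i j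
    using D unfolding has_OC_deriv_def by (rule limitin_OC_mat)
  have DOC: "D $ i $ j \<in> OC" for i j using topspace_OC_topology[OF limitin_topspace[OF lim]] by blast
  then show D': "D \<in> OC_mat" by (simp add: OC_mat_def)
  have sc: "mderiv \<alpha> (\<lambda>\<xi>. c * (f \<xi> - g \<xi>)) \<xi> = c * (mderiv \<alpha> f \<xi> - mderiv \<alpha> g \<xi>)"
    if "smooth f" "smooth g" for c \<xi> and f g :: "real^'n \<Rightarrow> complex"
  proof -
    have "smooth (\<lambda>\<xi>. - g \<xi>)" by (rule smooth_linear[OF bounded_linear_minus[OF bounded_linear_ident] that(2)])
    from smooth_add[OF that(1) this] mderiv_add[OF smooth_diff_order[OF that(1)] smooth_diff_order[OF this] order_refl, of \<alpha>]
    show ?thesis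
      using mderiv_linear[OF bounded_linear_mult_right smooth_diff_order order_refl, of "\<lambda>\<xi>. f \<xi> + - g \<xi>" \<alpha> c]
        mderiv_linear[OF bounded_linear_minus[OF bounded_linear_ident] smooth_diff_order[OF that(2)] order_refl, of \<alpha>]
      by simp
  qed
  have "((\<lambda>s. mderiv \<alpha> (fourier_symbol (S s $ i $ j)) \<xi>) has_vector_derivative
      mderiv \<alpha> (fourier_symbol (D $ i $ j)) \<xi>) (at t within {0..})" for i j
  proof -
    let ?a = "\<lambda>s. fourier_symbol (S s $ i $ j)"
    have sym: "has_symbol (S s $ i $ j) (?a s)" if "s \<ge> 0" for s by (rule has_symbol_OC[OF OC(1)[OF that]])
    have pos: "eventually (\<lambda>s. s \<ge> 0) (at t within {0..})" by (simp add: eventually_at_filter)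
    then have ev: "eventually (\<lambda>s. has_symbol (?Q s $ i $ j) (\<lambda>\<xi>. of_real (1 / (s - t)) * (?a s \<xi> - ?a t \<xi>))) (at t within {0..})"
    proof (rule eventually_mono)
      fix s :: real assume s: "s \<ge> 0"
      show "has_symbol (?Q s $ i $ j) (\<lambda>\<xi>. of_real (1 / (s - t)) * (?a s \<xi> - ?a t \<xi>))"
        using has_symbol_scaled_diff[OF sym[OF s] sym[OF t], of "of_real (1 / (s - t))"]
        by (simp add: mat_scale_def mat_diff_def)
    qed
    have "((\<lambda>s. mderiv \<alpha> (\<lambda>\<xi>. of_real (1 / (s - t)) * (?a s \<xi> - ?a t \<xi>)) \<xi>) \<longlongrightarrow>
        mderiv \<alpha> (fourier_symbol (D $ i $ j)) \<xi>) (at t within {0..})"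
      by (rule limitin_OC_symbol[OF lim ev has_symbol_OC[OF DOC]])
    moreover have "eventually (\<lambda>s. mderiv \<alpha> (\<lambda>\<xi>. of_real (1 / (s - t)) * (?a s \<xi> - ?a t \<xi>)) \<xi>
        = (mderiv \<alpha> (?a s) \<xi> - mderiv \<alpha> (?a t) \<xi>) /\<^sub>R (s - t)) (at t within {0..})"
      using pos
    proof (rule eventually_mono)
      fix s :: real assume s: "s \<ge> 0"
      show "mderiv \<alpha> (\<lambda>\<xi>. of_real (1 / (s - t)) * (?a s \<xi> - ?a t \<xi>)) \<xi>
          = (mderiv \<alpha> (?a s) \<xi> - mderiv \<alpha> (?a t) \<xi>) /\<^sub>R (s - t)"
        unfolding sc[OF slow_smooth[OF has_symbol_slow[OF sym[OF s]]] slow_smooth[OF has_symbol_slow[OF sym[OF t]]]]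
        by (simp add: scaleR_conv_of_real inverse_eq_divide)
    qed
    ultimately show ?thesis
      unfolding has_vector_derivative_iff_tendsto by (rule Lim_transform_eventually)
  qed
  then have "((\<lambda>s. mderiv \<alpha> (mat_symbol (S s)) \<xi> $ i $ j) has_vector_derivative
      mderiv \<alpha> (mat_symbol D) \<xi> $ i $ j) (at t within {0..})" for i j
    unfolding mderiv_mat_symbol[OF D']
    by (rule has_vector_derivative_transform[rotated 2]) (use t OC in \<open>auto simp: mderiv_mat_symbol\<close>)
  then show "((\<lambda>s. mderiv \<alpha> (mat_symbol (S s)) \<xi>) has_vector_derivative
    mderiv \<alpha> (mat_symbol D) \<xi>) (at t within {0..})"
    by (intro has_vector_derivative_vec)
qed

lemma idcs_symbol_semigroup:
  assumes S: "idcs S" and st: "s \<ge> 0" "t \<ge> 0"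
  shows "mat_symbol (S (s + t)) \<xi> = mat_symbol (S s) \<xi> ** mat_symbol (S t) \<xi>"
proof -
  have OC: "S s $ i $ j \<in> OC" if "s \<ge> 0" for s i j
    using S that by (auto simp: idcs_def OC_mat_def)
  have "fourier_symbol (S (s + t) $ i $ k)
      = (\<lambda>\<xi>. \<Sum>j\<in>UNIV. fourier_symbol (S s $ i $ j) \<xi> * fourier_symbol (S t $ j $ k) \<xi>)" for i k
  proof (rule fourier_symbol_eqI)
    have "S (s + t) $ i $ k = (\<lambda>\<phi>. \<Sum>j\<in>UNIV. conv_dist (S s $ i $ j) (S t $ j $ k) \<phi>)"
      using S st by (simp add: idcs_def mat_conv_def)
    then show "has_symbol (S (s + t) $ i $ k)
        (\<lambda>\<xi>. \<Sum>j\<in>UNIV. fourier_symbol (S s $ i $ j) \<xi> * fourier_symbol (S t $ j $ k) \<xi>)"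
      by (simp only: has_symbol_sum has_symbol_conv_dist has_symbol_OC OC st)
  qed
  then show ?thesis by (simp add: vec_eq_iff mat_symbol_nth matrix_matrix_mult_def)
qed

lemma idcs_symbol_0:
  assumes "idcs S" shows "mat_symbol (S 0) \<xi> = mat 1"
proof -
  have "fourier_symbol (S 0 $ i $ j) = (\<lambda>\<xi>. if i = j then 1 else 0)" for i j
    using assms has_symbol_delta has_symbol_zero
    by (intro fourier_symbol_eqI) (auto simp: idcs_def mat_delta_def)
  then show ?thesis by (simp add: vec_eq_iff mat_symbol_nth mat_def)
qed

lemma has_vector_derivative_shift:
  fixes f :: "real \<Rightarrow> 'b::real_normed_vector"
  assumes "(f has_vector_derivative D) (at t within {0..})" "t \<ge> 0"
  shows "((\<lambda>h. f (t + h)) has_vector_derivative D) (at 0 within {0..})"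
proof -
  have "((\<lambda>h. t + h) has_vector_derivative 1) (at 0 within {0..})"
    by (auto intro!: derivative_eq_intros)
  moreover have "(f has_vector_derivative D) (at (t + 0) within (\<lambda>h. t + h) ` {0..})"
    using has_vector_derivative_within_subset[OF assms(1), of "(\<lambda>h. t + h) ` {0..}"] assms(2) by auto
  ultimately show ?thesis using vector_diff_chain_within[of "\<lambda>h. t + h" 1 0 "{0..}" f D] by (simp add: o_def)
qed

text \<open>The derivative at \<open>t\<close> is determined from the right, where the semigroup law expresses \<open>S\<^bsub>t + h\<^esub>\<close> by \<open>S\<^sub>h\<close> and
  \<open>S\<^sub>t\<close> in either order; comparison of the two results also shows that the factors commute.\<close>

lemma idcs_symbol_equation:
  fixes S :: "real \<Rightarrow> ('n::finite, 'm::finite) mfunctional"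
  assumes S: "idcs S" and G: "generating_distribution S G" and t: "t \<ge> 0"
  shows "((\<lambda>s. mderiv \<alpha> (mat_symbol (S s)) \<xi>) has_vector_derivative
      mderiv \<alpha> (\<lambda>\<xi>. mat_symbol G \<xi> ** mat_symbol (S t) \<xi>) \<xi>) (at t within {0..})"
    and "mat_symbol G \<xi> ** mat_symbol (S t) \<xi> = mat_symbol (S t) \<xi> ** mat_symbol G \<xi>"
proof -
  obtain D where D: "has_OC_deriv S D t"
    using S t unfolding idcs_def OC_smooth_def by metis
  have G0: "((\<lambda>s. mat_symbol (S s) \<xi>) has_vector_derivative mat_symbol G \<xi>) (at 0 within {0..})" for \<xi>
    using idcs_symbol_derivative(2)[OF S order_refl, of G "[]"] G by (simp add: generating_distribution_def)
  have D0: "((\<lambda>h. mat_symbol (S (t + h)) \<xi>) has_vector_derivative mat_symbol D \<xi>) (at 0 within {0..})" for \<xi>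
    using idcs_symbol_derivative(2)[OF S t D, of "[]"] by (intro has_vector_derivative_shift t) simp
  have ne: "at 0 within {0::real..} \<noteq> bot" by (simp add: at_within_Ici_at_right)
  have L: "mat_symbol D \<xi> = mat_symbol G \<xi> ** mat_symbol (S t) \<xi>" for \<xi>
  proof (rule vector_derivative_unique_within[OF ne D0])
    have "((\<lambda>h. mat_symbol (S h) \<xi> ** mat_symbol (S t) \<xi>) has_vector_derivative
        mat_symbol G \<xi> ** mat_symbol (S t) \<xi>) (at 0 within {0..})"
      by (rule bounded_linear.has_vector_derivative[OF bounded_bilinear.bounded_linear_left[OF
          bounded_bilinear_matrix_mult] G0])
    then show "((\<lambda>h. mat_symbol (S (t + h)) \<xi>) has_vector_derivative
        mat_symbol G \<xi> ** mat_symbol (S t) \<xi>) (at 0 within {0..})"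
      by (rule has_vector_derivative_transform[rotated 2])
        (use idcs_symbol_semigroup[OF S _ t] in \<open>auto simp: add.commute\<close>)
  qed
  have R: "mat_symbol D \<xi> = mat_symbol (S t) \<xi> ** mat_symbol G \<xi>" for \<xi>
  proof (rule vector_derivative_unique_within[OF ne D0])
    have "((\<lambda>h. mat_symbol (S t) \<xi> ** mat_symbol (S h) \<xi>) has_vector_derivative
        mat_symbol (S t) \<xi> ** mat_symbol G \<xi>) (at 0 within {0..})"
      by (rule bounded_linear.has_vector_derivative[OF bounded_bilinear.bounded_linear_right[OF
          bounded_bilinear_matrix_mult] G0])
    then show "((\<lambda>h. mat_symbol (S (t + h)) \<xi>) has_vector_derivative
        mat_symbol (S t) \<xi> ** mat_symbol G \<xi>) (at 0 within {0..})"
      by (rule has_vector_derivative_transform[rotated 2])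
        (use idcs_symbol_semigroup[OF S t] in auto)
  qed
  from L have "mat_symbol D = (\<lambda>\<xi>. mat_symbol G \<xi> ** mat_symbol (S t) \<xi>)" by blast
  with idcs_symbol_derivative(2)[OF S t D, of \<alpha> \<xi>]
  show "((\<lambda>s. mderiv \<alpha> (mat_symbol (S s)) \<xi>) has_vector_derivative
      mderiv \<alpha> (\<lambda>\<xi>. mat_symbol G \<xi> ** mat_symbol (S t) \<xi>) \<xi>) (at t within {0..})" by simp
  show "mat_symbol G \<xi> ** mat_symbol (S t) \<xi> = mat_symbol (S t) \<xi> ** mat_symbol G \<xi>"
    using L R by metis
qed

section \<open>The growth bound is at most the spectral bound\<close>

lemma mat_scale_symbol:
  assumes "A $ i $ j \<in> OC"
  shows "has_symbol (mat_scale r A $ i $ j) (\<lambda>\<xi>. of_real r * fourier_symbol (A $ i $ j) \<xi>)"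
  using has_symbol_scale[OF has_symbol_OC[OF assms]] by (simp add: mat_scale_def)

lemma mat_conv_fun_add:
  assumes A: "\<And>i j. has_symbol (A $ i $ j) (g i j)" and phi: "\<phi> \<in> schwartz" "\<psi> \<in> schwartz"
  shows "mat_conv_fun A (\<lambda>x. \<phi> x + \<psi> x) = (\<lambda>x. mat_conv_fun A \<phi> x + mat_conv_fun A \<psi> x)"
proof -
  have c: "(\<lambda>x. f x $ j) \<in> schwartz" if "f \<in> schwartz" for f j
    by (rule schwartz_linear[OF bounded_linear_vec_nth that])
  show ?thesis
    by (simp add: mat_conv_fun_def vec_eq_iff fun_eq_iff conv_fun_add[OF A c[OF phi(1)] c[OF phi(2)]] sum.distrib)
qed

lemma mat_conv_fun_scale:
  assumes A: "\<And>i j. has_symbol (A $ i $ j) (g i j)" and phi: "\<phi> \<in> schwartz"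
  shows "mat_conv_fun A (\<lambda>x. c *s \<phi> x) = (\<lambda>x. c *s mat_conv_fun A \<phi> x)"
proof -
  have c: "(\<lambda>x. \<phi> x $ j) \<in> schwartz" for j
    by (rule schwartz_linear[OF bounded_linear_vec_nth phi])
  show ?thesis
    by (simp add: mat_conv_fun_def vec_eq_iff fun_eq_iff conv_fun_cmult[OF A c] sum_distrib_left)
qed

text \<open>The gap between \<open>\<omega>'\<close> and \<open>\<omega>\<close> absorbs the powers of \<open>1 + t\<close>.\<close>

lemma slow_scaled_symbols:
  fixes S :: "real \<Rightarrow> ('n::finite, 'm::finite) mfunctional"
  assumes S: "idcs S" and G: "generating_distribution S G"
    and spec: "\<And>z \<xi>. z \<in> spectrum (mat_symbol G \<xi>) \<Longrightarrow> Re z \<le> \<omega>'" and \<omega>: "\<omega>' < \<omega>"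
  shows "slow {0..} (\<lambda>t \<xi>. of_real (exp (- \<omega> * t)) * fourier_symbol (S t $ i $ j) \<xi>)"
proof -
  have OC: "S t \<in> OC_mat" if "t \<ge> 0" for t using S that by (simp add: idcs_def)
  have sm: "smooth (fourier_symbol (S t $ i $ j))" if "t \<ge> 0" for t
    by (rule slow_smooth[OF has_symbol_slow[OF has_symbol_OC]]) (use OC[OF that] in \<open>simp add: OC_mat_def\<close>)
  have "has_OC_deriv S G 0" using G by (simp add: generating_distribution_def)
  then have slow_G: "slow1 (mat_symbol G)"
    by (intro slow_mat_symbol idcs_symbol_derivative(1)[OF S order_refl])
  have growth: "exp_growth \<omega>' (\<lambda>t \<xi>. mderiv \<alpha> (mat_symbol (S t)) \<xi>)" for \<alpha>
    by (rule symbol_derivatives_growth[OF slow_G spec smooth_mat_symbol[OF OC]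
        idcs_symbol_equation[OF S G] idcs_symbol_0[OF S]])
  show ?thesis
    unfolding slow_def
  proof (intro conjI ballI allI)
    fix t :: real assume "t \<in> {0..}"
    then show "smooth (\<lambda>\<xi>. of_real (exp (- \<omega> * t)) * fourier_symbol (S t $ i $ j) \<xi>)"
      by (intro smooth_linear[OF bounded_linear_mult_right sm]) simp
  next
    fix \<alpha> :: "'n list"
    obtain C N where C: "C \<ge> 0" and N: "\<And>t \<xi>. t \<ge> 0 \<Longrightarrow> norm (mderiv \<alpha> (mat_symbol (S t)) \<xi>)
        \<le> C * ((1 + t) * (1 + norm \<xi>)) ^ N * exp (\<omega>' * t)"
      using growth[of \<alpha>] unfolding exp_growth_def by blast
    have "\<omega> - \<omega>' > 0" using \<omega> by simp
    then obtain B where B: "B \<ge> 0" "\<And>t::real. t \<ge> 0 \<Longrightarrow> (1 + t) ^ N \<le> B * exp ((\<omega> - \<omega>') * t)"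
      by (rule power_le_exp) blast
    have "norm (mderiv \<alpha> (\<lambda>\<xi>. of_real (exp (- \<omega> * t)) * fourier_symbol (S t $ i $ j) \<xi>) \<xi>)
        \<le> (C * B) * (1 + norm \<xi>) ^ N" if t: "t \<ge> 0" for t \<xi>
    proof -
      have "mderiv \<alpha> (\<lambda>\<xi>. of_real (exp (- \<omega> * t)) * fourier_symbol (S t $ i $ j) \<xi>) \<xi>
          = of_real (exp (- \<omega> * t)) * mderiv \<alpha> (mat_symbol (S t)) \<xi> $ i $ j"
        unfolding mderiv_linear[OF bounded_linear_mult_right smooth_diff_order[OF sm[OF t]] order_refl]
          mderiv_mat_symbol[OF OC[OF t]] ..
      then have "norm (mderiv \<alpha> (\<lambda>\<xi>. of_real (exp (- \<omega> * t)) * fourier_symbol (S t $ i $ j) \<xi>) \<xi>)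
          = exp (- \<omega> * t) * norm (mderiv \<alpha> (mat_symbol (S t)) \<xi> $ i $ j)"
        by (simp only: norm_mult norm_of_real abs_exp_cancel)
      also have "\<dots> \<le> exp (- \<omega> * t) * norm (mderiv \<alpha> (mat_symbol (S t)) \<xi>)"
        by (intro mult_left_mono order_trans[OF Finite_Cartesian_Product.norm_nth_le
            Finite_Cartesian_Product.norm_nth_le]) simp
      also have "\<dots> \<le> exp (- \<omega> * t) * (C * ((1 + t) * (1 + norm \<xi>)) ^ N * exp (\<omega>' * t))"
        by (intro mult_left_mono N t) simp
      also have "\<dots> = C * (1 + t) ^ N * (1 + norm \<xi>) ^ N * (exp (- \<omega> * t) * exp (\<omega>' * t))"
        by (simp add: power_mult_distrib mult_ac)
      also have "\<dots> \<le> C * (B * exp ((\<omega> - \<omega>') * t)) * (1 + norm \<xi>) ^ N * (exp (- \<omega> * t) * exp (\<omega>' * t))"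
        using C by (intro mult_right_mono mult_left_mono B t) auto
      also have "\<dots> = C * B * (1 + norm \<xi>) ^ N * (exp ((\<omega> - \<omega>') * t) * (exp (- \<omega> * t) * exp (\<omega>' * t)))"
        by (simp only: mult_ac)
      also have "exp ((\<omega> - \<omega>') * t) * (exp (- \<omega> * t) * exp (\<omega>' * t)) = 1"
        by (simp add: left_diff_distrib flip: exp_add)
      finally show ?thesis by simp
    qed
    then show "\<exists>C N. \<forall>t\<in>{0..}. \<forall>\<xi>. norm (mderiv \<alpha> (\<lambda>\<xi>. of_real (exp (- \<omega> * t)) * fourier_symbol (S t $ i $ j) \<xi>) \<xi>)
        \<le> C * (1 + norm \<xi>) ^ N" by (intro exI[of _ "C * B"] exI[of _ N]) auto
  qed
qed

lemma growth_bound_le: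
  fixes S :: "real \<Rightarrow> ('n::finite, 'm::finite) mfunctional"
  assumes S: "idcs S" and G: "generating_distribution S G"
    and spec: "\<And>z \<xi>. z \<in> spectrum (mat_symbol G \<xi>) \<Longrightarrow> Re z \<le> \<omega>'" and \<omega>: "\<omega>' < \<omega>"
  shows "growth_bound S \<le> ereal \<omega>"
  unfolding growth_bound_def
proof (rule INF_lower, intro CollectI conjI)
  let ?A = "\<lambda>t. mat_scale (exp (- \<omega> * t)) (S t)"
  let ?g = "\<lambda>i j t \<xi>. of_real (exp (- \<omega> * t)) * fourier_symbol (S t $ i $ j) \<xi>"
  let ?U = "\<lambda>t. restrict (mat_conv_fun (?A t)) schwartz"
  have sym: "has_symbol (?A t $ i $ j) (?g i j t)" if "t \<ge> 0" for t i j
    by (rule mat_scale_symbol) (use S that in \<open>simp add: idcs_def OC_mat_def\<close>)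
  have t: "tame {0..} (\<lambda>t. mat_conv_fun (?A t))"
    by (rule tame_mat_conv_fun[OF slow_scaled_symbols[OF S G spec \<omega>] sym]) auto
  show "equicontinuous (scaled_ops S \<omega>)"
    unfolding scaled_ops_def by (rule tame_equicontinuous, rule tame_cong[OF t]) simp
  show "scaled_ops S \<omega> \<subseteq> schwartz_ops (*s)"
    unfolding scaled_ops_def
  proof (rule image_subsetI)
    fix t :: real assume t0: "t \<in> {0..}"
    define B where "B = ?A t"
    have sym: "has_symbol (B $ i $ j) (?g i j t)" for i j
      using sym t0 unfolding B_def by simp
    have "tame {()} (\<lambda>_. mat_conv_fun B)"
      unfolding B_def using t t0 unfolding tame_def by (metis singletonD)
    then have "continuous_map schwartz_topology schwartz_topology (mat_conv_fun B)"
      by (rule tame_continuous) (rule mat_conv_fun_add[OF sym])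
    then have "continuous_map schwartz_topology schwartz_topology (restrict (mat_conv_fun B) schwartz)"
      by (rule continuous_map_eq) simp
    moreover have "(\<lambda>x. c *s \<phi> x) \<in> schwartz" if "\<phi> \<in> schwartz" for c and \<phi> :: "real^'n \<Rightarrow> complex^'m"
      by (rule schwartz_linear[OF bounded_bilinear.bounded_linear_right[OF bounded_bilinear_vector_scalar_mult] that])
    ultimately show "?U t \<in> schwartz_ops (*s)"
      unfolding schwartz_ops_def B_def[symmetric]
      by (simp add: schwartz_add mat_conv_fun_add[OF sym] mat_conv_fun_scale[OF sym])
  qed
qed

section \<open>The spectral bound is at most the growth bound\<close>

text \<open>The derivative of \<open>e\<^bsup>-z t\<^esup> A\<^sub>t v\<close> vanishes.\<close>

lemma idcs_eigenvector:
  fixes S :: "real \<Rightarrow> ('n::finite, 'm::finite) mfunctional"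
  assumes S: "idcs S" and G: "generating_distribution S G"
    and v: "mat_symbol G \<xi> *v v = z *s v" and t: "t \<ge> 0"
  shows "mat_symbol (S t) \<xi> *v v = exp (z * of_real t) *s v"
proof -
  let ?A = "\<lambda>t. mat_symbol (S t) \<xi>"
  let ?w = "\<lambda>t. exp (- z * of_real t) *s (?A t *v v)"
  have "norm (?w t - ?w 0) \<le> 0 * (t - 0)"
  proof (rule norm_diff_le_vector_derivative[OF t, where f' = "\<lambda>_. 0"])
    fix s assume s: "s \<in> {0..t}"
    have "((\<lambda>s. exp (- z * of_real s)) has_vector_derivative - z * exp (- z * of_real s)) (at s within {0..t})"
      by (rule has_vector_derivative_real_field[THEN has_vector_derivative_at_within])
        (auto intro!: derivative_eq_intros)
    moreover have "(?A has_vector_derivative mat_symbol G \<xi> ** ?A s) (at s within {0..})"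
      using idcs_symbol_equation(1)[OF S G, of s "[]"] s by simp
    then have "(?A has_vector_derivative mat_symbol G \<xi> ** ?A s) (at s within {0..t})"
      by (rule has_vector_derivative_within_subset) auto
    then have "((\<lambda>s. ?A s *v v) has_vector_derivative (mat_symbol G \<xi> ** ?A s) *v v) (at s within {0..t})"
      by (rule bounded_linear.has_vector_derivative[OF bounded_bilinear.bounded_linear_left[OF
          bounded_bilinear_matrix_vector_mult]])
    ultimately have "(?w has_vector_derivative exp (- z * of_real s) *s ((mat_symbol G \<xi> ** ?A s) *v v)
        + (- z * exp (- z * of_real s)) *s (?A s *v v)) (at s within {0..t})"
      by (rule bounded_bilinear.has_vector_derivative[OF bounded_bilinear_vector_scalar_mult])
    moreover have "(mat_symbol G \<xi> ** ?A s) *v v = z *s (?A s *v v)"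
      using s idcs_symbol_equation(2)[OF S G, of s \<xi>]
      by (simp add: matrix_vector_mul_assoc[symmetric] v vector_scalar_commute)
    moreover have "exp (- z * of_real s) *s (z *s (?A s *v v)) + (- z * exp (- z * of_real s)) *s (?A s *v v) = 0"
      by (simp add: vec_eq_iff)
    ultimately show "(?w has_vector_derivative 0) (at s within {0..t})" by (simp only:)
  qed simp
  then have "?w t = v" using idcs_symbol_0[OF S] by simp
  then have "exp (z * of_real t) *s ?w t = exp (z * of_real t) *s v" by simp
  then show ?thesis by (simp add: vector_smult_assoc flip: exp_add)
qed

text \<open>Test the equicontinuous family on \<open>x \<mapsto> \<gamma>(x) v\<close> for the Gaussian \<open>\<gamma>\<close> and an eigenvector \<open>v\<close> of
  \<open>(\<F> G)(\<xi>)\<close>: the Fourier transforms at \<open>\<xi>\<close> of the images are multiples of \<open>e\<^bsup>(z - \<omega>) t\<^esup>\<close>, and they stay bounded.\<close>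

lemma spectrum_le_of_equicontinuous:
  fixes S :: "real \<Rightarrow> ('n::finite, 'm::finite) mfunctional"
  assumes S: "idcs S" and G: "generating_distribution S G"
    and eq: "equicontinuous (scaled_ops S \<omega>)" and z: "z \<in> spectrum (mat_symbol G \<xi>)"
  shows "Re z \<le> \<omega>"
proof (rule ccontr)
  assume "\<not> Re z \<le> \<omega>"
  define \<delta> where "\<delta> = Re z - \<omega>"
  then have d: "\<delta> > 0" using \<open>\<not> Re z \<le> \<omega>\<close> by simp
  let ?n = "2 * CARD('n)"
  let ?A = "\<lambda>t. mat_scale (exp (- \<omega> * t)) (S t)"
  let ?U = "\<lambda>t. mat_conv_fun (?A t)"
  obtain v where v: "v \<noteq> 0" "mat_symbol G \<xi> *v v = z *s v"
    using z unfolding spectrum_iff_eigenvector by blast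
  obtain i where i: "v $ i \<noteq> 0" using v(1) by (auto simp: vec_eq_iff)
  obtain V :: "(real^'n \<Rightarrow> complex^'m) set" where V: "openin schwartz_topology V" "(\<lambda>x. 0) \<in> V"
    "V \<subseteq> {g \<in> schwartz. schwartz_norm ?n (\<lambda>x. g x - 0) < 1}"
    by (rule schwartz_ball_nhd[OF schwartz_zero, of 1 ?n]) auto
  obtain W :: "(real^'n \<Rightarrow> complex^'m) set" where W: "openin schwartz_topology W" "(\<lambda>x. 0) \<in> W"
    "\<And>u. u \<in> scaled_ops S \<omega> \<Longrightarrow> u ` W \<subseteq> V"
    using eq V(1,2) unfolding equicontinuous_def by metis
  obtain M \<epsilon> where e: "\<epsilon> > 0" and M: "{g \<in> schwartz. schwartz_norm M (\<lambda>x. g x - 0) < \<epsilon>} \<subseteq> W"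
    by (rule schwartz_nhd_ball[OF W(1,2)])
  let ?\<phi> = "\<lambda>x::real^'n. gauss x *s v"
  have phi: "?\<phi> \<in> schwartz"
    by (rule schwartz_linear[OF bounded_bilinear.bounded_linear_left[OF bounded_bilinear_vector_scalar_mult] schwartz_gauss])
  \<comment> \<open>scale the test function into the neighbourhood\<close>
  define r where "r = \<epsilon> / (1 + schwartz_norm M ?\<phi>)"
  have nn: "schwartz_norm M ?\<phi> \<ge> 0" by (rule schwartz_norm_nonneg[OF phi])
  have r: "r > 0" using e nn by (simp add: r_def)
  let ?\<psi> = "\<lambda>x. r *\<^sub>R ?\<phi> x"
  have psi: "?\<psi> \<in> schwartz" by (rule schwartz_linear[OF bounded_linear_scaleR_right phi])
  have "schwartz_norm M ?\<psi> \<le> \<bar>r\<bar> * schwartz_norm M ?\<phi>" by (rule schwartz_norm_scaleR[OF phi])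
  also have "\<dots> < \<epsilon>" using r e nn by (simp add: r_def field_simps)
  finally have psiW: "?\<psi> \<in> W" using M psi by auto
  define b where "b = r * norm (gauss_integral TYPE('n)) * norm (gauss \<xi>) * norm (v $ i)"
  have b: "b > 0" using r i by (simp add: b_def gauss_integral_nonzero)
  let ?w = "\<integral>x. weight (x :: real^'n) \<partial>lborel"
  have bound: "exp (\<delta> * t) * b \<le> ?w" if t: "t \<ge> 0" for t
  proof -
    have "?U t ?\<psi> \<in> V"
      using W(3)[of "restrict (?U t) schwartz"] psiW psi t by (auto simp: scaled_ops_def)
    then have U: "?U t ?\<psi> \<in> schwartz" "schwartz_norm ?n (?U t ?\<psi>) < 1" using V(3) by auto
    have sym: "has_symbol (?A t $ i $ j) (\<lambda>\<xi>. of_real (exp (- \<omega> * t)) * fourier_symbol (S t $ i $ j) \<xi>)" for j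
      by (rule mat_scale_symbol) (use S t in \<open>simp add: idcs_def OC_mat_def\<close>)
    have c: "(\<lambda>y. ?\<psi> y $ j) \<in> schwartz" for j by (rule schwartz_linear[OF bounded_linear_vec_nth psi])
    have Fc: "fourier (\<lambda>y. ?\<psi> y $ j) \<xi> = of_real r * v $ j * gauss_integral TYPE('n) * gauss \<xi>" for j
    proof -
      have "fourier (\<lambda>y. ?\<psi> y $ j) \<xi> = fourier (\<lambda>y. (of_real r * v $ j) * gauss y) \<xi>"
        by (simp add: scaleR_conv_of_real[of r "x * y" for x y :: complex] mult_ac)
      then show ?thesis unfolding fourier_cmult fourier_gauss by (simp add: mult.assoc)
    qed
    have F: "fourier (\<lambda>x. ?U t ?\<psi> x $ i) \<xi> = (\<Sum>j\<in>UNIV. fourier (conv_fun (?A t $ i $ j) (\<lambda>y. ?\<psi> y $ j)) \<xi>)"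
    proof -
      have "(\<lambda>x. ?U t ?\<psi> x $ i) = (\<lambda>x. \<Sum>j\<in>UNIV. conv_fun (?A t $ i $ j) (\<lambda>y. ?\<psi> y $ j) x)"
        by (simp add: mat_conv_fun_def)
      then show ?thesis
        by (simp only:) (intro fourier_sum schwartz_decaying schwartz_conv_fun[OF sym c])
    qed
    also have "\<dots> = (\<Sum>j\<in>UNIV. (of_real (r * exp (- \<omega> * t)) * gauss_integral TYPE('n) * gauss \<xi>)
        * (mat_symbol (S t) \<xi> $ i $ j * v $ j))"
      unfolding fourier_conv_fun[OF sym c] Fc
      by (intro sum.cong refl) (simp add: mat_symbol_nth mult_ac)
    also have "\<dots> = (of_real (r * exp (- \<omega> * t)) * gauss_integral TYPE('n) * gauss \<xi>) * (mat_symbol (S t) \<xi> *v v) $ i"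
      by (simp add: matrix_vector_mult_def sum_distrib_left)
    also have "(mat_symbol (S t) \<xi> *v v) $ i = exp (z * of_real t) * v $ i"
      unfolding idcs_eigenvector[OF S G v(2) t] by simp
    finally have "norm (fourier (\<lambda>x. ?U t ?\<psi> x $ i) \<xi>)
        = (r * exp (- \<omega> * t) * norm (gauss_integral TYPE('n)) * norm (gauss \<xi>)) * (exp (Re z * t) * norm (v $ i))"
      using r by (simp add: norm_mult norm_exp_eq_Re)
    also have "\<dots> = (exp (- \<omega> * t) * exp (Re z * t)) * b" by (simp add: b_def mult_ac)
    also have "exp (- \<omega> * t) * exp (Re z * t) = exp (\<delta> * t)"
      by (simp add: \<delta>_def left_diff_distrib flip: exp_add)
    finally have "norm (fourier (\<lambda>x. ?U t ?\<psi> x $ i) \<xi>) = exp (\<delta> * t) * b" .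
    moreover have "norm (fourier (\<lambda>x. ?U t ?\<psi> x $ i) \<xi>) \<le> 1 * ?w"
    proof (rule fourier_bound)
      show "decaying ?n (\<lambda>x. ?U t ?\<psi> x $ i)"
        by (rule schwartz_decaying[OF schwartz_linear[OF bounded_linear_vec_nth U(1)]])
      fix x
      have "(1 + norm x) ^ ?n * norm (?U t ?\<psi> x $ i) \<le> (1 + norm x) ^ ?n * norm (mderiv [] (?U t ?\<psi>) x)"
        by (intro mult_left_mono) (auto simp: Finite_Cartesian_Product.norm_nth_le)
      also have "\<dots> \<le> schwartz_norm ?n (?U t ?\<psi>)" by (rule schwartz_norm_upper[OF U(1)]) auto
      finally show "(1 + norm x) ^ ?n * norm (?U t ?\<psi> x $ i) \<le> 1" using U(2) by simp
    qed
    ultimately show ?thesis by simp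
  qed
  have "?w \<ge> 0" by (intro integral_nonneg_AE AE_I2) auto
  \<comment> \<open>at this time the estimate contradicts \<open>1 + u \<le> e\<^sup>u\<close>\<close>
  then have "?w / b / \<delta> \<ge> 0" using b d by simp
  from bound[OF this] have "exp (?w / b) * b \<le> ?w" using d by simp
  then have "exp (?w / b) \<le> ?w / b" using b by (simp add: le_divide_eq)
  then show False using exp_ge_add_one_self[of "?w / b"] by linarith
qed

theorem theorem2:
  fixes S :: "real \<Rightarrow> ('n::finite, 'm::finite) mfunctional"
    and G :: "('n, 'm) mfunctional"
  assumes "idcs S"
    and "generating_distribution S G"
  shows "growth_bound S = spectral_bound G"
proof (rule antisym)
  show "growth_bound S \<le> spectral_bound G"
  proof (rule dense_ge)
    fix x assume x: "spectral_bound G < x"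
    then obtain \<omega> where \<omega>: "spectral_bound G < ereal \<omega>" "ereal \<omega> < x" using ereal_dense2 by blast
    then obtain \<omega>' where \<omega>': "spectral_bound G < ereal \<omega>'" "\<omega>' < \<omega>"
      using ereal_dense2[OF \<omega>(1)] by auto
    have "Re z \<le> \<omega>'" if "z \<in> spectrum (mat_symbol G \<xi>)" for z \<xi>
    proof -
      have "ereal (Re z) \<le> spectral_bound G"
        unfolding spectral_bound_def by (rule SUP_upper) (use that in blast)
      also have "\<dots> < ereal \<omega>'" by (rule \<omega>')
      finally show ?thesis by simp
    qed
    from growth_bound_le[OF assms this \<omega>'(2)] \<omega>(2) show "growth_bound S \<le> x" by (meson less_imp_le order_trans)
  qed
  show "spectral_bound G \<le> growth_bound S"
    unfolding spectral_bound_def growth_bound_def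
    using spectrum_le_of_equicontinuous[OF assms] by (intro SUP_least INF_greatest) auto
qed

end
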